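(* Let $\mathfrak n$ be a square-free nonzero ideal of $A$, and let $k\ge1$ and $0\le l\le q-2$ be integers with $k\equiv 2l\pmod{q-1}$. The operators $U_{\mathfrak p}$, for $\mathfrak p$ ranging over the prime divisors of $\mathfrak n$, are simultaneously diagonalizable on $S_{k,l}^{\mathrm{new}}(\Gamma_0(\mathfrak n))$.
   Context: Let $q$ be a power of an odd prime, $A=\mathbb{F}_q[T]$, $K_\infty=\mathbb{F}_q((1/T))$, $C$ the completion of an algebraic closure of $K_\infty$, and $\Omega=C\setminus K_\infty$ the Drinfeld upper half-plane with its rigid analytic structure. For $\gamma=\begin{pmatrix} a & b \\ c & d \end{pmatrix}\in\mathrm{GL}_2(K_\infty)$ and $f:\Omega\to C$ rigid holomorphic put $(f|_{k,l}\gamma)(z)=(\det\gamma)^l(cz+d)^{-k}f(\gamma z)$. For a nonzero ideal $\mathfrak n=(n)$ of $A$ ($n$ monic), $\Gamma_0(\mathfrak n)=\{\begin{pmatrix} a & b \\ c & d \end{pmatrix}\in\mathrm{GL}_2(A): c\in\mathfrak n\}$. Let $\tilde\pi$ be the Carlitz period (so $L=\tilde\pi A$ is the lattice of the Carlitz module $\rho_T=TX+X^q$), $e_L(z)=z\prod_{0\ne\lambda\in L}(1-z/\lambda)$, $u(z)=1/e_L(\tilde\pi z)$. $S_{k,l}(\Gamma_0(\mathfrak n))$ is the (finite-dimensional) $C$-space of Drinfeld cusp forms of weight $k$, type $l$: rigid holomorphic $f:\Omega\to C$ with $f|_{k,l}\gamma=f$ for all $\gamma\in\Gamma_0(\mathfrak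 n)$ which are holomorphic and vanish at the cusps, i.e. for every $\gamma\in\mathrm{GL}_2(A)$ the expansion of $f|_{k,l}\gamma$ in powers of $u(z/n)$ (for $\inf_{x\in K_\infty}|z-x|$ large) has only positive powers. For a prime $\mathfrak p=(P)\mid\mathfrak n$ ($P$ monic irreducible) and $f\in S_{k,l}(\Gamma_0(\mathfrak n))$: $U_{\mathfrak p}(f)=P^{k-l}\sum_{Q\in A,\ \deg Q<\deg P}f|_{k,l}\begin{pmatrix} 1 & Q \\ 0 & P \end{pmatrix}$; $\mathrm{Tr}^{\mathfrak n}_{\mathfrak n/\mathfrak p}(f)=\sum_{\gamma\in\Gamma_0(\mathfrak n)\backslash\Gamma_0(\mathfrak n/\mathfrak p)}f|_{k,l}\gamma$; $f|W_{\mathfrak p}^{(\mathfrak n)}=f|_{k,l}\begin{pmatrix} P & b \\ n & P d \end{pmatrix}$ with $b,d\in A$, $P^2d-nb=P$ (independent of choice; $\mathfrak n$ square-free); $\mathrm{Tr}'^{\,\mathfrak n}_{\mathfrak n/\mathfrak p}(f)=\mathrm{Tr}^{\mathfrak n}_{\mathfrak n/\mathfrak p}(f|W_{\mathfrak p}^{(\mathfrak n)})$. Then $S^{\mathrm{new}}_{k,l}(\Gamma_0(\mathfrak n))=\bigcap_{\mathfrak p\mid\mathfrak n}\big(\ker(\mathrm{Tr}^{\mathfrak n}_{\mathfrak n/\mathfrak p})\cap\ker(\mathrm{Tr}'^{\,\mathfrak n}_{\mathfrak n/\mathfrak p})\big)\subseteq S_{k,l}(\Gamma_0(\mathfrak n))$,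 intersection over prime divisors $\mathfrak p$ of $\mathfrak n$; it is stable under each $U_{\mathfrak p}$, $\mathfrak p\mid\mathfrak n$. *)

theory Defs
  imports
    "HOL-Algebra.Algebraic_Closure_Type"
    "HOL-Computational_Algebra.Computational_Algebra"
    "HOL-Number_Theory.Cong"
    "HOL-Library.Function_Algebras"
    "HOL-Analysis.Analysis"
begin

section \<open>The fields\<close>

text \<open>
  The finite field is a type \<open>'q\<close>, so that \<open>q = CARD('q)\<close>.  The ring \<open>A\<close> of polynomials over it in
  \<open>T\<close> is \<open>'q poly\<close>, and the field \<open>K\<^sub>\<infinity>\<close> of Laurent series in \<open>1/T\<close> is \<open>'q fls\<close>: the
  indeterminate \<^const>\<open>fls_X\<close> stands for \<open>1/T\<close>, hence \<^const>\<open>fls_X_inv\<close> for \<open>T\<close>.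
\<close>

definition poly_to_K :: "'q::field poly \<Rightarrow> 'q fls" where
  "poly_to_K p = poly (map_poly fls_const p) fls_X_inv"

definition abs_K :: "'q::{finite,field} fls \<Rightarrow> real" where
  "abs_K x = (if x = 0 then 0 else real CARD('q) powi (- fls_subdegree x))"

text \<open>
  The field \<open>C\<close> is a type \<open>'c\<close> whose metric comes from a nonarchimedean absolute value
  \<open>\<bar>x\<bar> = dist x 0\<close>; completeness is part of its sort.  The map \<open>\<iota>\<close> exhibits it as
  a completion of an algebraic closure of \<open>K\<^sub>\<infinity>\<close>.  This determines \<open>C\<close> up to isometric isomorphism,
  as the absolute value of \<open>K\<^sub>\<infinity>\<close> extends uniquely to its algebraic closure.
\<close>

locale completed_alg_closure =
  fixes \<iota> :: "'q::{finite,field} fls alg_closure \<Rightarrow> 'c::{field,complete_space}"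
  assumes \<iota>_one: "\<iota> 1 = 1"
    and \<iota>_add: "\<iota> (x + y) = \<iota> x + \<iota> y"
    and \<iota>_mult: "\<iota> (x * y) = \<iota> x * \<iota> y"
    and dist_diff: "dist (u :: 'c) v = dist (u - v) 0"
    and dist_mult: "dist ((u :: 'c) * v) 0 = dist u 0 * dist v 0"
    and dist_add: "dist ((u :: 'c) + v) 0 \<le> max (dist u 0) (dist v 0)"
    and dist_K: "dist (\<iota> (to_ac a)) 0 = abs_K a"
    and dense: "closure (range \<iota>) = UNIV"

definition of_K :: "('q::field fls alg_closure \<Rightarrow> 'c) \<Rightarrow> 'q fls \<Rightarrow> 'c" where
  "of_K \<iota> x = \<iota> (to_ac x)"

definition of_A :: "('q::field fls alg_closure \<Rightarrow> 'c) \<Rightarrow> 'q poly \<Rightarrow> 'c" where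
  "of_A \<iota> p = of_K \<iota> (poly_to_K p)"


section \<open>The Drinfeld upper half-plane\<close>

definition upper_half :: "('q::field fls alg_closure \<Rightarrow> 'c) \<Rightarrow> 'c set" where
  "upper_half \<iota> = - range (of_K \<iota>)"

text \<open>\<open>imag_abs \<iota> z\<close> is the infimum of \<open>\<bar>z - x\<bar>\<close> over \<open>x \<in> K\<^sub>\<infinity>\<close>.\<close>

definition imag_abs :: "('q::field fls alg_closure \<Rightarrow> 'c::metric_space) \<Rightarrow> 'c \<Rightarrow> real" where
  "imag_abs \<iota> z = infdist z (range (of_K \<iota>))"

text \<open>
  The rigid structure on \<open>\<Omega>\<close> is given by its standard admissible covering by the affinoids
  \<open>{z. \<bar>z\<bar> \<le> q\<^sup>m, \<bar>z - x\<bar> \<ge> q\<^sup>-\<^sup>m for all x \<in> K\<^sub>\<infinity>}\<close>.  Each of them is the complement of finitely many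
  open discs in the projective line, so a function on it is holomorphic iff it is a uniform limit of
  rational functions without poles there.
\<close>

definition half_plane_affinoid ::
    "('q::{finite,field} fls alg_closure \<Rightarrow> 'c::{field,metric_space}) \<Rightarrow> nat \<Rightarrow> 'c set" where
  "half_plane_affinoid \<iota> m =
     {z. dist z 0 \<le> real CARD('q) ^ m \<and> imag_abs \<iota> z \<ge> 1 / real CARD('q) ^ m}"

text \<open>
  A function on \<open>\<Omega>\<close> is represented by its extension by zero to \<open>C\<close>, so that equality,
  linear independence and spans of functions on \<open>\<Omega>\<close> are those of functions on \<open>C\<close>.
\<close>

definition rigid_holomorphic ::
    "('q::{finite,field} fls alg_closure \<Rightarrow> 'c::{field,metric_space}) \<Rightarrow> ('c \<Rightarrow> 'c) \<Rightarrow> bool" where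
  "rigid_holomorphic \<iota> f \<longleftrightarrow>
     (\<forall>z. z \<notin> upper_half \<iota> \<longrightarrow> f z = 0) \<and>
     (\<forall>m. \<exists>r s :: nat \<Rightarrow> 'c poly.
        (\<forall>j. \<forall>z\<in>half_plane_affinoid \<iota> m. poly (s j) z \<noteq> 0) \<and>
        uniform_limit (half_plane_affinoid \<iota> m) (\<lambda>j z. poly (r j) z / poly (s j) z) f sequentially)"


section \<open>The Carlitz period and the parameter at infinity\<close>

text \<open>The product is unordered, i.e. the limit over the finite subsets of \<open>L - {0}\<close>.\<close>

definition lattice_exp :: "'c::{field,t2_space} set \<Rightarrow> 'c \<Rightarrow> 'c" where
  "lattice_exp L z = z * Lim (finite_subsets_at_top (L - {0})) (\<lambda>F. \<Prod>w\<in>F. 1 - z / w)"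

definition scaled_lattice :: "('q::field fls alg_closure \<Rightarrow> 'c::field) \<Rightarrow> 'c \<Rightarrow> 'c set" where
  "scaled_lattice \<iota> \<pi> = range (\<lambda>a. \<pi> * of_A \<iota> a)"

text \<open>
  \<open>\<pi> A\<close> is the lattice of the Carlitz module \<open>\<rho>\<^sub>T = T X + X\<^sup>q\<close>: its exponential satisfies
  \<open>e(T z) = \<rho>\<^sub>T(e(z))\<close>.  This determines \<open>\<pi>\<close> up to a factor in the multiplicative group of
  the finite field, as does the definition of the Carlitz period.
\<close>

definition carlitz_period ::
    "('q::{finite,field} fls alg_closure \<Rightarrow> 'c::{field,t2_space}) \<Rightarrow> 'c \<Rightarrow> bool" where
  "carlitz_period \<iota> \<pi> \<longleftrightarrow> \<pi> \<noteq> 0 \<and>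
     (let e = lattice_exp (scaled_lattice \<iota> \<pi>); t = of_A \<iota> [:0, 1:]
      in \<forall>z. e (t * z) = t * e z + e z ^ CARD('q))"

definition u_param ::
    "('q::field fls alg_closure \<Rightarrow> 'c::{field,t2_space}) \<Rightarrow> 'c \<Rightarrow> 'c \<Rightarrow> 'c" where
  "u_param \<iota> \<pi> z = 1 / lattice_exp (scaled_lattice \<iota> \<pi>) (\<pi> * z)"


section \<open>Cusp forms\<close>

text \<open>
  For invertible \<open>\<gamma>\<close> this preserves the functions vanishing on \<open>K\<^sub>\<infinity>\<close>, also at a pole of \<open>\<gamma>\<close>,
  where the argument of \<open>f\<close> is \<open>0\<close> because \<open>x / 0 = 0\<close>.
\<close>

definition slash ::
    "('q::field fls alg_closure \<Rightarrow> 'c::field) \<Rightarrow> nat \<Rightarrow> nat \<Rightarrow> ('c \<Rightarrow> 'c) \<Rightarrow> 'q fls^2^2 \<Rightarrow> 'c \<Rightarrow> 'c" where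
  "slash \<iota> k l f \<gamma> = (\<lambda>z.
     let a = of_K \<iota> (\<gamma>$1$1); b = of_K \<iota> (\<gamma>$1$2); c = of_K \<iota> (\<gamma>$2$1); d = of_K \<iota> (\<gamma>$2$2)
     in of_K \<iota> (det \<gamma>) ^ l * (c * z + d) powi (- int k) * f ((a * z + b) / (c * z + d)))"

definition slash_A ::
    "('q::field fls alg_closure \<Rightarrow> 'c::field) \<Rightarrow> nat \<Rightarrow> nat \<Rightarrow> ('c \<Rightarrow> 'c) \<Rightarrow> 'q poly^2^2 \<Rightarrow> 'c \<Rightarrow> 'c" where
  "slash_A \<iota> k l f \<gamma> = slash \<iota> k l f (map_matrix poly_to_K \<gamma>)"

definition mat2 :: "'a \<Rightarrow> 'a \<Rightarrow> 'a \<Rightarrow> 'a \<Rightarrow> 'a::zero^2^2" where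
  "mat2 a b c d = vector [vector [a, b], vector [c, d]]"

definition Gamma0 :: "'q::field poly \<Rightarrow> ('q poly^2^2) set" where
  "Gamma0 n = {\<gamma>. invertible \<gamma> \<and> n dvd \<gamma>$2$1}"

text \<open>
  The expansion in \<open>u(z/n)\<close>, valid for \<open>imag_abs \<iota> z\<close> large, has only positive powers.
\<close>

definition vanishes_at_infinity ::
    "('q::field fls alg_closure \<Rightarrow> 'c::{field,metric_space}) \<Rightarrow> 'c \<Rightarrow> 'q poly \<Rightarrow> ('c \<Rightarrow> 'c) \<Rightarrow> bool" where
  "vanishes_at_infinity \<iota> \<pi> n f \<longleftrightarrow>
     (\<exists>(a :: nat \<Rightarrow> 'c) (R :: real). a 0 = 0 \<and>
        (\<forall>z\<in>upper_half \<iota>. imag_abs \<iota> z > R \<longrightarrow>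
           (\<lambda>i. a i * u_param \<iota> \<pi> (z / of_A \<iota> n) ^ i) sums f z))"

definition cusp_forms ::
    "('q::{finite,field} fls alg_closure \<Rightarrow> 'c::{field,metric_space}) \<Rightarrow> 'c \<Rightarrow> nat \<Rightarrow> nat \<Rightarrow> 'q poly
      \<Rightarrow> ('c \<Rightarrow> 'c) set" where
  "cusp_forms \<iota> \<pi> k l n =
     {f. rigid_holomorphic \<iota> f \<and>
         (\<forall>\<gamma>\<in>Gamma0 n. slash_A \<iota> k l f \<gamma> = f) \<and>
         (\<forall>\<gamma>. invertible \<gamma> \<longrightarrow> vanishes_at_infinity \<iota> \<pi> n (slash_A \<iota> k l f \<gamma>))}"


section \<open>Operators and newforms\<close>

text \<open>Primes and ideals of \<open>A\<close> are given by their monic generators.\<close>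

definition prime_divisor :: "'q::field poly \<Rightarrow> 'q poly \<Rightarrow> bool" where
  "prime_divisor P n \<longleftrightarrow> lead_coeff P = 1 \<and> irreducible P \<and> P dvd n"

definition U_op ::
    "('q::field fls alg_closure \<Rightarrow> 'c::field) \<Rightarrow> nat \<Rightarrow> nat \<Rightarrow> 'q poly \<Rightarrow> ('c \<Rightarrow> 'c) \<Rightarrow> 'c \<Rightarrow> 'c" where
  "U_op \<iota> k l P f = (\<lambda>z. of_A \<iota> P powi (int k - int l) *
     (\<Sum>Q | degree Q < degree P. slash_A \<iota> k l f (mat2 1 Q 0 P) z))"

text \<open>The right cosets in \<open>Gamma0 n \ Gamma0 m\<close>, for \<open>m\<close> dividing \<open>n\<close>.\<close>

definition Gamma0_cosets :: "'q::field poly \<Rightarrow> 'q poly \<Rightarrow> ('q poly^2^2) set set" where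
  "Gamma0_cosets n m = (\<lambda>\<gamma>. (\<lambda>\<delta>. \<delta> ** \<gamma>) ` Gamma0 n) ` Gamma0 m"

text \<open>
  On forms for \<open>Gamma0 n\<close> the choices of the coset representatives and, below, of \<open>b\<close> and \<open>d\<close>
  do not matter.
\<close>

definition trace_op ::
    "('q::field fls alg_closure \<Rightarrow> 'c::field) \<Rightarrow> nat \<Rightarrow> nat \<Rightarrow> 'q poly \<Rightarrow> 'q poly
      \<Rightarrow> ('c \<Rightarrow> 'c) \<Rightarrow> 'c \<Rightarrow> 'c" where
  "trace_op \<iota> k l n P f = (\<lambda>z.
     \<Sum>S\<in>Gamma0_cosets n (n div P). slash_A \<iota> k l f (SOME \<gamma>. \<gamma> \<in> S) z)"

definition W_matrix :: "'q::field poly \<Rightarrow> 'q poly \<Rightarrow> 'q poly^2^2" where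
  "W_matrix n P = (let (b, d) = SOME (b, d). P\<^sup>2 * d - n * b = P in mat2 P b n (P * d))"

definition twisted_trace_op ::
    "('q::field fls alg_closure \<Rightarrow> 'c::field) \<Rightarrow> nat \<Rightarrow> nat \<Rightarrow> 'q poly \<Rightarrow> 'q poly
      \<Rightarrow> ('c \<Rightarrow> 'c) \<Rightarrow> 'c \<Rightarrow> 'c" where
  "twisted_trace_op \<iota> k l n P f = trace_op \<iota> k l n P (slash_A \<iota> k l f (W_matrix n P))"

definition new_cusp_forms ::
    "('q::{finite,field} fls alg_closure \<Rightarrow> 'c::{field,metric_space}) \<Rightarrow> 'c \<Rightarrow> nat \<Rightarrow> nat \<Rightarrow> 'q poly
      \<Rightarrow> ('c \<Rightarrow> 'c) set" where
  "new_cusp_forms \<iota> \<pi> k l n =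
     {f \<in> cusp_forms \<iota> \<pi> k l n. \<forall>P. prime_divisor P n \<longrightarrow>
        trace_op \<iota> k l n P f = 0 \<and> twisted_trace_op \<iota> k l n P f = 0}"


section \<open>Simultaneous diagonalizability\<close>

definition scale_fun :: "'c::field \<Rightarrow> ('d \<Rightarrow> 'c) \<Rightarrow> 'd \<Rightarrow> 'c" where
  "scale_fun c f = (\<lambda>z. c * f z)"

lemma vector_space_scale_fun: "vector_space scale_fun"
  by (simp add: vector_space_def scale_fun_def fun_eq_iff algebra_simps)

text \<open>
  The operators in \<open>\<U>\<close> map \<open>V\<close> to itself, and \<open>V\<close> has a basis of common eigenvectors.
\<close>

definition simultaneously_diagonalizable ::
    "('c::field \<Rightarrow> 'v::ab_group_add \<Rightarrow> 'v) \<Rightarrow> ('v \<Rightarrow> 'v) set \<Rightarrow> 'v set \<Rightarrow> bool" where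
  "simultaneously_diagonalizable smul \<U> V \<longleftrightarrow>
     (\<forall>U\<in>\<U>. U ` V \<subseteq> V) \<and>
     (\<exists>B\<subseteq>V. \<not> module.dependent smul B \<and> module.span smul B = V \<and>
        (\<forall>U\<in>\<U>. \<forall>v\<in>B. \<exists>c. U v = smul c v))"

end

theory Submission
  imports Defs
begin

text \<open>
  On newforms the operator \<open>U\<^sub>P\<close> is, up to a scalar, an involution.  Let \<open>W\<close> be the Atkin--Lehner matrix
  of \<open>P\<close> at level \<open>n\<close>.  The cosets of \<open>Gamma0 n\<close> in \<open>Gamma0 (n div P)\<close> are represented by the identity
  and by matrices \<open>\<gamma>\<^sub>Q\<close> with \<open>W \<gamma>\<^sub>Q = (1 Q; 0 P)\<close>, where \<open>Q\<close> runs through the residues modulo \<open>P\<close>.  Hence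
  the trace of \<open>f|W\<close> is \<open>f|W + P\<^bsup>l-k\<^esup> U\<^sub>P f\<close> (lemma \<open>twisted_trace_eq\<close>).  It vanishes for a newform, so
  there \<open>U\<^sub>P f = - P\<^bsup>k-l\<^esup> f|W\<close>.  Since \<open>W\<^sup>2\<close> is \<open>P\<close> times an element of \<open>Gamma0 n\<close>, and \<open>f|W\<close> is again a
  newform, it follows that \<open>U\<^sub>P\<^sup>2 = P\<^sup>k\<close>.  The Atkin--Lehner matrices of different primes commute modulo
  \<open>Gamma0 n\<close>, so the operators commute.  The polynomial \<open>X\<^sup>2 - P\<^sup>k\<close> has two different roots because the
  characteristic is odd, and finitely many commuting operators of this kind have a spanning set of common
  eigenvectors.

  The analytic part of the proof shows that \<open>f|W\<close> is a cusp form.  Holomorphy holds because Moebius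
  transformations carry each affinoid of the covering into another one.  At the cusps, \<open>W \<gamma>\<close> is the product
  of a matrix in \<open>GL\<^sub>2(A)\<close> and an upper triangular matrix \<open>(a b; 0 d)\<close>, so the question is whether
  \<open>z \<mapsto> h((a z + b)/d)\<close> has an expansion in \<open>u(z/n)\<close> if \<open>h\<close> has one.  The Carlitz module gives an expansion in
  \<open>u(z/(d n))\<close> (lemma \<open>vanishes_at_infinity_affine\<close>), and invariance under translation by \<open>n A\<close> permits the
  descent to \<open>u(z/n)\<close> (lemma \<open>vanishes_at_infinity_descent\<close>).  Both steps rest on the additivity of the
  lattice exponential \<open>E\<close>, on its zeros, on the lower bound for \<open>\<bar>E z\<bar>\<close> by the imaginary part, and on
  elementary rules for power series over a complete nonarchimedean field.
\<close>

no_notation fps_nth (infixl "$" 75)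

section \<open>Commuting involutions up to scalars\<close>

text \<open>
  If \<open>U\<^sup>2 = s\<^sup>2\<close>, then \<open>s v + U v\<close> and \<open>s v - U v\<close> are eigenvectors of \<open>U\<close> with sum \<open>2 s v\<close>.  They remain
  eigenvectors of every operator that commutes with \<open>U\<close> and has \<open>v\<close> as an eigenvector, so the operators can be
  treated one after the other.
\<close>

lemma (in vector_space) commuting_involutions_span:
  fixes \<U> :: "('b \<Rightarrow> 'b) set"
  assumes two: "(2::'a) \<noteq> 0" and "finite \<U>"
    and V: "subspace V"
    and stable: "\<And>U v. U \<in> \<U> \<Longrightarrow> v \<in> V \<Longrightarrow> U v \<in> V"
    and add: "\<And>U v w. U \<in> \<U> \<Longrightarrow> v \<in> V \<Longrightarrow> w \<in> V \<Longrightarrow> U (v + w) = U v + U w"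
    and scale: "\<And>U c v. U \<in> \<U> \<Longrightarrow> v \<in> V \<Longrightarrow> U (scale c v) = scale c (U v)"
    and commute: "\<And>U U' v. U \<in> \<U> \<Longrightarrow> U' \<in> \<U> \<Longrightarrow> v \<in> V \<Longrightarrow> U (U' v) = U' (U v)"
    and square: "\<And>U. U \<in> \<U> \<Longrightarrow> \<exists>s. s \<noteq> 0 \<and> (\<forall>v\<in>V. U (U v) = scale (s * s) v)"
  shows "V \<subseteq> span {v \<in> V. \<forall>U\<in>\<U>. \<exists>c. U v = scale c v}"
proof -
  have "V \<subseteq> span {v \<in> V. \<forall>U\<in>\<F>. \<exists>c. U v = scale c v}" if "finite \<F>" "\<F> \<subseteq> \<U>" for \<F>
    using that
  proof (induction \<F> rule: finite_induct)
    case empty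
    show ?case by (auto intro: span_base)
  next
    case (insert U \<F>)
    let ?E = "\<lambda>\<F>. {v \<in> V. \<forall>U\<in>\<F>. \<exists>c. U v = scale c v}"
    have U: "U \<in> \<U>" and \<F>: "\<F> \<subseteq> \<U>" using insert.prems by auto
    obtain s where s: "s \<noteq> 0" "\<And>v. v \<in> V \<Longrightarrow> U (U v) = scale (s * s) v"
      using square[OF U] by blast
    have "?E \<F> \<subseteq> span (?E (insert U \<F>))"
    proof
      fix v assume v: "v \<in> ?E \<F>"
      hence vV: "v \<in> V" by simp
      have UvV: "U v \<in> V" using stable[OF U vV] .
      have part: "scale s v + scale e (U v) \<in> ?E (insert U \<F>)" if e: "e * e = 1" for e
      proof -
        let ?w = "scale s v + scale e (U v)"
        have wV: "?w \<in> V" using V vV UvV by (simp add: subspace_add subspace_scale)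
        have "U ?w = scale s (U v) + scale e (scale (s * s) v)"
          using add[OF U, of "scale s v" "scale e (U v)"] scale[OF U vV] scale[OF U UvV] s(2)[OF vV]
            V vV UvV by (simp add: subspace_scale)
        also have "scale s (U v) = scale (e * s) (scale e (U v))"
        proof -
          have "e * s * e = s" using e by (simp add: algebra_simps)
          thus ?thesis by (simp add: ac_simps)
        qed
        also have "scale e (scale (s * s) v) = scale (e * s) (scale s v)"
          by (simp add: ac_simps)
        finally have Uw: "U ?w = scale (e * s) ?w"
          by (simp add: scale_right_distrib add.commute)
        have "\<exists>c. U' ?w = scale c ?w" if U': "U' \<in> \<F>" for U'
        proof -
          obtain c where c: "U' v = scale c v" using v U' by auto
          have U'\<U>: "U' \<in> \<U>" using U' \<F> by auto
          have "U' (U v) = scale c (U v)"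
            using commute[OF U'\<U> U vV] c scale[OF U vV] by simp
          hence "U' ?w = scale c ?w"
            using add[OF U'\<U>, of "scale s v" "scale e (U v)"] scale[OF U'\<U> vV] scale[OF U'\<U> UvV] c
              V vV UvV by (simp add: subspace_scale scale_right_distrib ac_simps)
          thus ?thesis ..
        qed
        thus ?thesis using wV Uw by auto
      qed
      have "scale s v + scale 1 (U v) \<in> span (?E (insert U \<F>))"
        and "scale s v + scale (-1) (U v) \<in> span (?E (insert U \<F>))"
        by (rule span_base, rule part, simp)+
      hence "scale (inverse (2 * s)) ((scale s v + scale 1 (U v)) + (scale s v + scale (-1) (U v)))
               \<in> span (?E (insert U \<F>))"
        by (rule span_scale[OF span_add])
      also have "(scale s v + scale 1 (U v)) + (scale s v + scale (-1) (U v)) = scale (2 * s) v"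
        by (simp add: scale_left_distrib [symmetric] flip: mult_2)
      finally show "v \<in> span (?E (insert U \<F>))"
        using two s(1) by simp
    qed
    hence "span (?E \<F>) \<subseteq> span (?E (insert U \<F>))"
      by (simp add: span_minimal)
    thus ?case using insert.IH \<F> by blast
  qed
  from this[of \<U>] \<open>finite \<U>\<close> show ?thesis by simp
qed

lemma simultaneously_diagonalizable_commuting_involutions:
  fixes scale :: "'c::field \<Rightarrow> 'v::ab_group_add \<Rightarrow> 'v"
  assumes vs: "vector_space scale"
    and two: "(2::'c) \<noteq> 0" and fin: "finite \<U>"
    and V: "module.subspace scale V"
    and stable: "\<And>U v. U \<in> \<U> \<Longrightarrow> v \<in> V \<Longrightarrow> U v \<in> V"
    and add: "\<And>U v w. U \<in> \<U> \<Longrightarrow> v \<in> V \<Longrightarrow> w \<in> V \<Longrightarrow> U (v + w) = U v + U w"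
    and scale: "\<And>U c v. U \<in> \<U> \<Longrightarrow> v \<in> V \<Longrightarrow> U (scale c v) = scale c (U v)"
    and commute: "\<And>U U' v. U \<in> \<U> \<Longrightarrow> U' \<in> \<U> \<Longrightarrow> v \<in> V \<Longrightarrow> U (U' v) = U' (U v)"
    and square: "\<And>U. U \<in> \<U> \<Longrightarrow> \<exists>s. s \<noteq> 0 \<and> (\<forall>v\<in>V. U (U v) = scale (s * s) v)"
  shows "simultaneously_diagonalizable scale \<U> V"
proof -
  interpret vector_space scale by (rule vs)
  let ?E = "{v \<in> V. \<forall>U\<in>\<U>. \<exists>c. U v = scale c v}"
  have "V \<subseteq> span ?E"
    by (rule commuting_involutions_span[OF two fin V])
       (use stable add scale commute square in blast)+
  moreover obtain B where B: "B \<subseteq> ?E" "independent B" "?E \<subseteq> span B"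
    using maximal_independent_subset[of ?E] by blast
  ultimately have "V \<subseteq> span B"
    by (meson span_minimal subspace_span subset_trans)
  moreover have "span B \<subseteq> V"
    using B(1) V by (intro span_minimal) auto
  ultimately have "B \<subseteq> V" "span B = V" using B(1) by auto
  moreover have "\<forall>U\<in>\<U>. \<forall>v\<in>B. \<exists>c. U v = scale c v" using B(1) by blast
  ultimately show ?thesis
    unfolding simultaneously_diagonalizable_def using stable B(2) by blast
qed

section \<open>Two by two matrices\<close>

lemma mat2_nth [simp]:
  "mat2 a b c d $ 1 $ 1 = a" "mat2 a b c d $ 1 $ 2 = b"
  "mat2 a b c d $ 2 $ 1 = c" "mat2 a b c d $ 2 $ 2 = d"
  by (simp_all add: mat2_def)

lemma mat2_eqI:
  assumes "M $ 1 $ 1 = M' $ 1 $ 1" "M $ 1 $ 2 = M' $ 1 $ 2" "M $ 2 $ 1 = M' $ 2 $ 1" "M $ 2 $ 2 = M' $ 2 $ 2"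
  shows "M = (M' :: 'a^2^2)"
  using assms by (simp add: vec_eq_iff forall_2)

lemma mat2_eta: "(M :: 'a::zero^2^2) = mat2 (M $ 1 $ 1) (M $ 1 $ 2) (M $ 2 $ 1) (M $ 2 $ 2)"
  by (rule mat2_eqI) simp_all

lemma mat2_cases:
  fixes M :: "'a::zero^2^2"
  obtains a b c d where "M = mat2 a b c d"
  using mat2_eta by blast

lemma mat2_eq_iff: "mat2 a b c d = mat2 a' b' c' d' \<longleftrightarrow> a = a' \<and> b = b' \<and> c = c' \<and> d = d'"
  by (metis mat2_nth)

lemma mat2_mult:
  "mat2 a b c d ** mat2 a' b' c' d' =
   mat2 (a * a' + b * c') (a * b' + b * d') (c * a' + d * c') (c * b' + d * (d' :: 'a::semiring_1))"
  by (rule mat2_eqI) (simp_all add: matrix_matrix_mult_def sum_2)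

lemma mat_1_eq_mat2: "(mat 1 :: 'a::semiring_1^2^2) = mat2 1 0 0 1"
  by (rule mat2_eqI) (simp_all add: mat_def)

lemma det_mat2: "det (mat2 a b c d) = a * d - b * (c :: 'a::comm_ring_1)"
  by (simp add: det_2)

lemma invertible_mat2_iff:
  fixes M :: "'a::comm_ring_1^2^2"
  shows "invertible M \<longleftrightarrow> det M dvd 1"
proof
  assume "invertible M"
  then obtain M' where "M ** M' = mat 1" unfolding invertible_def by blast
  hence "det M * det M' = 1" by (metis det_I det_mul)
  thus "det M dvd 1" by (metis dvd_triv_left)
next
  assume "det M dvd 1"
  then obtain u where u: "det M * u = 1" by (metis dvdE)
  obtain a b c d where M: "M = mat2 a b c d" by (rule mat2_cases)
  have u': "(a * d - b * c) * u = 1" using u by (simp add: M det_mat2)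
  have "M ** mat2 (d * u) (- b * u) (- c * u) (a * u) = mat 1"
    "mat2 (d * u) (- b * u) (- c * u) (a * u) ** M = mat 1"
    using u' by (simp_all add: M mat2_mult mat_1_eq_mat2 mat2_eq_iff algebra_simps)
  thus "invertible M" unfolding invertible_def by blast
qed

lemma Gamma0_iff: "M \<in> Gamma0 n \<longleftrightarrow> det M dvd 1 \<and> n dvd M $ 2 $ 1"
  by (simp add: Gamma0_def invertible_mat2_iff)

lemma Gamma0_one: "mat 1 \<in> Gamma0 n"
  by (simp add: Gamma0_iff mat_1_eq_mat2 det_mat2)

lemma Gamma0_mult:
  assumes "M \<in> Gamma0 n" "M' \<in> Gamma0 n"
  shows "M ** M' \<in> Gamma0 n"
proof -
  obtain a b c d where M: "M = mat2 a b c d" by (rule mat2_cases)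
  obtain a' b' c' d' where M': "M' = mat2 a' b' c' d'" by (rule mat2_cases)
  have "det M * det M' dvd 1 * 1" using assms by (intro mult_dvd_mono) (auto simp: Gamma0_iff)
  hence "det (M ** M') dvd 1" by (simp add: det_mul)
  moreover have "n dvd (M ** M') $ 2 $ 1"
    using assms unfolding M M' mat2_mult by (simp add: Gamma0_iff)
  ultimately show ?thesis by (simp add: Gamma0_iff)
qed

lemma Gamma0_inverse:
  assumes "M \<in> Gamma0 n"
  obtains M' where "M' \<in> Gamma0 n" "M ** M' = mat 1" "M' ** M = mat 1"
proof -
  obtain a b c d where M: "M = mat2 a b c d" by (rule mat2_cases)
  obtain u where u: "det M * u = 1" using assms by (metis Gamma0_iff dvdE)
  have u': "(a * d - b * c) * u = 1" using u by (simp add: M det_mat2)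
  let ?M' = "mat2 (d * u) (- b * u) (- c * u) (a * u)"
  have 1: "M ** ?M' = mat 1" "?M' ** M = mat 1"
    using u' by (simp_all add: M mat2_mult mat_1_eq_mat2 mat2_eq_iff algebra_simps)
  hence "det M * det ?M' = 1" by (metis det_I det_mul)
  hence "det ?M' dvd 1" by (metis dvd_triv_right)
  moreover have "n dvd ?M' $ 2 $ 1" using assms by (simp add: Gamma0_iff M)
  ultimately have "?M' \<in> Gamma0 n" by (simp only: Gamma0_iff)
  thus ?thesis using that 1 by blast
qed

text \<open>
  Up to the unit \<open>det M'\<close>, the lower left entry of \<open>M M'\<^sup>-\<^sup>1\<close> is the minor formed by the two bottom rows.
\<close>

lemma same_Gamma0_coset_iff:
  fixes n :: "'q::field poly"
  assumes M: "det M dvd 1" and M': "det M' dvd 1"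
  shows "(\<exists>\<delta>\<in>Gamma0 n. M = \<delta> ** M') \<longleftrightarrow> n dvd M $ 2 $ 1 * M' $ 2 $ 2 - M $ 2 $ 2 * M' $ 2 $ 1"
proof
  obtain a b c d where Mm: "M = mat2 a b c d" by (rule mat2_cases)
  obtain a' b' c' d' where Mm': "M' = mat2 a' b' c' d'" by (rule mat2_cases)
  {
    assume "\<exists>\<delta>\<in>Gamma0 n. M = \<delta> ** M'"
    then obtain \<delta> where \<delta>: "\<delta> \<in> Gamma0 n" "M = \<delta> ** M'" by blast
    obtain e f g h where D: "\<delta> = mat2 e f g h" by (rule mat2_cases)
    have "c = g * a' + h * c'" "d = g * b' + h * d'"
      using \<delta>(2) by (simp_all add: Mm Mm' D mat2_mult mat2_eq_iff)
    hence "c * d' - d * c' = g * (a' * d' - b' * c')" by (simp add: algebra_simps)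
    moreover have "n dvd g" using \<delta>(1) by (simp add: Gamma0_iff D)
    ultimately show "n dvd M $ 2 $ 1 * M' $ 2 $ 2 - M $ 2 $ 2 * M' $ 2 $ 1" by (simp add: Mm Mm')
  next
    assume dvd: "n dvd M $ 2 $ 1 * M' $ 2 $ 2 - M $ 2 $ 2 * M' $ 2 $ 1"
    obtain u where u: "(a' * d' - b' * c') * u = 1" using M' by (auto simp: Mm' det_mat2 elim: dvdE)
    define N where "N = mat2 (d' * u) (- b' * u) (- c' * u) (a' * u)"
    have N: "N ** M' = mat 1"
      using u by (simp add: N_def Mm' mat2_mult mat_1_eq_mat2 mat2_eq_iff algebra_simps)
    hence "det N * det M' = 1" by (simp flip: det_mul)
    hence detN: "det N dvd 1" by (metis dvd_triv_left)
    have "(M ** N) $ 2 $ 1 = (c * d' - d * c') * u"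
      by (simp add: Mm N_def mat2_mult algebra_simps)
    hence "n dvd (M ** N) $ 2 $ 1" using dvd by (simp add: Mm Mm')
    moreover have "det M * det N dvd 1 * 1"
      using M detN by (rule mult_dvd_mono)
    hence "det (M ** N) dvd 1" by (simp add: det_mul)
    ultimately have "M ** N \<in> Gamma0 n" by (simp only: Gamma0_iff)
    moreover have "(M ** N) ** M' = M"
      unfolding matrix_mul_assoc [symmetric] N by (rule matrix_mul_rid)
    hence "M = (M ** N) ** M'" ..
    ultimately show "\<exists>\<delta>\<in>Gamma0 n. M = \<delta> ** M'" by (rule bexI[rotated])
  }
qed

section \<open>Bezout identities\<close>

lemma poly_bezout:
  fixes x y :: "'q::field poly"
  shows "\<exists>g s t. g dvd x \<and> g dvd y \<and> g = s * x + t * y"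
proof (induction "euclidean_size y" arbitrary: x y rule: less_induct)
  case less
  show ?case
  proof (cases "y = 0")
    case True
    thus ?thesis by (intro exI[of _ x] exI[of _ 1] exI[of _ 0]) auto
  next
    case False
    obtain g s t where g: "g dvd y" "g dvd x mod y" "g = s * y + t * (x mod y)"
      using less[OF mod_size_less[OF False, of x]] by blast
    have "g dvd x" using g(1,2) dvd_mod_iff by blast
    moreover have "g = t * x + (s - t * (x div y)) * y"
      unfolding g(3) minus_div_mult_eq_mod [symmetric] by (simp add: algebra_simps)
    ultimately show ?thesis using g(1) by blast
  qed
qed

lemma irreducible_bezout:
  fixes P x :: "'q::field poly"
  assumes "irreducible P" "\<not> P dvd x"
  shows "\<exists>s t. s * P + t * x = 1"
proof -
  obtain g s t where g: "g dvd P" "g dvd x" "g = s * P + t * x" using poly_bezout by blast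
  have "\<not> P dvd g" using g(2) assms(2) dvd_trans by blast
  hence "g dvd 1" using assms(1) g(1) irreducibleD' by blast
  then obtain u where "1 = g * u" by (rule dvdE)
  moreover have "(u * s) * P + (u * t) * x = g * u" unfolding g(3) by (simp add: algebra_simps)
  ultimately have "(u * s) * P + (u * t) * x = 1" by simp
  thus ?thesis by blast
qed

text \<open>
  Hermite normal form: a Bezout identity for the first column, whose gcd becomes \<open>a\<close>, supplies the
  unimodular factor.
\<close>

lemma upper_triangular_decomposition:
  fixes M :: "'q::field poly^2^2"
  assumes "det M \<noteq> 0"
  obtains \<delta> a b d where "det \<delta> = 1" "M = \<delta> ** mat2 a b 0 d" "a \<noteq> 0" "d \<noteq> 0"
proof -
  obtain x b y d where M: "M = mat2 x b y d" by (rule mat2_cases)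
  obtain g s t where g: "g dvd x" "g dvd y" "g = s * x + t * y" using poly_bezout by blast
  obtain x' y' where xy: "x = g * x'" "y = g * y'" using g(1,2) unfolding dvd_def by blast
  have "det M = g * (x' * d - b * y')" by (simp add: M det_mat2 xy algebra_simps)
  hence "g \<noteq> 0" using assms by auto
  have "g * (s * x' + t * y') = g * 1"
  proof -
    have "g * (s * x' + t * y') = s * x + t * y" by (simp add: xy algebra_simps)
    thus ?thesis using g(3) by (simp only: mult_1_right)
  qed
  hence st: "s * x' + t * y' = 1" using \<open>g \<noteq> 0\<close> by simp
  let ?\<delta> = "mat2 x' (- t) y' s" and ?B = "mat2 g (s * b + t * d) 0 (x' * d - y' * b)"
  have det: "det ?\<delta> = 1" using st by (simp add: det_mat2 algebra_simps)
  have "x' * (s * b + t * d) - t * (x' * d - y' * b) = (s * x' + t * y') * b"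
    "y' * (s * b + t * d) + s * (x' * d - y' * b) = (s * x' + t * y') * d"
    by (simp_all add: algebra_simps)
  hence eq: "M = ?\<delta> ** ?B" using st by (simp add: M mat2_mult mat2_eq_iff xy mult.commute)
  have "det M = det ?B" by (simp add: eq det_mul det)
  hence "x' * d - y' * b \<noteq> 0" using assms by (auto simp: det_mat2)
  thus ?thesis by (rule that[OF det eq \<open>g \<noteq> 0\<close>])
qed

section \<open>Atkin--Lehner matrices\<close>

text \<open>
  For squarefree \<open>n\<close> these are the matrices of the Atkin--Lehner involution belonging to the divisor \<open>Q\<close> of \<open>n\<close>.
  Determinants are taken up to units, so that the set is stable under \<open>Gamma0 n\<close> on both sides; in fact it is a
  single coset on either side.
\<close>

definition AL :: "'q::field poly \<Rightarrow> 'q poly \<Rightarrow> ('q poly^2^2) set" where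
  "AL n Q = {M. Q dvd M $ 1 $ 1 \<and> n dvd M $ 2 $ 1 \<and> Q dvd M $ 2 $ 2 \<and> (\<exists>u. u dvd 1 \<and> det M = u * Q)}"

lemma ALE:
  assumes "M \<in> AL n Q" "Q dvd n" "Q \<noteq> 0"
  obtains a b c d m u v where "M = mat2 (Q * a) b (n * c) (Q * d)" "n = Q * m"
    "Q * a * d - m * b * c = u" "u * v = 1"
proof -
  obtain a c d where "M $ 1 $ 1 = Q * a" "M $ 2 $ 1 = n * c" "M $ 2 $ 2 = Q * d"
    using assms(1) unfolding AL_def by (auto elim!: dvdE)
  hence M: "M = mat2 (Q * a) (M $ 1 $ 2) (n * c) (Q * d)" by (metis mat2_eta)
  obtain u where u0: "u dvd 1" "det M = u * Q" using assms(1) unfolding AL_def by blast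
  then obtain v where u: "det M = u * Q" "1 = u * v" by (auto simp: dvd_def)
  obtain m where m: "n = Q * m" using assms(2) by (rule dvdE)
  have "Q * (Q * a * d - m * (M $ 1 $ 2) * c) = Q * u"
    using u(1) by (subst (asm) M) (simp add: det_mat2 m algebra_simps)
  hence "Q * a * d - m * (M $ 1 $ 2) * c = u" using assms(3) by (metis mult_left_cancel)
  thus ?thesis by (rule that[OF M m _ u(2) [symmetric]])
qed

lemma AL_det_nz: "M \<in> AL n Q \<Longrightarrow> Q \<noteq> 0 \<Longrightarrow> det M \<noteq> 0"
  unfolding AL_def by auto

lemma AL_Gamma0_left:
  assumes "M \<in> AL n Q" "Q dvd n" "\<gamma> \<in> Gamma0 n"
  shows "\<gamma> ** M \<in> AL n Q"
proof -
  obtain a b c d where M: "M = mat2 a b c d" by (rule mat2_cases)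
  obtain e f g h where G: "\<gamma> = mat2 e f g h" by (rule mat2_cases)
  have dvd: "Q dvd a" "n dvd c" "Q dvd d" "n dvd g" "Q dvd c" "Q dvd g"
    using assms dvd_trans unfolding AL_def Gamma0_iff by (auto simp: M G)
  obtain u where u: "u dvd 1" "det M = u * Q" using assms(1) unfolding AL_def by auto
  have "det (\<gamma> ** M) = (det \<gamma> * u) * Q" by (simp add: det_mul u(2))
  moreover have "det \<gamma> * u dvd 1" using u(1) assms(3) by (simp add: Gamma0_iff is_unit_mult_iff)
  ultimately show ?thesis unfolding AL_def using dvd by (auto simp: M G mat2_mult)
qed

definition adj2 :: "'a::comm_ring_1^2^2 \<Rightarrow> 'a^2^2" where
  "adj2 M = mat2 (M $ 2 $ 2) (- M $ 1 $ 2) (- M $ 2 $ 1) (M $ 1 $ 1)"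

lemma adj2_adj2 [simp]: "adj2 (adj2 M) = M"
  by (rule mat2_eqI) (simp_all add: adj2_def)

lemma adj2_mult: "adj2 (M ** N) = adj2 N ** adj2 M"
  by (rule mat2_cases[of M], rule mat2_cases[of N])
     (simp add: adj2_def mat2_mult mat2_eq_iff algebra_simps)

lemma det_adj2 [simp]: "det (adj2 M) = det M"
  by (rule mat2_cases[of M]) (simp add: adj2_def det_mat2 algebra_simps)

lemma mult_adj2: "M ** adj2 M = mat2 (det M) 0 0 (det M)"
  by (rule mat2_cases[of M]) (simp add: adj2_def mat2_mult det_mat2 mat2_eq_iff algebra_simps)

lemma adj2_Gamma0: "M \<in> Gamma0 n \<Longrightarrow> adj2 M \<in> Gamma0 n"
  unfolding Gamma0_iff det_adj2 by (simp add: adj2_def)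

lemma adj2_AL: "M \<in> AL n Q \<Longrightarrow> adj2 M \<in> AL n Q"
  unfolding AL_def mem_Collect_eq det_adj2 by (simp add: adj2_def)

lemma AL_Gamma0_right:
  assumes "M \<in> AL n Q" "Q dvd n" "\<gamma> \<in> Gamma0 n"
  shows "M ** \<gamma> \<in> AL n Q"
  using adj2_AL[OF AL_Gamma0_left[OF adj2_AL[OF assms(1)] assms(2) adj2_Gamma0[OF assms(3)]]]
  by (simp add: adj2_mult)

lemma mat2_mult_cancel_right:
  fixes N N' M :: "'a::idom^2^2"
  assumes "N ** M = N' ** M" "det M \<noteq> 0"
  shows "N = N'"
proof -
  have "N ** (M ** adj2 M) = N' ** (M ** adj2 M)" using assms(1) by (simp only: matrix_mul_assoc)
  thus ?thesis
    using assms(2) by (rule_tac mat2_cases[of N], rule_tac mat2_cases[of N'])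
      (simp add: mult_adj2 mat2_mult mat2_eq_iff)
qed

lemma mat2_mult_cancel_left:
  fixes N N' M :: "'a::idom^2^2"
  assumes "M ** N = M ** N'" "det M \<noteq> 0"
  shows "N = N'"
proof -
  have "adj2 N ** adj2 M = adj2 N' ** adj2 M" using assms(1) by (simp only: adj2_mult [symmetric])
  hence "adj2 N = adj2 N'" by (rule mat2_mult_cancel_right) (simp add: assms(2))
  thus ?thesis by (metis adj2_adj2)
qed

text \<open>
  The matrix \<open>\<gamma> = M M'\<^sup>-\<^sup>1\<close> has entries in \<open>A\<close> because all entries of the product of \<open>M\<close> with the adjugate of
  \<open>M'\<close> are divisible by \<open>Q\<close>; the lower left one is divisible by \<open>n Q\<close>.
\<close>

lemma AL_left_coset:
  assumes "M \<in> AL n Q" "M' \<in> AL n Q" "Q dvd n" "Q \<noteq> 0"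
  obtains \<gamma> where "\<gamma> \<in> Gamma0 n" "M = \<gamma> ** M'"
proof -
  obtain a b c d m u v where M: "M = mat2 (Q * a) b (n * c) (Q * d)" "n = Q * m"
    "Q * a * d - m * b * c = u" "u * v = 1" using ALE[OF assms(1,3,4)] by metis
  obtain a' b' c' d' m' u' v' where M': "M' = mat2 (Q * a') b' (n * c') (Q * d')" "n = Q * m'"
    "Q * a' * d' - m' * b' * c' = u'" "u' * v' = 1" using ALE[OF assms(2,3,4)] by metis
  have [simp]: "m' = m" using M(2) M'(2) assms(4) by auto
  have u'_1: "v' * (Q * a' * d' - m * b' * c') = 1" using M'(3,4) by (simp add: mult.commute)
  define \<gamma> where "\<gamma> = mat2 (v' * (Q * a * d' - m * b * c')) (v' * (a' * b - a * b'))
     (n * (v' * (c * d' - c' * d))) (v' * (Q * a' * d - m * b' * c))"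
  have "\<gamma> ** M' = mat2 (Q * a * (v' * (Q * a' * d' - m * b' * c'))) (b * (v' * (Q * a' * d' - m * b' * c')))
    (n * c * (v' * (Q * a' * d' - m * b' * c'))) (Q * d * (v' * (Q * a' * d' - m * b' * c')))"
    unfolding \<gamma>_def M'(1) mat2_mult M(2) by (simp add: mat2_eq_iff algebra_simps)
  also have "\<dots> = M" by (simp only: u'_1 mult_1_right M(1))
  finally have eq: "M = \<gamma> ** M'" ..
  have "det M = (Q * a * d - m * b * c) * Q" by (simp add: M(1,2) det_mat2 algebra_simps)
  hence "det M = u * Q" by (simp only: M(3))
  moreover have "det M' = (Q * a' * d' - m' * b' * c') * Q" by (simp add: M'(1) M(2) det_mat2 algebra_simps)
  hence "det M' = u' * Q" by (simp only: M'(3))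
  ultimately have "(det \<gamma> * u') * Q = u * Q" using eq by (simp add: det_mul)
  hence "det \<gamma> * u' = u" using assms(4) by simp
  hence "det \<gamma> * (u' * v) = 1" using M(4) by (simp flip: mult.assoc)
  hence "det \<gamma> dvd 1" by (metis dvd_triv_left)
  moreover have "n dvd \<gamma> $ 2 $ 1" by (simp add: \<gamma>_def)
  ultimately show ?thesis using that eq by (simp add: Gamma0_iff)
qed

text \<open>
  The adjugate exchanges left and right cosets.
\<close>

lemma AL_right_coset:
  assumes "M \<in> AL n Q" "M' \<in> AL n Q" "Q dvd n" "Q \<noteq> 0"
  obtains \<gamma> where "\<gamma> \<in> Gamma0 n" "M = M' ** \<gamma>"
proof -
  obtain \<gamma> where \<gamma>: "\<gamma> \<in> Gamma0 n" "adj2 M = \<gamma> ** adj2 M'"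
    by (rule AL_left_coset[OF adj2_AL[OF assms(1)] adj2_AL[OF assms(2)] assms(3,4)])
  have "adj2 (adj2 M) = M' ** adj2 \<gamma>" unfolding \<gamma>(2) adj2_mult adj2_adj2 ..
  thus ?thesis using that[OF adj2_Gamma0[OF \<gamma>(1)]] by (simp only: adj2_adj2)
qed

lemma AL_square:
  assumes "M \<in> AL n Q" "Q dvd n" "Q \<noteq> 0"
  obtains \<gamma> where "\<gamma> \<in> Gamma0 n" "M ** M = mat2 Q 0 0 Q ** \<gamma>"
proof -
  obtain a b c d m u v where M: "M = mat2 (Q * a) b (n * c) (Q * d)" "n = Q * m"
    "Q * a * d - m * b * c = u" "u * v = 1" using ALE[OF assms] by metis
  define \<gamma> where "\<gamma> = mat2 (Q * a * a + b * m * c) (a * b + b * d) (n * (c * a + d * c)) (m * c * b + Q * d * d)"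
  have eq: "M ** M = mat2 Q 0 0 Q ** \<gamma>"
    unfolding \<gamma>_def M(1,2) mat2_mult by (simp add: mat2_eq_iff algebra_simps)
  have "det M = (Q * a * d - m * b * c) * Q" by (simp add: M(1,2) det_mat2 algebra_simps)
  hence "det M = u * Q" by (simp only: M(3))
  moreover have "det (mat2 Q 0 0 Q) = Q * Q" by (simp add: det_mat2)
  ultimately have "(Q * Q) * det \<gamma> = (u * Q) * (u * Q)" using eq by (metis det_mul)
  also have "\<dots> = (Q * Q) * (u * u)" by (simp only: mult_ac)
  finally have "(Q * Q) * det \<gamma> = (Q * Q) * (u * u)" .
  hence "det \<gamma> = u * u"
    by (rule mult_left_cancel[THEN iffD1, rotated]) (use assms(3) in simp)
  hence "det \<gamma> * (v * v) = (u * v) * (u * v)" by (simp add: mult_ac)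
  hence "det \<gamma> dvd 1" using M(4) by (metis dvd_triv_left mult_1_right)
  moreover have "n dvd \<gamma> $ 2 $ 1" by (simp add: \<gamma>_def)
  ultimately show ?thesis using that eq by (simp add: Gamma0_iff)
qed

lemma AL_mult:
  assumes "M \<in> AL n Q" "M' \<in> AL n Q'" "Q * Q' dvd n"
  shows "M ** M' \<in> AL n (Q * Q')"
proof -
  obtain a b c d where M: "M = mat2 a b c d" by (rule mat2_cases)
  obtain a' b' c' d' where M': "M' = mat2 a' b' c' d'" by (rule mat2_cases)
  have dvd: "Q dvd a" "n dvd c" "Q dvd d" "Q' dvd a'" "n dvd c'" "Q' dvd d'"
    using assms unfolding AL_def by (auto simp: M M')
  have "Q * Q' dvd c" "Q * Q' dvd c'" using dvd assms(3) dvd_trans by blast+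
  moreover have "Q * Q' dvd a * a'" "Q * Q' dvd d * d'" using dvd mult_dvd_mono by blast+
  moreover obtain u u' where u: "u dvd 1" "det M = u * Q" "u' dvd 1" "det M' = u' * Q'"
    using assms unfolding AL_def by auto
  have "det (M ** M') = (u * u') * (Q * Q')" by (simp add: det_mul u mult_ac)
  moreover have "u * u' dvd 1" using u by (simp add: is_unit_mult_iff)
  ultimately show ?thesis unfolding AL_def using dvd by (auto simp: M M' mat2_mult)
qed

lemma AL_level_dvd: "M \<in> AL n Q \<Longrightarrow> n' dvd n \<Longrightarrow> M \<in> AL n' Q"
  unfolding AL_def using dvd_trans by blast

lemma W_matrix_props:
  fixes P m :: "'q::field poly"
  assumes "irreducible P" "\<not> P dvd m" "n = P * m"
  obtains b d where "W_matrix n P = mat2 P b n (P * d)" "P * d - m * b = 1"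
proof -
  have P: "P \<noteq> 0" using assms(1) by auto
  obtain s t where st: "s * P + t * m = 1" using irreducible_bezout[OF assms(1,2)] by blast
  define bd where "bd = (SOME (b, d). P\<^sup>2 * d - n * b = P)"
  have "P\<^sup>2 * s - n * (- t) = P * (s * P + t * m)"
    by (simp add: assms(3) power2_eq_square algebra_simps)
  hence "case (- t, s) of (b, d) \<Rightarrow> P\<^sup>2 * d - n * b = P" by (simp add: st)
  hence bd: "case bd of (b, d) \<Rightarrow> P\<^sup>2 * d - n * b = P"
    unfolding bd_def by (rule someI)
  obtain b d where bd': "bd = (b, d)" by (cases bd)
  have "P * (P * d - m * b) = P * 1"
    using bd by (simp add: bd' assms(3) power2_eq_square algebra_simps)
  hence "P * d - m * b = 1" using P by (metis mult_left_cancel)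
  moreover have "W_matrix n P = mat2 P b n (P * d)"
    unfolding W_matrix_def using bd' by (simp add: bd_def)
  ultimately show ?thesis by (rule that[rotated])
qed

lemma W_matrix_AL:
  fixes P m :: "'q::field poly"
  assumes "irreducible P" "\<not> P dvd m" "n = P * m"
  shows "W_matrix n P \<in> AL n P"
proof -
  obtain b d where W: "W_matrix n P = mat2 P b n (P * d)" "P * d - m * b = 1"
    by (rule W_matrix_props[OF assms])
  have "P * (P * d) - b * n = P * (P * d - m * b)" by (simp add: assms(3) algebra_simps)
  hence "det (W_matrix n P) = 1 * P" by (simp add: W det_mat2)
  thus ?thesis unfolding AL_def by (auto simp: W(1) intro!: exI[of _ 1])
qed

section \<open>Coset representatives\<close>

text \<open>
  Representatives of the cosets of \<open>Gamma0 (P m)\<close> in \<open>Gamma0 m\<close>.  The nontrivial ones are \<open>W\<^sup>-\<^sup>1 (1 Q; 0 P)\<close>, where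
  \<open>W = (P b; P m P d)\<close> is an Atkin--Lehner matrix of determinant \<open>P\<close>.
\<close>

definition coset_rep :: "'q::field poly \<Rightarrow> 'q poly \<Rightarrow> 'q poly \<Rightarrow> 'q poly \<Rightarrow> 'q poly option \<Rightarrow> 'q poly^2^2" where
  "coset_rep P m b d i = (case i of None \<Rightarrow> mat 1 | Some Q \<Rightarrow> mat2 d (d * Q - b) (- m) (P - m * Q))"

lemma W_coset_rep:
  assumes "P * d - m * b = 1" "n = P * m"
  shows "mat2 P b n (P * d) ** coset_rep P m b d (Some Q) = mat2 1 Q 0 P"
proof -
  have "P * d + b * (- m) = P * d - m * b" "n * d + P * d * (- m) = 0"
    "P * (d * Q - b) + b * (P - m * Q) = (P * d - m * b) * Q"
    "n * (d * Q - b) + P * d * (P - m * Q) = P * (P * d - m * b)"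
    by (simp_all add: assms(2) algebra_simps)
  thus ?thesis using assms
    by (simp add: coset_rep_def mat2_mult mat2_eq_iff)
qed

lemma coset_rep_Gamma0:
  assumes "P * d - m * b = 1"
  shows "coset_rep P m b d i \<in> Gamma0 m"
proof (cases i)
  case (Some Q)
  have "d * (P - m * Q) - (d * Q - b) * (- m) = P * d - m * b" by (simp add: algebra_simps)
  thus ?thesis using assms by (simp add: Some coset_rep_def Gamma0_iff det_mat2)
qed (simp add: coset_rep_def Gamma0_one)

text \<open>
  A matrix with bottom row \<open>(m c, e)\<close> lies in the trivial coset iff \<open>P\<close> divides \<open>c\<close>, and in that of \<open>Q\<close> iff
  \<open>e \<equiv> c m Q\<close> modulo \<open>P\<close>.  If \<open>P\<close> divides \<open>c\<close>, the latter would make it divide the determinant; otherwise the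
  congruence has exactly one solution \<open>Q\<close> of degree less than that of \<open>P\<close>.
\<close>

lemma coset_rep_unique:
  fixes P m :: "'q::field poly"
  assumes P: "irreducible P" "\<not> P dvd m" and n: "n = P * m" and bd: "P * d - m * b = 1"
    and \<gamma>: "\<gamma> \<in> Gamma0 m"
  shows "\<exists>!i. i \<in> insert None (Some ` {Q. degree Q < degree P}) \<and>
           (\<exists>\<delta>\<in>Gamma0 n. \<gamma> = \<delta> ** coset_rep P m b d i)"
proof -
  have prime: "prime_elem P" using P(1) by (rule field_poly_irreducible_imp_prime)
  have P0: "P \<noteq> 0" using P(1) by auto
  have m0: "m \<noteq> 0" using P(2) by auto
  obtain a' b' x e where G: "\<gamma> = mat2 a' b' x e" by (rule mat2_cases)
  obtain c where c: "x = m * c" using \<gamma> by (auto simp: Gamma0_iff G elim: dvdE)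
  have det\<gamma>: "a' * e - b' * (m * c) dvd 1" using \<gamma> by (simp add: Gamma0_iff G det_mat2 c)
  have det: "det (coset_rep P m b d i) dvd 1" for i
    using coset_rep_Gamma0[OF bd] by (simp add: Gamma0_iff)
  have None: "(\<exists>\<delta>\<in>Gamma0 n. \<gamma> = \<delta> ** coset_rep P m b d None) \<longleftrightarrow> P dvd c"
    using \<gamma> m0 same_Gamma0_coset_iff[OF _ det, of \<gamma> n None]
    by (simp add: Gamma0_iff G c n coset_rep_def mat_1_eq_mat2 mult.commute[of P])
  have Some: "(\<exists>\<delta>\<in>Gamma0 n. \<gamma> = \<delta> ** coset_rep P m b d (Some Q)) \<longleftrightarrow> P dvd e - c * m * Q" for Q
  proof -
    have "(\<exists>\<delta>\<in>Gamma0 n. \<gamma> = \<delta> ** coset_rep P m b d (Some Q)) \<longleftrightarrow> n dvd m * c * (P - m * Q) + e * m"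
      using \<gamma> same_Gamma0_coset_iff[OF _ det, of \<gamma> n "Some Q"]
      by (simp add: Gamma0_iff G c coset_rep_def)
    also have "m * c * (P - m * Q) + e * m = m * (c * P + (e - c * m * Q))" by (simp add: algebra_simps)
    also have "n dvd \<dots> \<longleftrightarrow> P dvd c * P + (e - c * m * Q)" using m0 by (simp add: n mult.commute[of P])
    also have "\<dots> \<longleftrightarrow> P dvd e - c * m * Q" by (rule dvd_add_right_iff) simp
    finally show ?thesis .
  qed
  show ?thesis
  proof (cases "P dvd c")
    case True
    have nodvd: "\<not> P dvd e - c * m * Q" for Q
    proof
      assume "P dvd e - c * m * Q"
      moreover have "P dvd c * m * Q" using True by simp
      ultimately have "P dvd (e - c * m * Q) + c * m * Q" by (rule dvd_add)
      hence "P dvd e" by simp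
      hence "P dvd a' * e - b' * (m * c)" using True by (intro dvd_diff dvd_mult)
      hence "P dvd 1" using det\<gamma> by (rule dvd_trans)
      thus False using irreducible_not_unit[OF P(1)] by (rule notE[rotated])
    qed
    have noSome: "\<not> (\<exists>\<delta>\<in>Gamma0 n. \<gamma> = \<delta> ** coset_rep P m b d (Some Q))" for Q
      using nodvd[of Q] unfolding Some[of Q] .
    show ?thesis
    proof (rule ex1I[of _ None], intro conjI insertI1)
      show "\<exists>\<delta>\<in>Gamma0 n. \<gamma> = \<delta> ** coset_rep P m b d None" unfolding None by (rule True)
    next
      fix i assume i: "i \<in> insert None (Some ` {Q. degree Q < degree P}) \<and>
        (\<exists>\<delta>\<in>Gamma0 n. \<gamma> = \<delta> ** coset_rep P m b d i)"
      show "i = None"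
      proof (rule ccontr)
        assume "i \<noteq> None"
        then obtain Q where "i = Some Q" by auto
        thus False using conjunct2[OF i] noSome[of Q] by (simp only: not_True_eq_False)
      qed
    qed
  next
    case False
    hence cm: "\<not> P dvd c * m" using P(2) by (simp add: prime_elem_dvd_mult_iff[OF prime])
    obtain s t where st: "s * P + t * (c * m) = 1" using irreducible_bezout[OF P(1) cm] by blast
    define Q where "Q = (t * e) mod P"
    have "degree P \<noteq> 0" using irreducible_not_unit[OF P(1)] is_unit_iff_degree[OF P0] by simp
    hence deg: "degree Q < degree P" using degree_mod_less[OF P0, of "t * e"] unfolding Q_def by auto
    have Q: "P dvd e - c * m * Q"
    proof -
      have Q': "t * e - (t * e) div P * P = Q" by (simp add: Q_def minus_div_mult_eq_mod)
      have "(s * P + t * (c * m)) * e - c * m * (t * e - (t * e) div P * P) =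
          P * (s * e + c * m * ((t * e) div P))" by (simp add: algebra_simps)
      hence "e - c * m * Q = P * (s * e + c * m * ((t * e) div P))"
        unfolding st Q' by (simp only: mult_1)
      thus ?thesis by simp
    qed
    have uniq: "Q' = Q" if "degree Q' < degree P" "P dvd e - c * m * Q'" for Q'
    proof -
      have "P dvd (e - c * m * Q) - (e - c * m * Q')" using Q that(2) by (rule dvd_diff)
      also have "(e - c * m * Q) - (e - c * m * Q') = (c * m) * (Q' - Q)" by (simp add: algebra_simps)
      finally have "P dvd Q' - Q" using cm unfolding prime_elem_dvd_mult_iff[OF prime] by simp
      moreover have "degree (Q' - Q) < degree P" using that(1) deg by (rule degree_diff_less)
      ultimately have "Q' - Q = 0" using dvd_imp_degree_le[of P "Q' - Q"] by linarith
      thus ?thesis by simp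
    qed
    show ?thesis
    proof (rule ex1I[of _ "Some Q"], intro conjI)
      show "Some Q \<in> insert None (Some ` {Q. degree Q < degree P})" using deg by simp
      show "\<exists>\<delta>\<in>Gamma0 n. \<gamma> = \<delta> ** coset_rep P m b d (Some Q)" unfolding Some by (rule Q)
    next
      fix i assume i: "i \<in> insert None (Some ` {Q. degree Q < degree P}) \<and>
        (\<exists>\<delta>\<in>Gamma0 n. \<gamma> = \<delta> ** coset_rep P m b d i)"
      show "i = Some Q"
      proof (cases i)
        case n: None
        show ?thesis using conjunct2[OF i] False unfolding n None by (rule notE[rotated])
      next
        case s: (Some Q')
        have "degree Q' < degree P" using conjunct1[OF i] unfolding s by auto
        moreover have "P dvd e - c * m * Q'" using conjunct2[OF i] unfolding s Some .
        ultimately show ?thesis unfolding s using uniq by simp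
      qed
    qed
  qed
qed

section \<open>Power series over complete nonarchimedean fields\<close>

lemma fps_inverse_linear_factor:
  fixes x :: "'a::field"
  assumes "x \<noteq> 0"
  shows "fps_of_poly [:- x, 1:] * Abs_fps (\<lambda>i. (1 / x) ^ Suc i) = - 1"
proof (rule fps_ext)
  fix i
  have eq: "fps_of_poly [:- x, 1:] = fps_const (- x) + fps_X"
    by (simp add: fps_of_poly_pCons)
  have nth: "fps_nth ((fps_const (- x) + fps_X) * G) i =
      - x * fps_nth G i + (if i = 0 then 0 else fps_nth G (i - 1))" for G
    by (simp only: distrib_right fps_add_nth fps_mult_left_const_nth fps_X_mult_nth)
  show "fps_nth (fps_of_poly [:- x, 1:] * Abs_fps (\<lambda>i. (1 / x) ^ Suc i)) i = fps_nth (- 1) i"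
    unfolding eq nth using assms by (cases i) simp_all
qed

locale complete_nonarch_field =
  fixes nm :: "'c::{field,complete_space} \<Rightarrow> real"
  assumes dist_nm: "dist x y = nm (x - y)"
    and nm_mult: "nm (x * y) = nm x * nm y"
    and nm_add: "nm (x + y) \<le> max (nm x) (nm y)"
begin

lemma nm_nonneg [simp]: "nm x \<ge> 0"
  using zero_le_dist[of x 0] by (simp add: dist_nm)

lemma nm_eq_0 [simp]: "nm x = 0 \<longleftrightarrow> x = 0"
  using dist_eq_0_iff[of x 0] by (simp add: dist_nm)

lemma nm_0 [simp]: "nm 0 = 0"
  by simp

lemma nm_pos [simp]: "nm x > 0 \<longleftrightarrow> x \<noteq> 0"
  using nm_nonneg[of x] nm_eq_0[of x] by linarith

lemma nm_1 [simp]: "nm 1 = 1"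
  using nm_mult[of 1 1] nm_eq_0[of 1] by simp

lemma nm_minus [simp]: "nm (- x) = nm x"
  using dist_commute[of x 0] by (simp add: dist_nm)

lemma nm_diff: "nm (x - y) \<le> max (nm x) (nm y)"
  using nm_add[of x "- y"] by simp

lemma nm_minus_commute: "nm (x - y) = nm (y - x)"
  using nm_minus[of "x - y"] by simp

lemma nm_power: "nm (x ^ i) = nm x ^ i"
  by (induction i) (simp_all add: nm_mult)

lemma nm_inverse: "nm (inverse x) = inverse (nm x)"
proof (cases "x = 0")
  case False
  thus ?thesis using nm_mult[of x "inverse x"] by (simp add: field_simps)
qed simp

lemma nm_divide: "nm (x / y) = nm x / nm y"
  by (simp add: divide_inverse nm_mult nm_inverse)

lemma nm_prod: "nm (prod f A) = (\<Prod>x\<in>A. nm (f x))"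
  by (induction A rule: infinite_finite_induct) (simp_all add: nm_mult)

lemma nm_add_eq: 
  assumes "nm x < nm y" shows "nm (x + y) = nm y"
proof (rule antisym)
  show "nm (x + y) \<le> nm y" using nm_add[of x y] assms by simp
  show "nm y \<le> nm (x + y)" using nm_diff[of "x + y" x] assms by simp
qed

lemma nm_sum:
  assumes "\<And>x. x \<in> A \<Longrightarrow> nm (f x) \<le> B" "B \<ge> 0"
  shows "nm (sum f A) \<le> B"
  using assms
proof (induction A rule: infinite_finite_induct)
  case (insert x A)
  have "nm (f x + sum f A) \<le> max (nm (f x)) (nm (sum f A))" by (rule nm_add)
  also have "\<dots> \<le> B" using insert by auto
  finally show ?case using insert.hyps by simp
qed auto

lemma nm_sum_less:
  assumes "\<And>x. x \<in> A \<Longrightarrow> nm (f x) < B" "B > 0"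
  shows "nm (sum f A) < B"
  using assms
proof (induction A rule: infinite_finite_induct)
  case (insert x A)
  have "nm (f x + sum f A) \<le> max (nm (f x)) (nm (sum f A))" by (rule nm_add)
  also have "\<dots> < B" using insert by auto
  finally show ?case using insert.hyps by simp
qed auto

lemma tendsto_nm_iff: "(f \<longlongrightarrow> l) F \<longleftrightarrow> ((\<lambda>x. nm (f x - l)) \<longlongrightarrow> 0) F"
  using tendsto_dist_iff[of f l F] by (simp add: dist_nm)

lemma tendsto_add_nm:
  fixes f g :: "'a \<Rightarrow> 'c"
  assumes "(f \<longlongrightarrow> a) F" "(g \<longlongrightarrow> b) F"
  shows "((\<lambda>x. f x + g x) \<longlongrightarrow> a + b) F"
proof -
  have "((\<lambda>x. nm (f x - a) + nm (g x - b)) \<longlongrightarrow> 0 + 0) F"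
    using assms by (intro tendsto_add) (simp_all add: tendsto_nm_iff)
  hence lim: "((\<lambda>x. nm (f x - a) + nm (g x - b)) \<longlongrightarrow> 0) F" by simp
  have le: "nm (f x + g x - (a + b)) \<le> nm (f x - a) + nm (g x - b)" for x
  proof -
    have "nm (f x + g x - (a + b)) = nm ((f x - a) + (g x - b))" by (simp add: algebra_simps)
    thus ?thesis
      using nm_add[of "f x - a" "g x - b"] nm_nonneg[of "f x - a"] nm_nonneg[of "g x - b"]
      unfolding max_def by (auto split: if_splits simp del: nm_nonneg)
  qed
  have "((\<lambda>x. nm (f x + g x - (a + b))) \<longlongrightarrow> 0) F"
    by (rule tendsto_sandwich[OF _ _ tendsto_const lim]) (simp_all add: le)
  thus ?thesis by (simp only: tendsto_nm_iff[of "\<lambda>x. f x + g x"])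
qed

lemma tendsto_cmult_nm:
  fixes f :: "'a \<Rightarrow> 'c"
  assumes "(f \<longlongrightarrow> a) F"
  shows "((\<lambda>x. c * f x) \<longlongrightarrow> c * a) F"
proof -
  have "((\<lambda>x. nm c * nm (f x - a)) \<longlongrightarrow> nm c * 0) F"
    using assms by (intro tendsto_mult tendsto_const) (simp add: tendsto_nm_iff)
  thus ?thesis
    by (simp add: tendsto_nm_iff[of "\<lambda>x. c * f x"] flip: nm_mult right_diff_distrib)
qed

lemma tendsto_uminus_nm:
  fixes f :: "'a \<Rightarrow> 'c"
  shows "(f \<longlongrightarrow> a) F \<Longrightarrow> ((\<lambda>x. - f x) \<longlongrightarrow> - a) F"
  using tendsto_cmult_nm[of f a F "-1"] by simp

lemma tendsto_diff_nm:
  fixes f g :: "'a \<Rightarrow> 'c"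
  assumes "(f \<longlongrightarrow> a) F" "(g \<longlongrightarrow> b) F"
  shows "((\<lambda>x. f x - g x) \<longlongrightarrow> a - b) F"
  using tendsto_add_nm[OF assms(1) tendsto_uminus_nm[OF assms(2)]] by simp

lemma tendsto_nm:
  assumes "(f \<longlongrightarrow> a) F"
  shows "((\<lambda>x. nm (f x)) \<longlongrightarrow> nm a) F"
  using tendsto_dist[OF assms tendsto_const[of 0]] by (simp add: dist_nm)

lemma sums_add_nm:
  fixes f g :: "nat \<Rightarrow> 'c"
  shows "f sums a \<Longrightarrow> g sums b \<Longrightarrow> (\<lambda>i. f i + g i) sums (a + b)"
  unfolding sums_def sum.distrib by (rule tendsto_add_nm)

lemma sums_cmult_nm:
  fixes f :: "nat \<Rightarrow> 'c"
  shows "f sums a \<Longrightarrow> (\<lambda>i. c * f i) sums (c * a)"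
  unfolding sums_def sum_distrib_left [symmetric] by (rule tendsto_cmult_nm)

lemma sums_sum_nm:
  fixes f :: "'a \<Rightarrow> nat \<Rightarrow> 'c"
  assumes "\<And>i. i \<in> I \<Longrightarrow> f i sums a i"
  shows "(\<lambda>k. \<Sum>i\<in>I. f i k) sums (\<Sum>i\<in>I. a i)"
  using assms by (induction I rule: infinite_finite_induct) (auto intro: sums_add_nm)

lemma sums_imp_tendsto_zero:
  assumes "f sums a" shows "(\<lambda>i. nm (f i)) \<longlonglongrightarrow> 0"
proof -
  have 1: "(\<lambda>N. \<Sum>i<N. f i) \<longlonglongrightarrow> a" using assms by (simp add: sums_def)
  have "(\<lambda>N. (\<Sum>i<Suc N. f i) - (\<Sum>i<N. f i)) \<longlonglongrightarrow> a - a"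
    by (intro tendsto_diff_nm 1 filterlim_compose[OF 1 filterlim_Suc])
  thus ?thesis using tendsto_nm by fastforce
qed

lemma nm_sums_le:
  assumes "f sums a" "\<And>i. nm (f i) \<le> B"
  shows "nm a \<le> B"
proof -
  have B: "B \<ge> 0" using assms(2)[of 0] nm_nonneg order_trans by blast
  have "(\<lambda>N. nm (\<Sum>i<N. f i)) \<longlonglongrightarrow> nm a"
    using assms(1) by (intro tendsto_nm) (simp add: sums_def)
  thus ?thesis
    by (rule Lim_bounded[where M = 0]) (use assms(2) B in \<open>auto intro: nm_sum\<close>)
qed

text \<open>The ultrametric inequality makes partial sums Cauchy as soon as the terms tend to zero.\<close>

lemma sums_if_tendsto_zero:
  assumes "(\<lambda>i. nm (f i)) \<longlonglongrightarrow> 0"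
  shows "\<exists>a. f sums a"
proof -
  have "Cauchy (\<lambda>N. \<Sum>i<N. f i)"
  proof (rule metric_CauchyI)
    fix e :: real assume e: "e > 0"
    obtain M where M: "\<And>i. i \<ge> M \<Longrightarrow> nm (f i) < e"
      using order_tendstoD(2)[OF assms e] by (auto simp: eventually_sequentially)
    have *: "nm ((\<Sum>i<n. f i) - (\<Sum>i<m. f i)) < e" if "m \<ge> M" "m \<le> n" for m n
    proof -
      have "(\<Sum>i<n. f i) - (\<Sum>i<m. f i) = (\<Sum>i=m..<n. f i)"
        using that by (simp add: sum_diff_nat_ivl flip: atLeast0LessThan)
      thus ?thesis using M that e by (auto intro: nm_sum_less)
    qed
    have "dist (\<Sum>i<m. f i) (\<Sum>i<n. f i) < e" if "m \<ge> M" "n \<ge> M" for m n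
      using *[of m n] *[of n m] that by (cases "m \<le> n") (auto simp: dist_nm nm_minus_commute)
    thus "\<exists>M. \<forall>m\<ge>M. \<forall>n\<ge>M. dist (\<Sum>i<m. f i) (\<Sum>i<n. f i) < e" by blast
  qed
  thus ?thesis by (metis Cauchy_convergent_iff convergent_def sums_def)
qed

text \<open>
  Interchange of summation.  In the ultrametric setting it suffices that the rows converge and that
  they tend to zero uniformly; triangular support makes the column sums finite.
\<close>

lemma triangular_sum_swap:
  assumes small: "\<And>e. e > 0 \<Longrightarrow> \<exists>I. \<forall>i\<ge>I. \<forall>k. nm (c i k) < e"
    and rows: "\<And>i. (\<lambda>k. c i k) sums s i"
    and total: "s sums t"
    and tri: "\<And>i k. k < i \<Longrightarrow> c i k = 0"
  shows "(\<lambda>k. \<Sum>i\<le>k. c i k) sums t"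
proof -
  have "(\<lambda>N. (\<Sum>i<N. s i) - (\<Sum>k<N. \<Sum>i\<le>k. c i k)) \<longlonglongrightarrow> 0"
  proof (rule metric_LIMSEQ_I)
    fix e :: real assume e: "e > 0"
    obtain I where I: "\<And>i k. i \<ge> I \<Longrightarrow> nm (c i k) < e / 2"
      using small[of "e / 2"] e by fastforce
    have "\<exists>K. \<forall>N\<ge>K. nm (s i - (\<Sum>k<N. c i k)) < e" for i
    proof -
      have "(\<lambda>N. nm ((\<Sum>k<N. c i k) - s i)) \<longlonglongrightarrow> 0"
        using rows[of i] by (simp add: sums_def flip: tendsto_nm_iff)
      from order_tendstoD(2)[OF this e] show ?thesis
        by (simp add: eventually_sequentially nm_minus_commute)
    qed
    then obtain K where K: "\<And>i N. N \<ge> K i \<Longrightarrow> nm (s i - (\<Sum>k<N. c i k)) < e" by metis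
    define L where "L = Max (K ` {..I})"
    have L: "nm (s i - (\<Sum>k<N. c i k)) < e" if "N \<ge> L" for i N
    proof (cases "i < I")
      case True
      hence "K i \<le> L" unfolding L_def by (intro Max_ge) auto
      thus ?thesis using K[of i N] that by simp
    next
      case False
      hence c: "nm (c i k) < e / 2" for k using I by simp
      have "nm (s i) \<le> e / 2" using nm_sums_le[OF rows[of i]] c less_imp_le by blast
      moreover have "nm (\<Sum>k<N. c i k) < e / 2" using c e by (intro nm_sum_less) auto
      ultimately show ?thesis using nm_diff[of "s i" "\<Sum>k<N. c i k"] e by auto
    qed
    have "nm ((\<Sum>i<N. s i) - (\<Sum>k<N. \<Sum>i\<le>k. c i k)) < e" if N: "N \<ge> L" for N
    proof -
      have "(\<Sum>k<N. \<Sum>i\<le>k. c i k) = (\<Sum>k<N. \<Sum>i<N. c i k)"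
        by (intro sum.cong sum.mono_neutral_left) (use tri in auto)
      also have "\<dots> = (\<Sum>i<N. \<Sum>k<N. c i k)" by (rule sum.swap)
      finally have "(\<Sum>i<N. s i) - (\<Sum>k<N. \<Sum>i\<le>k. c i k) = (\<Sum>i<N. s i - (\<Sum>k<N. c i k))"
        by (simp add: sum_subtractf)
      thus ?thesis using L[OF N] e by (auto intro: nm_sum_less)
    qed
    thus "\<exists>L. \<forall>N\<ge>L. dist ((\<Sum>i<N. s i) - (\<Sum>k<N. \<Sum>i\<le>k. c i k)) 0 < e"
      by (auto simp: dist_nm)
  qed
  from tendsto_diff_nm[OF total[unfolded sums_def] this] show ?thesis by (simp add: sums_def)
qed

definition fps_sums :: "'c fps \<Rightarrow> 'c \<Rightarrow> 'c \<Rightarrow> bool" where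
  "fps_sums F v s \<longleftrightarrow> (\<lambda>i. fps_nth F i * v ^ i) sums s"

lemma fps_sums_bounded:
  assumes "fps_sums F v s"
  obtains B where "B > 0" "\<And>i. nm (fps_nth F i * v ^ i) \<le> B"
proof -
  have "Bseq (\<lambda>i. nm (fps_nth F i * v ^ i))"
    using sums_imp_tendsto_zero assms unfolding fps_sums_def
    by (intro convergent_imp_Bseq) (auto simp: convergent_def)
  thus ?thesis using that unfolding Bseq_def by fastforce
qed

text \<open>
  The products of terms are arranged in a triangle whose rows belong to the terms of \<open>F\<close> and whose columns sum
  to the Cauchy product.
\<close>

lemma fps_sums_mult:
  assumes F: "fps_sums F v s" and G: "fps_sums G v t"
  shows "fps_sums (F * G) v (s * t)"
proof -
  define c where "c i k = (if k < i then 0 else fps_nth F i * v ^ i * (fps_nth G (k - i) * v ^ (k - i)))" for i k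
  obtain B where B: "B > 0" "\<And>i. nm (fps_nth G i * v ^ i) \<le> B"
    using fps_sums_bounded[OF G] by blast
  have "(\<lambda>k. \<Sum>i\<le>k. c i k) sums (s * t)"
  proof (rule triangular_sum_swap)
    fix e :: real assume e: "e > 0"
    have "(\<lambda>i. nm (fps_nth F i * v ^ i)) \<longlonglongrightarrow> 0"
      using F sums_imp_tendsto_zero unfolding fps_sums_def by blast
    from order_tendstoD(2)[OF this, of "e / B"] e B(1)
    obtain I where I: "\<And>i. i \<ge> I \<Longrightarrow> nm (fps_nth F i * v ^ i) < e / B"
      by (auto simp: eventually_sequentially)
    have "nm (c i k) < e" if "i \<ge> I" for i k
    proof (cases "k < i")
      case False
      have "nm (c i k) = nm (fps_nth F i * v ^ i) * nm (fps_nth G (k - i) * v ^ (k - i))"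
        using False by (simp only: c_def if_False nm_mult)
      also have "\<dots> \<le> nm (fps_nth F i * v ^ i) * B"
        by (intro mult_left_mono B) simp
      also have "\<dots> < e" using I[OF that] B(1) by (simp add: field_simps)
      finally show ?thesis .
    qed (use e in \<open>simp add: c_def\<close>)
    thus "\<exists>I. \<forall>i\<ge>I. \<forall>k. nm (c i k) < e" by blast
  next
    fix i
    have "(\<lambda>k. c i (k + i)) = (\<lambda>k. fps_nth F i * v ^ i * (fps_nth G k * v ^ k))"
      by (simp add: c_def fun_eq_iff)
    hence "(\<lambda>k. c i (k + i)) sums (fps_nth F i * v ^ i * t)"
      using sums_cmult_nm[OF G[unfolded fps_sums_def]] by simp
    moreover have "(\<Sum>k<N + i. c i k) = (\<Sum>k<N. c i (k + i))" for N
    proof -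
      have "(\<Sum>k<N + i. c i k) = (\<Sum>k=i..<N + i. c i k)"
        by (rule sum.mono_neutral_right) (auto simp: c_def)
      also have "\<dots> = (\<Sum>k<N. c i (k + i))"
        using sum.shift_bounds_nat_ivl[of "c i" 0 i N] by (simp add: atLeast0LessThan)
      finally show ?thesis .
    qed
    ultimately have "(\<lambda>N. \<Sum>k<N + i. c i k) \<longlonglongrightarrow> fps_nth F i * v ^ i * t"
      by (simp add: sums_def)
    thus "(\<lambda>k. c i k) sums (fps_nth F i * v ^ i * t)"
      unfolding sums_def by (rule LIMSEQ_offset)
  next
    show "(\<lambda>i. fps_nth F i * v ^ i * t) sums (s * t)"
      using sums_cmult_nm[OF F[unfolded fps_sums_def], of t] by (simp add: mult.commute)
  qed (simp add: c_def)
  moreover have "(\<Sum>i\<le>k. c i k) = fps_nth (F * G) k * v ^ k" for k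
  proof -
    have "c i k = fps_nth F i * fps_nth G (k - i) * v ^ k" if "i \<le> k" for i
    proof -
      have "v ^ k = v ^ i * v ^ (k - i)" using that by (simp flip: power_add)
      thus ?thesis using that by (simp add: c_def)
    qed
    thus ?thesis by (simp add: fps_mult_nth sum_distrib_right atLeast0AtMost)
  qed
  ultimately show ?thesis by (simp add: fps_sums_def)
qed

lemma fps_sums_poly: "fps_sums (fps_of_poly p) v (poly p v)"
proof -
  have "(\<lambda>i. coeff p i * v ^ i) sums (\<Sum>i\<in>{..degree p}. coeff p i * v ^ i)"
    by (rule sums_finite) (auto simp: coeff_eq_0)
  thus ?thesis by (simp add: fps_sums_def poly_altdef)
qed

lemma fps_sums_power: "fps_sums F v s \<Longrightarrow> fps_sums (F ^ i) v (s ^ i)"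
  by (induction i) (use fps_sums_poly[of 1 v] in \<open>auto intro: fps_sums_mult\<close>)

lemma fps_sums_unique: "fps_sums F v s \<Longrightarrow> fps_sums F v t \<Longrightarrow> s = t"
  unfolding fps_sums_def by (rule sums_unique2)

definition geom_bounded :: "'c fps \<Rightarrow> bool" where
  "geom_bounded F \<longleftrightarrow> (\<exists>M r. \<forall>i. nm (fps_nth F i) \<le> M * r ^ i)"

lemma geom_boundedE:
  assumes "geom_bounded F"
  obtains M r where "M \<ge> 1" "r \<ge> 1" "\<And>i. nm (fps_nth F i) \<le> M * r ^ i"
proof -
  obtain M r where Mr: "\<And>i. nm (fps_nth F i) \<le> M * r ^ i"
    using assms unfolding geom_bounded_def by blast
  have "nm (fps_nth F i) \<le> max M 1 * max \<bar>r\<bar> 1 ^ i" for i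
  proof -
    have M: "M \<ge> 0" using order_trans[OF nm_nonneg Mr[of 0]] by simp
    have "M * r ^ i \<le> M * \<bar>r\<bar> ^ i"
      using M power_abs[of r i] abs_ge_self[of "r ^ i"] by (intro mult_left_mono) simp_all
    also have "\<dots> \<le> max M 1 * max \<bar>r\<bar> 1 ^ i"
      using M by (intro mult_mono power_mono) auto
    finally show ?thesis using Mr[of i] by linarith
  qed
  thus ?thesis by (intro that[of "max M 1" "max \<bar>r\<bar> 1"]) simp_all
qed

lemma tendsto_geom:
  assumes "\<And>i. nm (x i) \<le> M * r ^ i" "0 \<le> r" "r < 1"
  shows "(\<lambda>i. nm (x i)) \<longlonglongrightarrow> 0"
proof -
  have "(\<lambda>i. M * r ^ i) \<longlonglongrightarrow> M * 0"
    using assms(2,3) by (intro tendsto_mult tendsto_const LIMSEQ_power_zero) auto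
  hence lim: "(\<lambda>i. M * r ^ i) \<longlonglongrightarrow> 0" by simp
  show ?thesis
    by (rule tendsto_sandwich[OF _ _ tendsto_const lim]) (simp_all add: assms(1))
qed

lemma geom_bounded_sums:
  assumes "\<And>i. nm (fps_nth F i) \<le> M * r ^ i" "0 \<le> r" "r * nm v < 1"
  shows "\<exists>s. fps_sums F v s"
  unfolding fps_sums_def
proof (rule sums_if_tendsto_zero, rule tendsto_geom)
  show "nm (fps_nth F i * v ^ i) \<le> M * (r * nm v) ^ i" for i
    using mult_right_mono[OF assms(1)[of i], of "nm v ^ i"]
    by (simp add: nm_mult nm_power power_mult_distrib mult_ac)
qed (use assms in auto)

lemma geom_bounded_if_sums:
  assumes "fps_sums F v s" "v \<noteq> 0"
  shows "geom_bounded F"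
proof -
  obtain B where B: "\<And>i. nm (fps_nth F i * v ^ i) \<le> B" using fps_sums_bounded[OF assms(1)] by blast
  have "nm (fps_nth F i) \<le> B * (inverse (nm v)) ^ i" for i
  proof -
    have "nm (fps_nth F i) * nm v ^ i \<le> B" using B[of i] by (simp add: nm_mult nm_power)
    moreover have "nm v ^ i > 0" using assms(2) by simp
    ultimately have "nm (fps_nth F i) \<le> B / nm v ^ i" by (simp only: pos_le_divide_eq)
    thus ?thesis by (simp add: power_inverse divide_inverse)
  qed
  thus ?thesis unfolding geom_bounded_def by blast
qed

text \<open>
  The growth bound is part of the notion, since convergence for all small \<open>v\<close> implies it only if the field
  has small elements other than \<open>0\<close>.
\<close>

definition expands :: "('c \<Rightarrow> 'c) \<Rightarrow> 'c fps \<Rightarrow> bool" where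
  "expands \<phi> F \<longleftrightarrow> geom_bounded F \<and> (\<exists>r>0. \<forall>v. nm v < r \<longrightarrow> fps_sums F v (\<phi> v))"

lemma expands_if_geom_bounded:
  assumes "geom_bounded F"
  shows "expands (\<lambda>v. THE s. fps_sums F v s) F"
proof -
  obtain M r where Mr: "M \<ge> 1" "r \<ge> 1" "\<And>i. nm (fps_nth F i) \<le> M * r ^ i"
    using geom_boundedE[OF assms] by blast
  have "fps_sums F v (THE s. fps_sums F v s)" if "nm v < 1 / r" for v
  proof -
    have "\<exists>s. fps_sums F v s"
    proof (rule geom_bounded_sums[OF Mr(3)])
      show "r * nm v < 1" using that Mr(2) by (simp add: less_divide_eq mult.commute)
    qed (use Mr in simp)
    then obtain s where s: "fps_sums F v s" ..
    show ?thesis by (rule theI[of _ s]) (use s fps_sums_unique in blast)+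
  qed
  thus ?thesis unfolding expands_def using assms Mr(2) by (intro conjI exI[of _ "1 / r"]) auto
qed

lemma expands_mult:
  assumes "expands \<phi> F" "expands \<psi> G"
  shows "expands (\<lambda>v. \<phi> v * \<psi> v) (F * G)"
proof -
  obtain M r where F: "M \<ge> 1" "r \<ge> 1" "\<And>i. nm (fps_nth F i) \<le> M * r ^ i"
    using assms(1) geom_boundedE unfolding expands_def by metis
  obtain M' r' where G: "M' \<ge> 1" "r' \<ge> 1" "\<And>i. nm (fps_nth G i) \<le> M' * r' ^ i"
    using assms(2) geom_boundedE unfolding expands_def by metis
  have "nm (fps_nth (F * G) i) \<le> (M * M') * (r * r') ^ i" for i
    unfolding fps_mult_nth
  proof (rule nm_sum)
    fix j assume "j \<in> {0..i}"
    hence j: "j \<le> i" by simp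
    have "nm (fps_nth F j * fps_nth G (i - j)) \<le> (M * r ^ j) * (M' * r' ^ (i - j))"
      unfolding nm_mult using F G by (intro mult_mono) auto
    also have "\<dots> \<le> (M * r ^ i) * (M' * r' ^ i)"
      using F G j by (intro mult_mono mult_left_mono power_increasing) auto
    finally show "nm (fps_nth F j * fps_nth G (i - j)) \<le> M * M' * (r * r') ^ i"
      by (simp add: power_mult_distrib mult_ac)
  qed (use F G in auto)
  hence "geom_bounded (F * G)" unfolding geom_bounded_def by blast
  moreover obtain e where "e > 0" "\<And>v. nm v < e \<Longrightarrow> fps_sums F v (\<phi> v)"
    using assms(1) unfolding expands_def by blast
  moreover obtain e' where "e' > 0" "\<And>v. nm v < e' \<Longrightarrow> fps_sums G v (\<psi> v)"
    using assms(2) unfolding expands_def by blast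
  ultimately show ?thesis
    unfolding expands_def by (intro conjI exI[of _ "min e e'"]) (auto intro: fps_sums_mult)
qed

lemma expands_poly: "expands (poly p) (fps_of_poly p)"
proof -
  have "geom_bounded (fps_of_poly p)"
    unfolding geom_bounded_def
  proof (intro exI allI)
    show "nm (fps_nth (fps_of_poly p) i) \<le> (\<Sum>i\<le>degree p. nm (coeff p i)) * 1 ^ i" for i
    proof (cases "i \<le> degree p")
      case True
      thus ?thesis using member_le_sum[of i "{..degree p}" "\<lambda>i. nm (coeff p i)"] by simp
    next
      case False
      hence "coeff p i = 0" by (intro coeff_eq_0) simp
      thus ?thesis by (simp add: sum_nonneg)
    qed
  qed
  thus ?thesis using fps_sums_poly unfolding expands_def by (auto intro: exI[of _ 1])
qed

lemma expands_geometric: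
  assumes c: "c \<noteq> 0"
  shows "expands (\<lambda>v. inverse (c - v)) (Abs_fps (\<lambda>i. (1 / c) ^ Suc i))"
proof -
  let ?G = "Abs_fps (\<lambda>i. (1 / c) ^ Suc i)"
  have bound: "nm (fps_nth ?G i) \<le> nm (1 / c) * nm (1 / c) ^ i" for i
    by (simp add: nm_mult nm_divide nm_power power_divide)
  have "fps_sums ?G v (inverse (c - v))" if v: "nm v < nm c" for v
  proof -
    have "nm (1 / c) * nm v < 1" using v c by (simp add: nm_divide)
    then obtain s where s: "fps_sums ?G v s" using geom_bounded_sums[OF bound nm_nonneg] by blast
    have "fps_sums (fps_of_poly [:- c, 1:] * ?G) v (poly [:- c, 1:] v * s)"
      by (rule fps_sums_mult[OF fps_sums_poly s])
    hence "fps_sums (- 1) v (poly [:- c, 1:] v * s)" by (simp only: fps_inverse_linear_factor[OF c])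
    moreover have "fps_sums (- 1) v (- 1)" using fps_sums_poly[of "- 1" v] by (simp add: fps_of_poly_uminus)
    ultimately have "poly [:- c, 1:] v * s = - 1" by (rule fps_sums_unique)
    hence "(c - v) * s = 1" by (simp add: algebra_simps)
    hence "s = inverse (c - v)" by (rule inverse_unique [symmetric])
    thus ?thesis using s by simp
  qed
  thus ?thesis
    unfolding expands_def geom_bounded_def using bound c by (intro conjI exI[of _ "nm c"] exI allI) auto
qed

lemma nm_power_nth:
  assumes "\<And>k. nm (fps_nth H k) * x ^ k \<le> \<delta>" "x \<ge> 0"
  shows "nm (fps_nth (H ^ i) k) * x ^ k \<le> \<delta> ^ i"
proof (induction i arbitrary: k)
  case 0
  thus ?case by (cases "k = 0") auto
next
  case (Suc i)
  have \<delta>: "\<delta> \<ge> 0" using assms(1)[of 0] nm_nonneg[of "fps_nth H 0"] by (simp del: nm_nonneg)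
  show ?case
  proof (cases "x = 0")
    case True
    show ?thesis
    proof (cases "k = 0")
      case k: True
      have "nm (fps_nth H 0) * nm (fps_nth (H ^ i) 0) \<le> \<delta> * \<delta> ^ i"
        using assms(1)[of 0] Suc[of 0] \<delta> by (intro mult_mono) auto
      thus ?thesis using k by (simp add: nm_mult)
    qed (use True \<delta> in \<open>simp add: zero_power\<close>)
  next
    case False
    have "nm (fps_nth (H ^ Suc i) k) \<le> \<delta> ^ Suc i / x ^ k"
      unfolding power_Suc[of H] fps_mult_nth
    proof (rule nm_sum)
      fix j assume "j \<in> {0..k}"
      hence x: "x ^ k = x ^ j * x ^ (k - j)" by (simp flip: power_add)
      have "(nm (fps_nth H j) * x ^ j) * (nm (fps_nth (H ^ i) (k - j)) * x ^ (k - j)) \<le> \<delta> * \<delta> ^ i"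
        using assms Suc \<delta> by (intro mult_mono) auto
      thus "nm (fps_nth H j * fps_nth (H ^ i) (k - j)) \<le> \<delta> ^ Suc i / x ^ k"
        using False assms(2) by (simp add: nm_mult x field_simps)
    qed (use \<delta> assms(2) in auto)
    moreover have "x ^ k > 0" using False assms(2) by simp
    ultimately show ?thesis by (simp only: pos_le_divide_eq)
  qed
qed

text \<open>
  For small \<open>v\<close> all terms of \<open>H\<close> at \<open>v\<close> are bounded by some small \<open>\<delta>\<close>, and then those of \<open>H\<^sup>i\<close> by \<open>\<delta>\<^sup>i\<close>
  (lemma \<open>nm_power_nth\<close>).  Therefore the terms of the series \<open>F\<^sub>i H\<^sup>i\<close> tend to zero uniformly, and the two
  summations may be exchanged.
\<close>

lemma expands_compose:
  assumes "expands \<phi> F" "expands \<psi> H" and H0: "fps_nth H 0 = 0"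
  shows "expands (\<phi> \<circ> \<psi>) (fps_compose F H)"
proof -
  obtain M r where F: "M \<ge> 1" "r \<ge> 1" "\<And>i. nm (fps_nth F i) \<le> M * r ^ i"
    using assms(1) geom_boundedE unfolding expands_def by metis
  obtain M' r' where H: "M' \<ge> 1" "r' \<ge> 1" "\<And>i. nm (fps_nth H i) \<le> M' * r' ^ i"
    using assms(2) geom_boundedE unfolding expands_def by metis
  obtain e where e: "e > 0" "\<And>v. nm v < e \<Longrightarrow> fps_sums F v (\<phi> v)"
    using assms(1) unfolding expands_def by blast
  obtain e' where e': "e' > 0" "\<And>v. nm v < e' \<Longrightarrow> fps_sums H v (\<psi> v)"
    using assms(2) unfolding expands_def by blast
  have tri: "fps_nth (H ^ i) k = 0" if "k < i" for i k
    using that H0 by (simp add: startsby_zero_power_prefix)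
  have Hx: "nm (fps_nth H k) * x ^ k \<le> M' * (r' * x)" if x: "x \<ge> 0" "r' * x \<le> 1" for k x
  proof (cases k)
    case (Suc j)
    have "nm (fps_nth H k) * x ^ k \<le> M' * r' ^ k * x ^ k"
      by (rule mult_right_mono) (use H x in auto)
    also have "\<dots> = M' * (r' * x) ^ k" by (simp add: power_mult_distrib)
    also have "(r' * x) ^ k \<le> r' * x"
      using power_le_one[of "r' * x" j] x H(2) mult_left_mono[of "(r' * x) ^ j" 1 "r' * x"]
      by (simp add: Suc)
    finally show ?thesis using H(1) by (simp add: mult_left_mono)
  qed (use H0 H x in simp)
  define x0 where "x0 = min (min (1 / (r' * M' * r * 2)) e') (e / (M' * r' * 2))"
  have x0: "x0 > 0" unfolding x0_def using F H e(1) e'(1) by auto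
  have "fps_sums (fps_compose F H) v (\<phi> (\<psi> v))" if v: "nm v < x0" for v
  proof -
    define \<delta> where "\<delta> = M' * (r' * nm v)"
    have "nm v < 1 / (r' * M' * r * 2)" using v by (simp add: x0_def)
    hence \<delta>1: "\<delta> * r < 1 / 2" using F H by (simp add: \<delta>_def field_simps)
    have "nm v < e / (M' * r' * 2)" using v by (simp add: x0_def)
    hence \<delta>2: "\<delta> < e" using F H e(1) by (simp add: \<delta>_def field_simps)
    have \<delta>0: "\<delta> \<ge> 0" using H by (simp add: \<delta>_def)
    have "\<delta> \<le> \<delta> * r" using \<delta>0 F(2) mult_left_mono[of 1 r \<delta>] by simp
    moreover have "r' * nm v \<le> \<delta>" unfolding \<delta>_def using H mult_right_mono[of 1 M' "r' * nm v"] by simp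
    ultimately have v1: "r' * nm v \<le> 1" using \<delta>1 by linarith
    have pow: "nm (fps_nth (H ^ i) k * v ^ k) \<le> \<delta> ^ i" for i k
      using nm_power_nth[of H "nm v" \<delta> i k] Hx[OF _ v1] by (simp add: nm_mult nm_power \<delta>_def)
    have Hs: "fps_sums H v (\<psi> v)" using e'(2) v by (simp add: x0_def)
    have "nm (\<psi> v) \<le> \<delta>"
      using nm_sums_le[OF Hs[unfolded fps_sums_def], of \<delta>] pow[of 1] by simp
    hence Fs: "fps_sums F (\<psi> v) (\<phi> (\<psi> v))" using e(2) \<delta>2 by simp
    define c where "c i k = fps_nth F i * (fps_nth (H ^ i) k * v ^ k)" for i k
    have "(\<lambda>k. \<Sum>i\<le>k. c i k) sums \<phi> (\<psi> v)"
    proof (rule triangular_sum_swap)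
      have cb: "nm (c i k) \<le> M * (1 / 2) ^ i" for i k
      proof -
        have "nm (c i k) \<le> (M * r ^ i) * \<delta> ^ i"
          unfolding c_def nm_mult[of "fps_nth F i"] using F pow by (intro mult_mono) auto
        also have "\<dots> = M * (\<delta> * r) ^ i" by (simp add: power_mult_distrib)
        also have "\<dots> \<le> M * (1 / 2) ^ i"
          using \<delta>1 \<delta>0 F by (intro mult_left_mono power_mono) auto
        finally show ?thesis .
      qed
      fix e :: real assume "e > 0"
      have "(\<lambda>i. M * (1 / 2) ^ i) \<longlonglongrightarrow> M * 0"
        by (intro tendsto_mult tendsto_const LIMSEQ_power_zero) auto
      from order_tendstoD(2)[OF this, of e] \<open>e > 0\<close>
      obtain I where "\<And>i. i \<ge> I \<Longrightarrow> M * (1 / 2) ^ i < e"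
        by (auto simp: eventually_sequentially)
      thus "\<exists>I. \<forall>i\<ge>I. \<forall>k. nm (c i k) < e" using cb by (meson le_less_trans)
    next
      show "c i sums (fps_nth F i * \<psi> v ^ i)" for i
        unfolding c_def using fps_sums_power[OF Hs, of i] by (intro sums_cmult_nm) (simp add: fps_sums_def)
    next
      show "(\<lambda>i. fps_nth F i * \<psi> v ^ i) sums \<phi> (\<psi> v)" using Fs by (simp add: fps_sums_def)
    qed (simp add: c_def tri)
    moreover have "(\<Sum>i\<le>k. c i k) = fps_nth (fps_compose F H) k * v ^ k" for k
      by (simp add: c_def fps_compose_nth sum_distrib_right atLeast0AtMost mult.assoc)
    ultimately show ?thesis by (simp add: fps_sums_def)
  qed
  moreover have "geom_bounded (fps_compose F H)"
    unfolding geom_bounded_def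
  proof (intro exI allI)
    fix k
    show "nm (fps_nth (fps_compose F H) k) \<le> M * (r * M' * r') ^ k"
      unfolding fps_compose_nth
    proof (rule nm_sum)
      fix i assume i: "i \<in> {0..k}"
      have "nm (fps_nth (H ^ i) k) * (1 / r') ^ k \<le> (M' * (r' * (1 / r'))) ^ i"
        by (rule nm_power_nth[OF Hx]) (use H in auto)
      hence "nm (fps_nth (H ^ i) k) \<le> M' ^ i * r' ^ k"
        using H by (simp add: field_simps)
      hence "nm (fps_nth F i * fps_nth (H ^ i) k) \<le> (M * r ^ i) * (M' ^ i * r' ^ k)"
        unfolding nm_mult using F H by (intro mult_mono) auto
      also have "\<dots> \<le> (M * r ^ k) * (M' ^ k * r' ^ k)"
        using F H i by (intro mult_mono mult_left_mono mult_right_mono power_increasing) auto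
      finally show "nm (fps_nth F i * fps_nth (H ^ i) k) \<le> M * (r * M' * r') ^ k"
        by (simp add: power_mult_distrib mult_ac)
    qed (use F H in auto)
  qed
  ultimately show ?thesis unfolding expands_def using x0 by auto
qed

end

section \<open>Finite additive groups of roots\<close>

text \<open>
  For fixed \<open>y\<close> the two sides are monic polynomials in \<open>x\<close> of degree \<open>card V\<close>.  They agree on \<open>V\<close>, because translation by
  an element of \<open>V\<close> permutes the factors.
\<close>

lemma prod_linear_additive:
  fixes V :: "'a::field set"
  assumes fin: "finite V" and "0 \<in> V" and sub: "\<And>v w. v \<in> V \<Longrightarrow> w \<in> V \<Longrightarrow> v - w \<in> V"
  shows "(\<Prod>w\<in>V. x + y - w) = (\<Prod>w\<in>V. x - w) + (\<Prod>w\<in>V. y - w)"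
proof -
  have add: "v + w \<in> V" if "v \<in> V" "w \<in> V" for v w
    using sub[OF that(1) sub[OF \<open>0 \<in> V\<close> that(2)]] by simp
  define p where "p = (\<Prod>w\<in>V. [:- w, 1:])"
  define r where "r = pcompose p [:y, 1:] - [:poly p y:]"
  have p: "poly p z = (\<Prod>w\<in>V. z - w)" for z
    by (simp add: p_def poly_prod)
  have N: "card V > 0" using assms card_gt_0_iff by blast
  have deg: "degree p = card V" unfolding p_def by (subst degree_prod_eq_sum_degree) auto
  have lead: "coeff p (card V) = 1"
    using lead_coeff_prod[of "\<lambda>w. [:- w, 1:]" V] deg unfolding p_def by simp
  have degc: "degree (pcompose p [:y, 1:]) = card V" using deg by (simp add: degree_pcompose)
  have "p = r"
  proof (rule poly_eqI_degree_lead_coeff)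
    have "coeff (pcompose p [:y, 1:]) (card V) = 1"
      using lead_coeff_comp[of "[:y, 1:]" p] lead deg degc by simp
    thus "coeff p (card V) = coeff r (card V)"
      using lead N by (simp add: r_def coeff_pCons split: nat.splits)
    show "degree r \<le> card V"
      unfolding r_def using degc N by (intro degree_diff_le) auto
    fix v assume v: "v \<in> V"
    have "(\<Prod>w\<in>V. y + v - w) = (\<Prod>w\<in>V. y - w)"
      by (rule prod.reindex_bij_witness[of _ "\<lambda>w. w + v" "\<lambda>w. w - v"]) (use v sub add in auto)
    thus "poly p v = poly r v"
      using v fin by (auto simp: r_def poly_pcompose p intro!: prod_zero)
  qed (use deg in auto)
  hence "poly p x = poly r x" by simp
  thus ?thesis by (simp add: r_def poly_pcompose p add.commute)
qed

section \<open>Polynomials of bounded degree\<close>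

text \<open>
  In contrast to \<open>degree a < d\<close> this includes the zero polynomial if \<open>d = 0\<close>, so that \<open>lowdeg d\<close> is always a
  group, with \<open>q\<^sup>d\<close> elements.
\<close>

definition lowdeg :: "nat \<Rightarrow> 'q::zero poly set" where
  "lowdeg d = {a. \<forall>i\<ge>d. coeff a i = 0}"

lemma lowdeg_iff: "a \<in> lowdeg d \<longleftrightarrow> a = 0 \<or> degree a < d"
proof
  assume a: "a \<in> lowdeg d"
  show "a = 0 \<or> degree a < d"
    using a leading_coeff_0_iff[of a] unfolding lowdeg_def by (cases "degree a < d") auto
qed (auto simp: lowdeg_def coeff_eq_0)

lemma lowdeg_0: "lowdeg 0 = {0}"
  by (auto simp: lowdeg_iff)

lemma lowdeg_Suc: "(lowdeg (Suc d) :: 'q::zero poly set) = (\<lambda>(c, a). pCons c a) ` (UNIV \<times> lowdeg d)"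
proof (rule Set.set_eqI)
  fix a :: "'q poly"
  obtain c b where "a = pCons c b" by (cases a)
  moreover have "(\<forall>i\<ge>Suc d. coeff (pCons c b) i = 0) \<longleftrightarrow> (\<forall>i\<ge>d. coeff b i = 0)"
    by (metis Suc_le_D Suc_le_mono coeff_pCons_Suc)
  ultimately show "a \<in> lowdeg (Suc d) \<longleftrightarrow> a \<in> (\<lambda>(c, a). pCons c a) ` (UNIV \<times> lowdeg d)"
    unfolding lowdeg_def by auto
qed

lemma finite_lowdeg: "finite (lowdeg d :: 'q::{finite,zero} poly set)"
  by (induction d) (auto simp: lowdeg_0 lowdeg_Suc)

lemma card_lowdeg: "card (lowdeg d :: 'q::{finite,zero} poly set) = CARD('q) ^ d"
proof (induction d)
  case (Suc d)
  have "inj_on (\<lambda>(c :: 'q, a). pCons c a) (UNIV \<times> lowdeg d)" by (auto simp: inj_on_def)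
  thus ?case by (simp add: lowdeg_Suc card_image card_cartesian_product Suc)
qed (simp add: lowdeg_0)

lemma lowdeg_diff: "a \<in> lowdeg d \<Longrightarrow> b \<in> lowdeg d \<Longrightarrow> (a - b :: 'q::ab_group_add poly) \<in> lowdeg d"
  by (simp add: lowdeg_def)

lemma lowdeg_mono: "d \<le> e \<Longrightarrow> lowdeg d \<subseteq> lowdeg e"
  by (auto simp: lowdeg_def)

section \<open>The embeddings of A and of the Laurent series field\<close>

lemma poly_to_K_0 [simp]: "poly_to_K 0 = 0"
  by (simp add: poly_to_K_def)

lemma poly_to_K_pCons: "poly_to_K (pCons c p) = fls_const c + fls_X_inv * poly_to_K p"
  by (simp add: poly_to_K_def map_poly_pCons)

lemma poly_to_K_add: "poly_to_K (p + r) = poly_to_K p + poly_to_K r"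
  by (induction p r rule: poly_induct2)
     (simp_all add: poly_to_K_pCons algebra_simps flip: fls_plus_const)

lemma poly_to_K_1 [simp]: "poly_to_K 1 = 1"
  by (simp add: poly_to_K_pCons flip: one_pCons fls_const_1, simp add: one_pCons poly_to_K_pCons)

lemma poly_to_K_smult: "poly_to_K (smult c p) = fls_const c * poly_to_K p"
  by (induction p) (simp_all add: poly_to_K_pCons algebra_simps flip: fls_const_mult_const)

lemma poly_to_K_mult: "poly_to_K (p * r) = poly_to_K p * poly_to_K r"
  by (induction p) (simp_all add: poly_to_K_pCons poly_to_K_add poly_to_K_smult algebra_simps)

lemma poly_to_K_uminus: "poly_to_K (- p) = - poly_to_K p"
  using poly_to_K_add[of p "- p"] by (simp add: eq_neg_iff_add_eq_0 add.commute)

lemma poly_to_K_diff: "poly_to_K (p - r) = poly_to_K p - poly_to_K r"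
  using poly_to_K_add[of p "- r"] by (simp add: poly_to_K_uminus)

lemma card_finite_field_ge_2: "CARD('q::{finite,field}) \<ge> 2"
  using card_mono[of UNIV "{0, 1 :: 'q}"] by simp

lemma of_nat_card_finite_ring: "of_nat CARD('q) = (0 :: 'q::{finite,ring_1})"
proof -
  have "(\<Sum>x\<in>(UNIV :: 'q set). x) = (\<Sum>x\<in>UNIV. x + 1)"
    by (rule sum.reindex_bij_witness[of _ "\<lambda>x. x + 1" "\<lambda>x. x - 1"]) auto
  thus ?thesis by (simp add: sum.distrib)
qed

sublocale completed_alg_closure \<subseteq> complete_nonarch_field "\<lambda>x :: 'c. dist x 0"
  by standard (use dist_diff dist_mult dist_add in auto)

context completed_alg_closure
begin

abbreviation "nm x \<equiv> dist x (0 :: 'c)"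
abbreviation "ofK \<equiv> of_K \<iota>"
abbreviation "ofA \<equiv> of_A \<iota>"
abbreviation "slashA \<equiv> slash_A \<iota>"
abbreviation "\<Omega> \<equiv> upper_half \<iota>"
abbreviation "imag \<equiv> imag_abs \<iota>"

lemma \<iota>_zero: "\<iota> 0 = 0"
  using \<iota>_add[of 0 0] by (metis add.right_neutral add_left_cancel)

lemma of_K_0 [simp]: "ofK 0 = 0"
  by (simp add: of_K_def \<iota>_zero)

lemma of_K_1 [simp]: "ofK 1 = 1"
  by (simp add: of_K_def \<iota>_one)

lemma of_K_add: "ofK (x + y) = ofK x + ofK y"
  by (simp add: of_K_def \<iota>_add)

lemma of_K_mult: "ofK (x * y) = ofK x * ofK y"
  by (simp add: of_K_def \<iota>_mult)

lemma of_K_uminus: "ofK (- x) = - ofK x"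
  using of_K_add[of x "- x"] by (simp add: eq_neg_iff_add_eq_0 add.commute)

lemma of_K_diff: "ofK (x - y) = ofK x - ofK y"
  using of_K_add[of x "- y"] by (simp add: of_K_uminus)

lemma of_K_eq_0_iff [simp]: "ofK x = 0 \<longleftrightarrow> x = 0"
proof
  assume 0: "ofK x = 0"
  show "x = 0"
  proof (rule ccontr)
    assume "x \<noteq> 0"
    hence "ofK (x * inverse x) = 1" by simp
    thus False using 0 by (simp add: of_K_mult del: right_inverse)
  qed
qed simp

lemma of_K_inverse: "ofK (inverse x) = inverse (ofK x)"
proof (cases "x = 0")
  case False
  hence "ofK x * ofK (inverse x) = 1" by (simp flip: of_K_mult)
  thus ?thesis by (rule inverse_unique [symmetric])
qed simp

lemma of_K_divide: "ofK (x / y) = ofK x / ofK y"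
  by (simp add: divide_inverse of_K_mult of_K_inverse)

lemma nm_of_K: "nm (ofK x) = abs_K x"
  by (simp add: of_K_def dist_K)

lemma of_A_0 [simp]: "ofA 0 = 0"
  by (simp add: of_A_def)

lemma of_A_1 [simp]: "ofA 1 = 1"
  by (simp add: of_A_def)

lemma of_A_add: "ofA (x + y) = ofA x + ofA y"
  by (simp add: of_A_def poly_to_K_add of_K_add)

lemma of_A_mult: "ofA (x * y) = ofA x * ofA y"
  by (simp add: of_A_def poly_to_K_mult of_K_mult)

lemma of_A_diff: "ofA (x - y) = ofA x - ofA y"
  by (simp add: of_A_def poly_to_K_diff of_K_diff)

lemma of_A_of_nat: "ofA (of_nat i) = of_nat i"
  by (induction i) (simp_all add: of_A_add)

lemma of_A_pCons: "ofA (pCons c p) = ofA [:c:] + ofA [:0, 1:] * ofA p"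
  by (simp flip: of_A_mult of_A_add)

lemma nm_of_A_const: "c \<noteq> 0 \<Longrightarrow> nm (ofA [:c:]) = 1"
  by (simp add: of_A_def nm_of_K poly_to_K_pCons abs_K_def)

lemma nm_of_A: "p \<noteq> 0 \<Longrightarrow> nm (ofA p) = real CARD('q) ^ degree p"
proof (induction p)
  case (pCons c p)
  have T: "nm (ofA [:0, 1:]) = real CARD('q)"
    by (simp add: of_A_def nm_of_K poly_to_K_pCons abs_K_def)
  show ?case
  proof (cases "p = 0")
    case True
    thus ?thesis using pCons.hyps by (simp add: nm_of_A_const)
  next
    case False
    have "nm (ofA [:0, 1:] * ofA p) = real CARD('q) ^ Suc (degree p)"
      using pCons.IH[OF False] by (simp add: T nm_mult)
    moreover have "nm (ofA [:c:]) \<le> 1" by (cases "c = 0") (simp_all add: nm_of_A_const)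
    moreover have "real CARD('q) ^ Suc (degree p) > 1"
      using card_finite_field_ge_2[where 'q = 'q] by (intro one_less_power) auto
    ultimately show ?thesis
      using nm_add_eq[of "ofA [:c:]" "ofA [:0, 1:] * ofA p"] False
      by (simp add: of_A_pCons[of c p])
  qed
qed simp

lemma of_A_eq_0_iff [simp]: "ofA p = 0 \<longleftrightarrow> p = 0"
proof
  assume "ofA p = 0"
  thus "p = 0" using nm_of_A[of p] by (cases "p = 0") auto
qed simp

lemma of_nat_card_eq_0: "of_nat CARD('q) = (0 :: 'c)"
proof -
  have "ofA [:of_nat CARD('q):] = 0" by (simp add: of_nat_card_finite_ring)
  moreover have "[:of_nat CARD('q):] = (of_nat CARD('q) :: 'q poly)" by (simp add: of_nat_poly)
  ultimately show ?thesis by (simp only: of_A_of_nat)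
qed

lemma two_neq_0:
  assumes "odd CARD('q)" shows "(2 :: 'c) \<noteq> 0"
proof
  assume 2: "(2 :: 'c) = 0"
  obtain m where "CARD('q) = 2 * m + 1" using assms by (auto elim: oddE)
  hence "(0 :: 'c) = 2 * of_nat m + 1"
    using of_nat_card_eq_0 by (metis of_nat_1 of_nat_add of_nat_mult of_nat_numeral)
  thus False using 2 by simp
qed

lemma imag_abs_le: "imag z \<le> nm (z - ofK x)"
  unfolding imag_abs_def dist_nm [symmetric] by (intro infdist_le) auto

section \<open>The lattice exponential\<close>

lemma nm_prod_one_minus:
  assumes "\<And>w. w \<in> F \<Longrightarrow> nm (x w) \<le> \<delta>" "0 \<le> \<delta>" "\<delta> \<le> 1"
  shows "nm ((\<Prod>w\<in>F. 1 - x w) - 1) \<le> \<delta>"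
  using assms
proof (induction F rule: infinite_finite_induct)
  case (insert w F)
  let ?P = "\<Prod>w\<in>F. 1 - x w"
  have IH: "nm (?P - 1) \<le> \<delta>" using insert by auto
  have "nm ?P \<le> 1" using nm_add[of "?P - 1" 1] IH insert.prems by simp
  moreover have "nm (x w) \<le> \<delta>" using insert.prems by simp
  ultimately have "nm (x w * ?P) \<le> \<delta>"
    using mult_mono[of "nm (x w)" \<delta> "nm ?P" 1] insert.prems by (simp add: nm_mult)
  hence "nm ((?P - 1) - x w * ?P) \<le> \<delta>"
    using IH nm_diff[of "?P - 1" "x w * ?P"] by linarith
  also have "(?P - 1) - x w * ?P = (1 - x w) * ?P - 1" by (simp add: algebra_simps)
  also have "(1 - x w) * ?P = (\<Prod>w\<in>insert w F. 1 - x w)" using insert.hyps by simp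
  finally show ?case .
qed auto

end

locale scaled_A_lattice = completed_alg_closure \<iota>
  for \<iota> :: "'q::{finite,field} fls alg_closure \<Rightarrow> 'c::{field,complete_space}" +
  fixes \<pi> :: 'c
  assumes \<pi>_nz: "\<pi> \<noteq> 0"
begin

definition L :: "'c set" where "L = scaled_lattice \<iota> \<pi>"

definition Ld :: "nat \<Rightarrow> 'c set" where "Ld d = (\<lambda>a. \<pi> * ofA a) ` lowdeg d"

text \<open>
  The argument is rescaled so that the zeros of \<open>E\<close> are the elements of \<open>A\<close>; then \<open>u = 1/E\<close>.
\<close>

definition E :: "'c \<Rightarrow> 'c" where "E z = lattice_exp L (\<pi> * z)"

lemma finite_Ld: "finite (Ld d)"
  unfolding Ld_def by (intro finite_imageI finite_lowdeg)

lemma Ld_subset: "Ld d \<subseteq> L"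
  by (auto simp: Ld_def L_def scaled_lattice_def)

lemma Ld_mono: "d \<le> e \<Longrightarrow> Ld d \<subseteq> Ld e"
  unfolding Ld_def by (intro image_mono lowdeg_mono)

lemma nm_L_minus_Ld:
  assumes "w \<in> L" "w \<notin> Ld d"
  shows "nm w \<ge> nm \<pi> * real CARD('q) ^ d"
proof -
  obtain a where a: "w = \<pi> * ofA a" "a \<notin> lowdeg d"
    using assms by (auto simp: L_def scaled_lattice_def Ld_def)
  hence "a \<noteq> 0" "degree a \<ge> d" by (auto simp: lowdeg_iff)
  moreover have "real CARD('q) ^ d \<le> real CARD('q) ^ degree a"
    using \<open>degree a \<ge> d\<close> by (intro power_increasing) (simp_all add: Suc_leI)
  ultimately show ?thesis by (simp add: a nm_mult nm_of_A mult_left_mono)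
qed

text \<open>
  All but finitely many factors \<open>1 - z / w\<close> have absolute value one and are close to one, so the
  unordered product converges.
\<close>

lemma lattice_product_converges:
  "\<exists>l. ((\<lambda>F. \<Prod>w\<in>F. 1 - z / w) \<longlongrightarrow> l) (finite_subsets_at_top (L - {0})) \<and>
       (\<lambda>d. \<Prod>w\<in>Ld d - {0}. 1 - z / w) \<longlonglongrightarrow> l"
proof -
  define g where "g F = (\<Prod>w\<in>F. 1 - z / w)" for F
  define q where "q = real CARD('q)"
  have q: "q > 1" using card_finite_field_ge_2[where 'q = 'q] by (simp add: q_def)
  have np: "nm \<pi> > 0" using \<pi>_nz by simp
  define C where "C = nm z / nm \<pi>"
  have C: "C \<ge> 0" by (simp add: C_def)
  have small: "nm (z / w) \<le> C / q ^ d" if "w \<in> L" "w \<notin> Ld d" for w d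
  proof -
    have "nm \<pi> * q ^ d \<le> nm w" unfolding q_def using that by (rule nm_L_minus_Ld)
    moreover have "nm \<pi> * q ^ d > 0" using np q by simp
    ultimately have "nm z / nm w \<le> nm z / (nm \<pi> * q ^ d)"
      using less_le_trans[of 0 "nm \<pi> * q ^ d" "nm w"] by (intro divide_left_mono mult_pos_pos[of "nm w"]) auto
    thus ?thesis by (simp add: nm_divide C_def)
  qed
  obtain d0 where d0: "C < q ^ d0" using real_arch_pow[OF q] by blast
  have lt1: "C / q ^ d < 1" if "d \<ge> d0" for d
  proof -
    have "q ^ d0 \<le> q ^ d" using q by (intro power_increasing[OF that]) simp
    hence "C < q ^ d" using d0 by linarith
    thus ?thesis using q by (simp add: divide_less_eq)
  qed
  \<comment> \<open>From \<open>d0\<close> on all new factors have absolute value one, so \<open>B\<close> is that of every later product.\<close>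
  define B where "B = nm (g (Ld d0 - {0}))"
  have split: "g F = g (Ld d - {0}) * g (F - Ld d)" if "finite F" "Ld d - {0} \<subseteq> F" "F \<subseteq> L - {0}" for F d
  proof -
    have "F = (Ld d - {0}) \<union> (F - Ld d)" using that by auto
    moreover have "g ((Ld d - {0}) \<union> (F - Ld d)) = g (Ld d - {0}) * g (F - Ld d)"
      unfolding g_def using that finite_Ld by (intro prod.union_disjoint) auto
    ultimately show ?thesis by simp
  qed
  have B: "nm (g (Ld d - {0})) = B" if "d \<ge> d0" for d
  proof -
    have "nm (1 - z / w) = 1" if w: "w \<in> Ld d - {0} - Ld d0" for w
    proof -
      have "nm (z / w) < 1" using small[of w d0] lt1[of d0] w Ld_subset by fastforce
      thus ?thesis using nm_add_eq[of "- (z / w)" 1] by simp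
    qed
    hence "nm (g (Ld d - {0} - Ld d0)) = 1" by (simp add: g_def nm_prod)
    moreover have "g (Ld d - {0}) = g (Ld d0 - {0}) * g (Ld d - {0} - Ld d0)"
      using finite_Ld Ld_mono[OF that] Ld_subset[of d] by (intro split) auto
    ultimately show ?thesis by (simp add: nm_mult B_def)
  qed
  have close: "nm (g F - g (Ld d - {0})) \<le> B * C / q ^ d"
    if d: "d \<ge> d0" and F: "finite F" "Ld d - {0} \<subseteq> F" "F \<subseteq> L - {0}" for F d
  proof -
    have "nm (g (F - Ld d) - 1) \<le> C / q ^ d"
      unfolding g_def using small F lt1[OF d] C q by (intro nm_prod_one_minus) auto
    moreover have "g F - g (Ld d - {0}) = g (Ld d - {0}) * (g (F - Ld d) - 1)"
      using split[OF F] by (simp add: algebra_simps)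
    ultimately show ?thesis
      using mult_left_mono[of "nm (g (F - Ld d) - 1)" "C / q ^ d" B] B[OF d] 
      by (simp add: nm_mult B_def)
  qed
  have small_eventually: "\<exists>d\<ge>d0. B * C / q ^ d < e" if "e > 0" for e
  proof -
    obtain d where "B * C / e < q ^ d" using real_arch_pow[OF q] by blast
    also have "\<dots> \<le> q ^ max d d0" using q by (intro power_increasing) auto
    finally have "B * C / q ^ max d d0 < e" using that q by (simp add: field_simps)
    thus ?thesis by (metis max.cobounded2)
  qed
  have Ld_ok: "finite (Ld d - {0})" "Ld d - {0} \<subseteq> L - {0}" for d
    using finite_Ld Ld_subset by auto
  have "Cauchy (\<lambda>d. g (Ld d - {0}))"
  proof (rule metric_CauchyI)
    fix e :: real assume e: "e > 0"
    obtain D where D: "D \<ge> d0" "B * C / q ^ D < e" using small_eventually[OF e] by blast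
    have *: "nm (g (Ld d - {0}) - g (Ld D - {0})) < e" if "d \<ge> D" for d
      using close[OF D(1) Ld_ok(1), of d] Ld_ok(2)[of d] Ld_mono[OF that] D(2) by fastforce
    have "dist (g (Ld d - {0})) (g (Ld d' - {0})) < e" if "d \<ge> D" "d' \<ge> D" for d d'
    proof -
      have "nm (g (Ld d - {0}) - g (Ld d' - {0}))
          \<le> max (nm (g (Ld d - {0}) - g (Ld D - {0}))) (nm (g (Ld d' - {0}) - g (Ld D - {0})))"
        using nm_diff[of "g (Ld d - {0}) - g (Ld D - {0})" "g (Ld d' - {0}) - g (Ld D - {0})"] by simp
      thus ?thesis unfolding dist_nm[of "g (Ld d - {0})"] using *[OF that(1)] *[OF that(2)] by linarith
    qed
    thus "\<exists>D. \<forall>d\<ge>D. \<forall>d'\<ge>D. dist (g (Ld d - {0})) (g (Ld d' - {0})) < e" by blast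
  qed
  then obtain l where l: "(\<lambda>d. g (Ld d - {0})) \<longlonglongrightarrow> l"
    using Cauchy_convergent convergent_def by blast
  have "(g \<longlongrightarrow> l) (finite_subsets_at_top (L - {0}))"
  proof (rule tendstoI)
    fix e :: real assume e: "e > 0"
    obtain D where D: "D \<ge> d0" "B * C / q ^ D < e" using small_eventually[OF e] by blast
    obtain D' where D': "\<And>d. d \<ge> D' \<Longrightarrow> dist (g (Ld d - {0})) l < e"
      using metric_LIMSEQ_D[OF l e] by blast
    define m where "m = max D D'"
    have lm: "nm (g (Ld m - {0}) - l) < e"
      using D'[of m] by (simp add: m_def flip: dist_nm)
    have m: "m \<ge> d0" "B * C / q ^ m < e"
    proof -
      show "m \<ge> d0" using D(1) by (simp add: m_def)
      have "B * C / q ^ m \<le> B * C / q ^ D"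
        using q C by (intro divide_left_mono power_increasing) (auto simp: m_def B_def)
      thus "B * C / q ^ m < e" using D(2) by linarith
    qed
    show "\<forall>\<^sub>F F in finite_subsets_at_top (L - {0}). dist (g F) l < e"
      unfolding eventually_finite_subsets_at_top
    proof (intro exI[of _ "Ld m - {0}"] conjI allI impI Ld_ok)
      fix F assume F: "finite F \<and> Ld m - {0} \<subseteq> F \<and> F \<subseteq> L - {0}"
      have "nm (g F - g (Ld m - {0})) < e" using close[OF m(1), of F] F m(2) by fastforce
      hence "nm ((g F - g (Ld m - {0})) + (g (Ld m - {0}) - l)) < e"
        using lm nm_add[of "g F - g (Ld m - {0})" "g (Ld m - {0}) - l"] by simp
      thus "dist (g F) l < e" by (simp add: dist_nm[of "g F"])
    qed
  qed
  thus ?thesis using l unfolding g_def by blast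
qed

lemma lattice_exp_Lim:
  "(\<lambda>d. z * (\<Prod>w\<in>Ld d - {0}. 1 - z / w)) \<longlonglongrightarrow> lattice_exp L z"
proof -
  obtain l where l: "((\<lambda>F. \<Prod>w\<in>F. 1 - z / w) \<longlongrightarrow> l) (finite_subsets_at_top (L - {0}))"
    "(\<lambda>d. \<Prod>w\<in>Ld d - {0}. 1 - z / w) \<longlonglongrightarrow> l"
    using lattice_product_converges by blast
  have "Lim (finite_subsets_at_top (L - {0})) (\<lambda>F. \<Prod>w\<in>F. 1 - z / w) = l"
    by (rule tendsto_Lim[OF _ l(1)]) simp
  thus ?thesis using tendsto_cmult_nm[OF l(2), of z] by (simp add: lattice_exp_def)
qed

lemma E_Lim: "(\<lambda>d. \<pi> * z * (\<Prod>w\<in>Ld d - {0}. 1 - \<pi> * z / w)) \<longlonglongrightarrow> E z"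
  unfolding E_def by (rule lattice_exp_Lim)

text \<open>
  The partial products over \<open>Ld d\<close> are multiples of \<open>\<Prod>w\<in>Ld d. z - w\<close>, and \<open>Ld d\<close> is a finite additive group.
\<close>

lemma E_add: "E (x + y) = E x + E y"
proof -
  define p where "p d z = z * (\<Prod>w\<in>Ld d - {0}. 1 - z / w)" for d z
  have p: "p d z = (\<Prod>w\<in>Ld d - {0}. - (1 / w)) * (\<Prod>w\<in>Ld d. z - w)" for d z
  proof -
    have "0 \<in> Ld d" unfolding Ld_def by (auto simp: lowdeg_def intro!: image_eqI[of _ _ 0])
    hence "(\<Prod>w\<in>Ld d. z - w) = z * (\<Prod>w\<in>Ld d - {0}. z - w)"
      using prod.remove[OF finite_Ld, of 0 d "\<lambda>w. z - w"] by simp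
    moreover have "(\<Prod>w\<in>Ld d - {0}. 1 - z / w) = (\<Prod>w\<in>Ld d - {0}. - (1 / w)) * (\<Prod>w\<in>Ld d - {0}. z - w)"
      unfolding prod.distrib [symmetric] by (intro prod.cong) (auto simp: field_simps)
    ultimately show ?thesis by (simp add: p_def)
  qed
  have "p d (x + y) = p d x + p d y" for d x y
  proof -
    have "v - w \<in> Ld d" if "v \<in> Ld d" "w \<in> Ld d" for v w
      using that unfolding Ld_def
      by (auto simp flip: right_diff_distrib of_A_diff intro: imageI lowdeg_diff)
    moreover have "0 \<in> Ld d" unfolding Ld_def by (auto simp: lowdeg_def intro!: image_eqI[of _ _ 0])
    ultimately have "(\<Prod>w\<in>Ld d. x + y - w) = (\<Prod>w\<in>Ld d. x - w) + (\<Prod>w\<in>Ld d. y - w)"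
      by (intro prod_linear_additive finite_Ld) auto
    thus ?thesis by (simp add: p algebra_simps)
  qed
  moreover have lim: "(\<lambda>d. p d (\<pi> * z)) \<longlonglongrightarrow> E z" for z
    unfolding p_def by (rule E_Lim)
  ultimately have "(\<lambda>d. p d (\<pi> * x) + p d (\<pi> * y)) \<longlonglongrightarrow> E (x + y)"
    using lim[of "x + y"] by (simp add: ring_distribs)
  moreover have "(\<lambda>d. p d (\<pi> * x) + p d (\<pi> * y)) \<longlonglongrightarrow> E x + E y"
    by (intro tendsto_add_nm lim)
  ultimately show ?thesis using LIMSEQ_unique by blast
qed

lemma E_0 [simp]: "E 0 = 0"
  using E_add[of 0 0] by (metis add.right_neutral add_left_cancel)

lemma E_diff: "E (x - y) = E x - E y"
  using E_add[of "x - y" y] by simp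

lemma E_of_A [simp]: "E (ofA a) = 0"
proof (cases "a = 0")
  case False
  let ?w = "\<pi> * ofA a"
  have "\<forall>\<^sub>F d in sequentially. ?w * (\<Prod>w\<in>Ld d - {0}. 1 - ?w / w) = 0"
    unfolding eventually_sequentially
  proof (intro exI[of _ "Suc (degree a)"] allI impI)
    fix d assume "Suc (degree a) \<le> d"
    hence "?w \<in> Ld d - {0}" using False \<pi>_nz by (auto simp: Ld_def lowdeg_iff)
    thus "?w * (\<Prod>w\<in>Ld d - {0}. 1 - ?w / w) = 0"
      using finite_Ld[of d] by (auto intro!: prod_zero bexI[of _ ?w])
  qed
  from tendsto_cong[OF this] have "(\<lambda>d. 0) \<longlonglongrightarrow> E (ofA a)" using E_Lim by blast
  thus ?thesis by (simp add: tendsto_const_iff)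
qed simp

text \<open>
  Multiplication by a nonzero constant permutes the factors of each partial product.
\<close>

lemma E_const_mult: "E (ofA [:c:] * z) = ofA [:c:] * E z"
proof (cases "c = 0")
  case False
  let ?c = "ofA [:c:]"
  have c: "?c \<noteq> 0" using False by simp
  have inv: "ofA [:inverse c:] = inverse ?c"
  proof -
    have "?c * ofA [:inverse c:] = 1" using False by (simp flip: of_A_mult add: one_pCons [symmetric])
    thus ?thesis by (rule inverse_unique [symmetric])
  qed
  have mem: "ofA [:b:] * w \<in> Ld d" if w: "w \<in> Ld d" for b w d
  proof -
    obtain a where "a \<in> lowdeg d" "w = \<pi> * ofA a" using w unfolding Ld_def by blast
    moreover have "ofA (smult b a) = ofA [:b:] * ofA a" by (simp flip: of_A_mult)
    ultimately show ?thesis unfolding Ld_def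
      by (intro image_eqI[of _ _ "smult b a"]) (auto simp: lowdeg_def)
  qed
  have "(\<Prod>w\<in>Ld d - {0}. 1 - \<pi> * (?c * z) / w) = (\<Prod>w\<in>Ld d - {0}. 1 - \<pi> * z / w)" for d
    by (rule prod.reindex_bij_witness[of _ "\<lambda>w. ?c * w" "\<lambda>w. inverse ?c * w"])
       (use c mem[of _ d c] mem[of _ d "inverse c", unfolded inv] in \<open>auto simp: field_simps\<close>)
  hence "(\<lambda>d. ?c * (\<pi> * z * (\<Prod>w\<in>Ld d - {0}. 1 - \<pi> * z / w))) \<longlonglongrightarrow> E (?c * z)"
    using E_Lim[of "?c * z"] by (simp add: mult_ac)
  moreover have "(\<lambda>d. ?c * (\<pi> * z * (\<Prod>w\<in>Ld d - {0}. 1 - \<pi> * z / w))) \<longlonglongrightarrow> ?c * E z"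
    by (intro tendsto_cmult_nm E_Lim)
  ultimately show ?thesis using LIMSEQ_unique by blast
qed simp

text \<open>
  Translating \<open>z\<close> by the nearest element of \<open>A\<close> makes every factor of the product at least one in
  absolute value.
\<close>

lemma nm_E_ge: "\<exists>a. nm (E z) \<ge> nm \<pi> * nm (z - ofA a)"
proof -
  define q where "q = real CARD('q)"
  have q: "q > 1" using card_finite_field_ge_2[where 'q = 'q] by (simp add: q_def)
  obtain D where D: "nm z < q ^ D" using real_arch_pow[OF q] by blast
  have "0 \<in> lowdeg D" by (simp add: lowdeg_def)
  then obtain a where a: "a \<in> lowdeg D" "\<And>b. b \<in> lowdeg D \<Longrightarrow> nm (z - ofA a) \<le> nm (z - ofA b)"
    using ex_is_arg_min_if_finite[OF finite_lowdeg, of D "\<lambda>a. nm (z - ofA a)"]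
    unfolding is_arg_min_def by (metis empty_iff not_le)
  have min: "nm (z - ofA a) \<le> nm (z - ofA b)" for b
  proof (cases "b \<in> lowdeg D")
    case False
    hence b: "b \<noteq> 0" "degree b \<ge> D" by (auto simp: lowdeg_iff)
    have "nm (ofA b) \<ge> q ^ D"
      using b q by (simp add: nm_of_A power_increasing flip: q_def)
    hence "nm (z - ofA b) = nm (ofA b)" using D nm_add_eq[of z "- ofA b"] by simp
    moreover have "nm (z - ofA a) \<le> nm z" using a(2)[OF \<open>0 \<in> lowdeg D\<close>] by simp
    ultimately show ?thesis using D \<open>nm (ofA b) \<ge> q ^ D\<close> by simp
  qed (use a(2) in simp)
  define y where "y = z - ofA a"
  have Ey: "E z = E y" by (simp add: y_def E_diff)
  have factor: "nm (1 - \<pi> * y / w) \<ge> 1" if w: "w \<in> Ld d - {0}" for w d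
  proof -
    obtain b where b: "w = \<pi> * ofA b" "b \<noteq> 0" using w by (auto simp: Ld_def)
    have "nm (ofA b) \<le> nm (ofA b - y)"
    proof (cases "nm y < nm (ofA b)")
      case True
      thus ?thesis using nm_add_eq[of "- y" "ofA b"] by simp
    next
      case False
      have "nm y \<le> nm (ofA b - y)"
        using min[of "a + b"] nm_minus_commute[of y "ofA b"] by (simp add: y_def of_A_add algebra_simps)
      thus ?thesis using False by simp
    qed
    moreover have "1 - \<pi> * y / w = (ofA b - y) / ofA b"
      using b \<pi>_nz by (simp add: field_simps)
    ultimately show ?thesis using b(2) by (simp add: nm_divide)
  qed
  have "nm (\<pi> * y * (\<Prod>w\<in>Ld d - {0}. 1 - \<pi> * y / w)) \<ge> nm \<pi> * nm y" for d
  proof -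
    have "(\<Prod>w\<in>Ld d - {0}. nm (1 - \<pi> * y / w)) \<ge> 1" using factor by (intro prod_ge_1) blast
    thus ?thesis
      using mult_left_mono[of 1 "\<Prod>w\<in>Ld d - {0}. nm (1 - \<pi> * y / w)" "nm \<pi> * nm y"]
      by (simp add: nm_mult nm_prod)
  qed
  hence "nm (E y) \<ge> nm \<pi> * nm y"
    by (intro tendsto_lowerbound[OF tendsto_nm[OF E_Lim]]) auto
  thus ?thesis using Ey y_def by auto
qed

lemma E_eq_0_iff: "E z = 0 \<longleftrightarrow> z \<in> range (ofA)"
proof
  assume z: "E z = 0"
  obtain a where "nm (E z) \<ge> nm \<pi> * nm (z - ofA a)" using nm_E_ge by blast
  hence "nm \<pi> * nm (z - ofA a) \<le> 0" using z by simp
  hence "nm (z - ofA a) = 0"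
    using \<pi>_nz mult_pos_pos[of "nm \<pi>" "nm (z - ofA a)"] nm_nonneg[of "z - ofA a"] nm_pos[of \<pi>]
    by linarith
  thus "z \<in> range (ofA)" by simp
qed auto

lemma nm_E_ge_imag_abs: "nm (E z) \<ge> nm \<pi> * imag z"
proof -
  obtain a where a: "nm (E z) \<ge> nm \<pi> * nm (z - ofA a)" using nm_E_ge by blast
  have "imag z \<le> nm (z - ofA a)" unfolding of_A_def by (rule imag_abs_le)
  hence "nm \<pi> * imag z \<le> nm \<pi> * nm (z - ofA a)" by (intro mult_left_mono) auto
  thus ?thesis using a by linarith
qed

lemma u_param_E: "u_param \<iota> \<pi> z = 1 / E z"
  by (simp add: u_param_def E_def L_def)

end

locale carlitz_lattice = completed_alg_closure \<iota>
  for \<iota> :: "'q::{finite,field} fls alg_closure \<Rightarrow> 'c::{field,complete_space}" +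
  fixes \<pi> :: 'c
  assumes period: "carlitz_period \<iota> \<pi>"

sublocale carlitz_lattice \<subseteq> scaled_A_lattice
  by standard (use period in \<open>simp add: carlitz_period_def\<close>)

context carlitz_lattice
begin

lemma E_T: "E (ofA [:0, 1:] * z) = ofA [:0, 1:] * E z + E z ^ CARD('q)"
proof -
  have "lattice_exp L (ofA [:0, 1:] * (\<pi> * z)) =
      ofA [:0, 1:] * lattice_exp L (\<pi> * z) + lattice_exp L (\<pi> * z) ^ CARD('q)"
    using period unfolding carlitz_period_def Let_def L_def by blast
  thus ?thesis by (simp add: E_def mult.left_commute)
qed

text \<open>
  The polynomial \<open>R\<close> is the value of the Carlitz module at \<open>a\<close>.  Its derivative is constant because
  \<open>R\<close> is built from linear polynomials and \<open>q\<close>-th powers, and the latter have derivative zero.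
\<close>

lemma carlitz_module_poly:
  "\<exists>R. (\<forall>z. poly R (E z) = E (ofA a * z)) \<and> pderiv R = [:ofA a:] \<and>
       degree R \<le> CARD('q) ^ degree a"
proof (induction a)
  case 0
  show ?case by (intro exI[of _ 0]) auto
next
  case (pCons c a)
  let ?t = "ofA [:0, 1:]" and ?c = "ofA [:c:]"
  show ?case
  proof (cases "a = 0")
    case True
    thus ?thesis by (intro exI[of _ "[:0, ?c:]"]) (auto simp: E_const_mult pderiv_pCons)
  next
    case False
    obtain R where R: "\<And>z. poly R (E z) = E (ofA a * z)" "pderiv R = [:ofA a:]"
      "degree R \<le> CARD('q) ^ degree a" using pCons.IH by blast
    show ?thesis
    proof (intro exI[of _ "[:0, ?c:] + (smult ?t R + R ^ CARD('q))"] conjI allI)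
      fix z
      have "E (ofA (pCons c a) * z) = E (?c * z) + E (?t * (ofA a * z))"
        by (simp add: of_A_pCons[of c a] distrib_right mult.assoc E_add)
      thus "poly ([:0, ?c:] + (smult ?t R + R ^ CARD('q))) (E z) = E (ofA (pCons c a) * z)"
        by (simp add: E_const_mult E_T R poly_power)
    next
      have "pderiv (R ^ CARD('q)) = 0"
        by (simp add: pderiv_power of_nat_card_eq_0)
      thus "pderiv ([:0, ?c:] + (smult ?t R + R ^ CARD('q))) = [:ofA (pCons c a):]"
        by (simp add: pderiv_add pderiv_smult R(2) pderiv_pCons of_A_pCons[of c a])
    next
      let ?N = "CARD('q) ^ degree (pCons c a)"
      have q: "CARD('q) \<ge> 1" by (simp add: Suc_leI)
      have "degree (R ^ CARD('q)) \<le> CARD('q) * CARD('q) ^ degree a"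
        using order_trans[OF degree_power_le[of R "CARD('q)"] mult_le_mono1[OF R(3), of "CARD('q)"]]
        by (simp only: mult.commute)
      hence "degree (R ^ CARD('q)) \<le> ?N" using False by simp
      moreover have "degree (smult ?t R) \<le> ?N"
        using order_trans[OF degree_smult_le[of ?t R] order_trans[OF R(3)
          power_increasing[OF le_SucI[OF le_refl, of "degree a"] q]]] False by simp
      moreover have "degree [:0, ?c:] \<le> ?N"
        using order_trans[OF degree_pCons_le[of 0 "[:?c:]"], of ?N] one_le_power[OF q, of "degree (pCons c a)"]
        by simp
      ultimately show "degree ([:0, ?c:] + (smult ?t R + R ^ CARD('q))) \<le> ?N"
        by (intro degree_add_le)
    qed
  qed
qed

end

section \<open>The weight action\<close>

lemma map_matrix_mat2: "map_matrix h (mat2 a b c d) = mat2 (h a) (h b) (h c) (h d)"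
  by (rule mat2_eqI) (simp_all add: map_matrix_def)

context completed_alg_closure
begin

definition supported :: "('c \<Rightarrow> 'c) \<Rightarrow> bool" where
  "supported f \<longleftrightarrow> (\<forall>z. z \<notin> \<Omega> \<longrightarrow> f z = 0)"

lemma not_upper_half_iff: "z \<notin> \<Omega> \<longleftrightarrow> z \<in> range (ofK)"
  by (simp add: upper_half_def)

lemma of_K_not_upper_half [simp]: "ofK x \<notin> \<Omega>"
  by (simp add: upper_half_def)

lemma linear_nz:
  assumes "z \<in> \<Omega>" "c \<noteq> 0 \<or> d \<noteq> 0"
  shows "ofK c * z + ofK d \<noteq> 0"
proof
  assume 0: "ofK c * z + ofK d = 0"
  show False
  proof (cases "c = 0")
    case False
    have "ofK c * z = - ofK d" using 0 by (simp add: eq_neg_iff_add_eq_0)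
    hence "z = ofK (- d / c)" using False by (simp add: of_K_divide of_K_uminus field_simps)
    thus False using assms(1) by simp
  qed (use 0 assms(2) in simp)
qed

lemma moebius_upper_half:
  assumes z: "z \<in> \<Omega>" and det: "a * d - b * c \<noteq> 0"
  shows "(ofK a * z + ofK b) / (ofK c * z + ofK d) \<in> \<Omega>"
proof (rule ccontr)
  assume "\<not> ?thesis"
  then obtain x where x: "(ofK a * z + ofK b) / (ofK c * z + ofK d) = ofK x"
    by (auto simp: not_upper_half_iff)
  have "ofK c * z + ofK d \<noteq> 0" using det by (intro linear_nz[OF z]) auto
  hence "ofK a * z + ofK b = ofK x * (ofK c * z + ofK d)"
    using x by (simp add: divide_eq_eq)
  hence "ofK (a - x * c) * z + ofK (b - x * d) = 0"
    by (simp add: of_K_diff of_K_mult algebra_simps)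
  hence "a - x * c = 0" "b - x * d = 0" using linear_nz[OF z] by blast+
  hence "a = x * c" "b = x * d" by simp_all
  thus False using det by simp
qed

lemma moebius_not_upper_half:
  assumes "z \<notin> \<Omega>"
  shows "(ofK a * z + ofK b) / (ofK c * z + ofK d) \<notin> \<Omega>"
proof -
  obtain x where "z = ofK x" using assms by (auto simp: not_upper_half_iff)
  hence "(ofK a * z + ofK b) / (ofK c * z + ofK d) = ofK ((a * x + b) / (c * x + d))"
    by (simp add: of_K_divide of_K_add of_K_mult)
  thus ?thesis by simp
qed

lemma slash_mat2:
  "slash \<iota> k l f (mat2 a b c d) z =
     ofK (a * d - b * c) ^ l * (ofK c * z + ofK d) powi (- int k) *
     f ((ofK a * z + ofK b) / (ofK c * z + ofK d))"
  by (simp add: slash_def det_mat2 Let_def)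

lemma slash_supported: "supported f \<Longrightarrow> supported (slash \<iota> k l f M)"
  by (rule mat2_cases[of M]) (simp add: supported_def slash_mat2 moebius_not_upper_half)

lemma slash_slash:
  assumes f: "supported f" and "det M \<noteq> 0" "det N \<noteq> 0"
  shows "slash \<iota> k l (slash \<iota> k l f M) N = slash \<iota> k l f (M ** N)"
proof (rule ext)
  fix z
  have sup: "supported (slash \<iota> k l (slash \<iota> k l f M) N)" "supported (slash \<iota> k l f (M ** N))"
    using f by (simp_all add: slash_supported)
  show "slash \<iota> k l (slash \<iota> k l f M) N z = slash \<iota> k l f (M ** N) z"
  proof (cases "z \<in> \<Omega>")
    case z: True
    obtain a b c d where M: "M = mat2 a b c d" by (rule mat2_cases)
    obtain a' b' c' d' where N: "N = mat2 a' b' c' d'" by (rule mat2_cases)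
    have det: "a * d - b * c \<noteq> 0" "a' * d' - b' * c' \<noteq> 0" using assms(2,3) by (simp_all add: M N det_mat2)
    let ?a = "ofK a" and ?b = "ofK b" and ?c = "ofK c" and ?d = "ofK d"
    define n1 n2 where "n1 = ofK a' * z + ofK b'" and "n2 = ofK c' * z + ofK d'"
    have n2: "n2 \<noteq> 0" unfolding n2_def using det by (intro linear_nz[OF z]) auto
    have w: "n1 / n2 \<in> \<Omega>" unfolding n1_def n2_def by (rule moebius_upper_half[OF z det(2)])
    have nz: "?c * (n1 / n2) + ?d \<noteq> 0" using det by (intro linear_nz[OF w]) auto
    have num: "ofK (a * a' + b * c') * z + ofK (a * b' + b * d') = n2 * (?a * (n1 / n2) + ?b)"
      using n2 by (simp add: distrib_left) (simp add: n1_def n2_def of_K_add of_K_mult algebra_simps)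
    have den: "ofK (c * a' + d * c') * z + ofK (c * b' + d * d') = n2 * (?c * (n1 / n2) + ?d)"
      using n2 by (simp add: distrib_left) (simp add: n1_def n2_def of_K_add of_K_mult algebra_simps)
    have "(a * a' + b * c') * (c * b' + d * d') - (a * b' + b * d') * (c * a' + d * c') =
        (a * d - b * c) * (a' * d' - b' * c')" by (simp add: algebra_simps)
    hence "slash \<iota> k l f (M ** N) z = ofK ((a * d - b * c) * (a' * d' - b' * c')) ^ l *
        (n2 * (?c * (n1 / n2) + ?d)) powi (- int k) * f ((?a * (n1 / n2) + ?b) / (?c * (n1 / n2) + ?d))"
      using n2 by (simp only: M N mat2_mult slash_mat2 num den mult_divide_mult_cancel_left[OF n2])
    moreover have "slash \<iota> k l (slash \<iota> k l f M) N z = ofK (a' * d' - b' * c') ^ l * n2 powi (- int k) *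
        (ofK (a * d - b * c) ^ l * (?c * (n1 / n2) + ?d) powi (- int k) *
          f ((?a * (n1 / n2) + ?b) / (?c * (n1 / n2) + ?d)))"
      by (simp only: M N slash_mat2 flip: n1_def n2_def)
    ultimately show ?thesis
      by (simp add: of_K_mult power_mult_distrib power_int_mult_distrib mult_ac)
  qed (use sup in \<open>simp add: supported_def\<close>)
qed

lemma poly_to_K_eq_0_iff [simp]: "poly_to_K p = 0 \<longleftrightarrow> p = (0 :: 'q poly)"
  using of_A_eq_0_iff[of p] by (simp add: of_A_def)

lemma slash_A_mat2:
  "slashA k l f (mat2 a b c d) z =
     ofA (a * d - b * c) ^ l * (ofA c * z + ofA d) powi (- int k) *
     f ((ofA a * z + ofA b) / (ofA c * z + ofA d))"
  by (simp add: slash_A_def map_matrix_mat2 slash_mat2 of_A_def poly_to_K_mult poly_to_K_diff)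

lemma det_map_matrix_poly_to_K: "det (map_matrix poly_to_K (M :: 'q poly^2^2)) = poly_to_K (det M)"
  by (rule mat2_cases[of M]) (simp add: map_matrix_mat2 det_mat2 poly_to_K_mult poly_to_K_diff)

lemma slash_A_supported: "supported f \<Longrightarrow> supported (slashA k l f M)"
  unfolding slash_A_def by (rule slash_supported)

lemma slash_A_slash_A:
  assumes "supported f" "det M \<noteq> 0" "det N \<noteq> 0"
  shows "slashA k l (slashA k l f M) N = slashA k l f (M ** N)"
proof -
  have "map_matrix poly_to_K M ** map_matrix poly_to_K N = map_matrix poly_to_K (M ** N)"
    by (rule mat2_cases[of M], rule mat2_cases[of N])
       (simp add: map_matrix_mat2 mat2_mult poly_to_K_mult poly_to_K_add)
  thus ?thesis
    unfolding slash_A_def using assms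
    by (subst slash_slash) (simp_all add: det_map_matrix_poly_to_K)
qed

lemma slash_A_one: "slashA k l f (mat 1) = f"
  by (rule ext) (simp add: mat_1_eq_mat2 slash_A_mat2)

lemma slash_A_add: "slashA k l (f + g) M = slashA k l f M + slashA k l g M"
  by (rule ext, rule mat2_cases[of M]) (simp add: slash_A_mat2 algebra_simps)

lemma slash_A_scale: "slashA k l (scale_fun c f) M = scale_fun c (slashA k l f M)"
  by (rule ext, rule mat2_cases[of M]) (simp add: slash_A_mat2 scale_fun_def mult_ac)

lemma slash_A_scalar:
  assumes "Q \<noteq> 0"
  shows "slashA k l f (mat2 Q 0 0 Q) = scale_fun (ofA Q powi (2 * int l - int k)) f"
proof (rule ext)
  fix z
  have "ofA (Q * Q) ^ l * ofA Q powi (- int k) = ofA Q powi (2 * int l - int k)"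
  proof -
    have "ofA (Q * Q) ^ l = ofA Q powi (int (2 * l))"
      by (simp add: of_A_mult power_mult power2_eq_square del: of_nat_mult)
    thus ?thesis using assms by (simp flip: power_int_add)
  qed
  thus "slashA k l f (mat2 Q 0 0 Q) z = scale_fun (ofA Q powi (2 * int l - int k)) f z"
    using assms by (simp add: slash_A_mat2 scale_fun_def)
qed

section \<open>Rigid holomorphic functions\<close>

definition rational_limit_on :: "'c set \<Rightarrow> ('c \<Rightarrow> 'c) \<Rightarrow> bool" where
  "rational_limit_on S f \<longleftrightarrow> (\<exists>r s :: nat \<Rightarrow> 'c poly. (\<forall>j. \<forall>z\<in>S. poly (s j) z \<noteq> 0) \<and>
     (\<forall>e>0. \<forall>\<^sub>F j in sequentially. \<forall>z\<in>S. nm (poly (r j) z / poly (s j) z - f z) < e))"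

lemma rigid_holomorphic_iff:
  "rigid_holomorphic \<iota> f \<longleftrightarrow> supported f \<and> (\<forall>m. rational_limit_on (half_plane_affinoid \<iota> m) f)"
  by (simp add: rigid_holomorphic_def supported_def rational_limit_on_def uniform_limit_iff flip: dist_nm)

lemma rigid_holomorphic_supported: "rigid_holomorphic \<iota> f \<Longrightarrow> supported f"
  by (simp add: rigid_holomorphic_iff)

lemma rigid_holomorphic_0: "rigid_holomorphic \<iota> 0"
proof -
  have "rational_limit_on S 0" for S
    unfolding rational_limit_on_def by (rule exI[of _ "\<lambda>_. 0"], rule exI[of _ "\<lambda>_. 1"]) simp
  thus ?thesis by (simp add: rigid_holomorphic_iff supported_def)
qed

lemma rational_limit_on_add:
  assumes "rational_limit_on S f" "rational_limit_on S g"
  shows "rational_limit_on S (f + g)"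
proof -
  obtain r s where f: "\<And>j z. z \<in> S \<Longrightarrow> poly (s j) z \<noteq> 0"
    "\<And>e. e > 0 \<Longrightarrow> \<forall>\<^sub>F j in sequentially. \<forall>z\<in>S. nm (poly (r j) z / poly (s j) z - f z) < e"
    using assms(1) unfolding rational_limit_on_def by blast
  obtain r' s' where g: "\<And>j z. z \<in> S \<Longrightarrow> poly (s' j) z \<noteq> 0"
    "\<And>e. e > 0 \<Longrightarrow> \<forall>\<^sub>F j in sequentially. \<forall>z\<in>S. nm (poly (r' j) z / poly (s' j) z - g z) < e"
    using assms(2) unfolding rational_limit_on_def by blast
  show ?thesis
    unfolding rational_limit_on_def
  proof (rule exI[of _ "\<lambda>j. r j * s' j + r' j * s j"], rule exI[of _ "\<lambda>j. s j * s' j"], intro conjI allI impI ballI)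
    show "poly (s j * s' j) z \<noteq> 0" if "z \<in> S" for j z using f(1) g(1) that by simp
    fix e :: real assume e: "e > 0"
    show "\<forall>\<^sub>F j in sequentially. \<forall>z\<in>S.
        nm (poly (r j * s' j + r' j * s j) z / poly (s j * s' j) z - (f + g) z) < e"
      using f(2)[OF e] g(2)[OF e]
    proof eventually_elim
      case (elim j)
      show ?case
      proof
        fix z assume z: "z \<in> S"
        let ?x = "poly (r j) z / poly (s j) z" and ?y = "poly (r' j) z / poly (s' j) z"
        have eq: "poly (r j * s' j + r' j * s j) z / poly (s j * s' j) z - (f + g) z = (?x - f z) + (?y - g z)"
          using f(1)[OF z, of j] g(1)[OF z, of j] by (simp add: add_frac_eq)
        have "max (nm (?x - f z)) (nm (?y - g z)) < e" using elim z by simp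
        thus "nm (poly (r j * s' j + r' j * s j) z / poly (s j * s' j) z - (f + g) z) < e"
          unfolding eq by (rule le_less_trans[OF nm_add])
      qed
    qed
  qed
qed

text \<open>
  The multiplier \<open>c\<close> must be bounded for uniform convergence to survive.  The last hypothesis is the algebraic
  part: rational functions without poles are pulled back to such functions.
\<close>

lemma rational_limit_on_compose:
  assumes f: "rational_limit_on Y f" and w: "\<And>z. z \<in> S \<Longrightarrow> w z \<in> Y"
    and C: "\<And>z. z \<in> S \<Longrightarrow> nm (c z) \<le> C"
    and rat: "\<And>r s. (\<And>z. z \<in> Y \<Longrightarrow> poly s z \<noteq> 0) \<Longrightarrow>
      \<exists>r' s'. \<forall>z\<in>S. poly s' z \<noteq> 0 \<and> poly r' z / poly s' z = c z * (poly r (w z) / poly s (w z))"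
  shows "rational_limit_on S (\<lambda>z. c z * f (w z))"
proof -
  obtain r s where f: "\<And>j z. z \<in> Y \<Longrightarrow> poly (s j) z \<noteq> 0"
    "\<And>e. e > 0 \<Longrightarrow> \<forall>\<^sub>F j in sequentially. \<forall>z\<in>Y. nm (poly (r j) z / poly (s j) z - f z) < e"
    using f unfolding rational_limit_on_def by blast
  have "\<forall>j. \<exists>r' s'. \<forall>z\<in>S. poly s' z \<noteq> 0 \<and>
      poly r' z / poly s' z = c z * (poly (r j) (w z) / poly (s j) (w z))"
    using rat f(1) by blast
  then obtain r' s' where rs: "\<And>j z. z \<in> S \<Longrightarrow> poly (s' j) z \<noteq> 0"
    "\<And>j z. z \<in> S \<Longrightarrow> poly (r' j) z / poly (s' j) z = c z * (poly (r j) (w z) / poly (s j) (w z))"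
    by metis
  show ?thesis
    unfolding rational_limit_on_def
  proof (rule exI[of _ r'], rule exI[of _ s'], intro conjI allI impI ballI)
    show "poly (s' j) z \<noteq> 0" if "z \<in> S" for j z by (rule rs(1)[OF that])
    fix e :: real assume e: "e > 0"
    define D where "D = max C 1"
    have D: "D > 0" by (simp add: D_def less_max_iff_disj)
    show "\<forall>\<^sub>F j in sequentially. \<forall>z\<in>S. nm (poly (r' j) z / poly (s' j) z - c z * f (w z)) < e"
      using f(2)[OF divide_pos_pos[OF e D]]
    proof eventually_elim
      case (elim j)
      show ?case
      proof
        fix z assume z: "z \<in> S"
        let ?x = "poly (r j) (w z) / poly (s j) (w z) - f (w z)"
        have x: "nm ?x < e / D" using elim w[OF z] by blast
        have "nm (c z) \<le> D" using C[OF z] by (simp add: D_def)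
        hence "nm (c z * ?x) \<le> D * nm ?x" unfolding nm_mult[of _ ?x] by (intro mult_right_mono) auto
        also have "D * nm ?x < e" using x D by (simp add: field_simps)
        finally show "nm (poly (r' j) z / poly (s' j) z - c z * f (w z)) < e"
          by (simp only: rs(2)[OF z] right_diff_distrib)
      qed
    qed
  qed
qed

lemma rigid_holomorphic_add:
  "rigid_holomorphic \<iota> f \<Longrightarrow> rigid_holomorphic \<iota> g \<Longrightarrow> rigid_holomorphic \<iota> (f + g)"
  by (simp add: rigid_holomorphic_iff supported_def rational_limit_on_add)

lemma rigid_holomorphic_scale:
  assumes "rigid_holomorphic \<iota> f"
  shows "rigid_holomorphic \<iota> (scale_fun c f)"
proof -
  have "rational_limit_on S (\<lambda>z. c * f z)" if "rational_limit_on S f" for S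
  proof (rule rational_limit_on_compose[where f = f and w = "\<lambda>z. z" and C = "nm c", OF that])
    fix r s :: "'c poly" assume "\<And>z. z \<in> S \<Longrightarrow> poly s z \<noteq> 0"
    thus "\<exists>r' s'. \<forall>z\<in>S. poly s' z \<noteq> 0 \<and> poly r' z / poly s' z = c * (poly r z / poly s z)"
      by (intro exI[of _ "smult c r"] exI[of _ s]) simp
  qed simp_all
  thus ?thesis using assms by (simp add: rigid_holomorphic_iff supported_def scale_fun_def)
qed

lemma imag_abs_geI:
  assumes "\<And>x. B \<le> nm (z - ofK x)"
  shows "B \<le> imag z"
  unfolding imag_abs_def infdist_def dist_nm[of z] by (auto intro!: cINF_greatest assms)

lemma abs_K_mult: "abs_K (x * y) = abs_K x * abs_K (y :: 'q fls)"
  by (simp flip: nm_of_K add: of_K_mult nm_mult)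

lemma abs_K_diff: "abs_K (x - y) \<le> max (abs_K x) (abs_K (y :: 'q fls))"
  using nm_diff[of "ofK x" "ofK y"] by (simp flip: nm_of_K add: of_K_diff)

lemma abs_K_nonneg [simp]: "abs_K (x :: 'q fls) \<ge> 0"
  by (simp flip: nm_of_K)

lemma abs_K_pos [simp]: "abs_K (x :: 'q fls) > 0 \<longleftrightarrow> x \<noteq> 0"
  by (simp flip: nm_of_K)

lemma max_abs_K_nonneg [simp]: "max (abs_K x) (abs_K (y :: 'q fls)) \<ge> 0"
  by (simp add: le_max_iff_disj)

lemma imag_abs_affine:
  assumes "a \<noteq> 0"
  shows "imag (ofK a * z + ofK b) = abs_K a * imag z"
proof -
  have ge: "imag (ofK a * z + ofK b) \<ge> abs_K a * imag z" if "a \<noteq> 0" for a b z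
  proof (rule imag_abs_geI)
    fix x
    have "ofK a * z + ofK b - ofK x = ofK a * (z - ofK ((x - b) / a))"
      using that by (simp add: of_K_divide of_K_diff field_simps)
    thus "abs_K a * imag z \<le> nm (ofK a * z + ofK b - ofK x)"
      by (simp add: nm_mult nm_of_K mult_left_mono imag_abs_le)
  qed
  let ?w = "ofK a * z + ofK b"
  have "z = ofK (inverse a) * ?w + ofK (- b / a)"
    using assms by (simp add: of_K_inverse of_K_divide of_K_uminus field_simps)
  hence "abs_K (inverse a) * imag ?w \<le> imag z"
    using ge[of "inverse a" ?w "- b / a"] assms by simp
  hence "abs_K a * (abs_K (inverse a) * imag ?w) \<le> abs_K a * imag z"
    by (intro mult_left_mono) simp_all
  also have "abs_K a * (abs_K (inverse a) * imag ?w) = abs_K (a * inverse a) * imag ?w"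
    by (simp add: abs_K_mult mult.assoc)
  also have "abs_K (a * inverse a) = 1" using assms nm_of_K[of 1] by simp
  finally show ?thesis using ge[OF assms, of z b] by simp
qed

text \<open>
  On an affinoid a linear form over \<open>K\<close> is bounded below by its coefficients: either the constant
  term dominates, or the distance of \<open>z\<close> to the root of the form gives the bound.
\<close>

lemma affinoid_linear_ge:
  assumes z: "z \<in> half_plane_affinoid \<iota> m"
  shows "nm (ofK a * z + ofK b) \<ge> max (abs_K a) (abs_K b) / real CARD('q) ^ (2 * m)"
proof -
  define q where "q = real CARD('q)"
  have q: "q > 1" using card_finite_field_ge_2[where 'q = 'q] by (simp add: q_def)
  have qm: "q ^ m \<ge> 1" "q ^ m > 0" using q by (simp_all add: one_le_power)
  have q2: "q ^ (2 * m) = q ^ m * q ^ m" by (simp add: mult_2 power_add)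
  have z1: "nm z \<le> q ^ m" "imag z \<ge> 1 / q ^ m" using z by (simp_all add: half_plane_affinoid_def q_def)
  have z2: "nm z \<ge> 1 / q ^ m" using z1(2) imag_abs_le[of z 0] by simp
  have shrink: "x / q ^ (2 * m) \<le> x / q ^ m" "x / q ^ (2 * m) \<le> x" if "x \<ge> 0" for x
  proof -
    have "q ^ m \<le> q ^ m * q ^ m" using mult_left_mono[OF qm(1), of "q ^ m"] qm(2) by simp
    thus "x / q ^ (2 * m) \<le> x / q ^ m"
      unfolding q2 using qm that by (intro divide_left_mono) auto
    moreover have "x / q ^ m \<le> x / 1" using qm that by (intro divide_left_mono) auto
    ultimately show "x / q ^ (2 * m) \<le> x" by simp
  qed
  let ?L = "ofK a * z + ofK b"
  have "abs_K a / q ^ (2 * m) \<le> nm ?L \<and> abs_K b / q ^ (2 * m) \<le> nm ?L"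
  proof (cases "abs_K a * nm z < abs_K b")
    case True
    hence L: "nm ?L = abs_K b"
      using nm_add_eq[of "ofK a * z" "ofK b"] by (simp add: nm_mult nm_of_K)
    have "abs_K a / q ^ m \<le> abs_K a * nm z"
      using mult_left_mono[OF z2, of "abs_K a"] by simp
    thus ?thesis using L True shrink[of "abs_K a"] shrink[of "abs_K b"] by auto
  next
    case False
    show ?thesis
    proof (cases "a = 0")
      case True
      hence "abs_K b \<le> 0" using False by (simp add: abs_K_def)
      hence "b = 0" using abs_K_pos[of b] by linarith
      thus ?thesis using True by (simp add: abs_K_def)
    next
      case a: False
      have "abs_K a * imag z \<le> nm ?L"
        using imag_abs_le[of ?L 0] by (simp add: imag_abs_affine[OF a])
      moreover have "abs_K a * (1 / q ^ m) \<le> abs_K a * imag z"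
        using z1(2) by (intro mult_left_mono) auto
      ultimately have L: "abs_K a / q ^ m \<le> nm ?L" by simp
      have "abs_K b \<le> abs_K a * q ^ m"
        using False mult_left_mono[OF z1(1), of "abs_K a"] by simp
      hence "abs_K b / (q ^ m * q ^ m) \<le> (abs_K a * q ^ m) / (q ^ m * q ^ m)"
        using qm by (intro divide_right_mono) auto
      also have "\<dots> = abs_K a / q ^ m" using qm by simp
      finally have "abs_K b / q ^ (2 * m) \<le> abs_K a / q ^ m" by (simp only: q2)
      thus ?thesis using L shrink(1)[of "abs_K a"] by auto
    qed
  qed
  thus ?thesis unfolding q_def by (auto simp: max_def)
qed

lemma affinoid_linear_le:
  assumes z: "z \<in> half_plane_affinoid \<iota> m"
  shows "nm (ofK a * z + ofK b) \<le> max (abs_K a) (abs_K b) * real CARD('q) ^ m"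
proof -
  have q: "real CARD('q) ^ m \<ge> 1" by (intro one_le_power) (simp add: Suc_leI)
  have "nm z \<le> real CARD('q) ^ m" using z by (simp add: half_plane_affinoid_def)
  hence "nm (ofK a * z) \<le> max (abs_K a) (abs_K b) * real CARD('q) ^ m"
    unfolding nm_mult nm_of_K by (intro mult_mono) auto
  moreover have "nm (ofK b) \<le> max (abs_K a) (abs_K b) * real CARD('q) ^ m"
    using mult_mono[of "abs_K b" "max (abs_K a) (abs_K b)" 1 "real CARD('q) ^ m"] q
    by (simp add: nm_of_K le_max_iff_disj)
  ultimately show ?thesis using nm_add[of "ofK a * z" "ofK b"] by linarith
qed

text \<open>
  The difference between the image of \<open>z\<close> and a point \<open>x\<close> of \<open>K\<close> is a quotient of two linear forms in \<open>z\<close>.  The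
  coefficients of the numerator depend on \<open>x\<close>, but they cannot both be small, since together with \<open>c, d\<close> they
  have determinant \<open>a d - b c\<close>.
\<close>

lemma moebius_affinoid:
  assumes det: "a * d - b * c \<noteq> (0 :: 'q fls)"
  shows "\<exists>m'. \<forall>z\<in>half_plane_affinoid \<iota> m.
    (ofK a * z + ofK b) / (ofK c * z + ofK d) \<in> half_plane_affinoid \<iota> m'"
proof -
  define q where "q = real CARD('q)"
  have q: "q > 1" using card_finite_field_ge_2[where 'q = 'q] by (simp add: q_def)
  define A C \<Delta> where "A = max (abs_K a) (abs_K b)" and "C = max (abs_K c) (abs_K d)"
    and "\<Delta> = abs_K (a * d - b * c)"
  have C: "C > 0" unfolding C_def using det by (auto simp: less_max_iff_disj)
  have \<Delta>: "\<Delta> > 0" unfolding \<Delta>_def using det by simp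
  have qm: "q ^ i > 0" for i using q by simp
  define B1 B2 where "B1 = A * q ^ m / (C / q ^ (2 * m))" and "B2 = (\<Delta> / C / q ^ (2 * m)) / (C * q ^ m)"
  have B2: "B2 > 0" unfolding B2_def using \<Delta> C qm by simp
  obtain m1 where m1: "B1 < q ^ m1" using real_arch_pow[OF q] by blast
  obtain m2 where m2: "1 / B2 < q ^ m2" using real_arch_pow[OF q] by blast
  have "q ^ m1 \<le> q ^ (m1 + m2)" "q ^ m2 \<le> q ^ (m1 + m2)"
    using q by (auto intro: power_increasing)
  hence m: "B1 \<le> q ^ (m1 + m2)" "1 / B2 \<le> q ^ (m1 + m2)" using m1 m2 by linarith+
  from m(2) have m': "1 / q ^ (m1 + m2) \<le> B2" using B2 qm[of "m1 + m2"] by (simp add: field_simps)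
  have "(ofK a * z + ofK b) / (ofK c * z + ofK d) \<in> half_plane_affinoid \<iota> (m1 + m2)"
    if z: "z \<in> half_plane_affinoid \<iota> m" for z
  proof -
    let ?n = "ofK a * z + ofK b" and ?d = "ofK c * z + ofK d"
    have d: "nm ?d \<ge> C / q ^ (2 * m)" "nm ?d \<le> C * q ^ m"
      unfolding C_def q_def using affinoid_linear_ge[OF z] affinoid_linear_le[OF z] by auto
    have Cq: "C / q ^ (2 * m) > 0" using C qm by simp
    hence d0: "nm ?d > 0" using d(1) by linarith
    have "nm ?n \<le> A * q ^ m" unfolding A_def q_def by (rule affinoid_linear_le[OF z])
    hence "nm (?n / ?d) \<le> B1"
      unfolding nm_divide B1_def using d Cq qm[of m] by (intro frac_le) (auto simp: A_def)
    moreover have "B2 \<le> imag (?n / ?d)"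
    proof (rule imag_abs_geI)
      fix x
      define \<alpha> \<beta> where "\<alpha> = a - x * c" and "\<beta> = b - x * d"
      have "?n / ?d - ofK x = (ofK \<alpha> * z + ofK \<beta>) / ?d"
      proof -
        have "ofK \<alpha> * z + ofK \<beta> = ?n - ofK x * ?d"
          by (simp add: \<alpha>_def \<beta>_def of_K_diff of_K_mult algebra_simps)
        moreover have "(?n - ofK x * ?d) / ?d = ?n / ?d - ofK x"
          using d0 by (simp add: diff_divide_distrib)
        ultimately show ?thesis by simp
      qed
      moreover have "nm (ofK \<alpha> * z + ofK \<beta>) \<ge> \<Delta> / C / q ^ (2 * m)"
      proof -
        have "\<alpha> * d - \<beta> * c = a * d - b * c" by (simp add: \<alpha>_def \<beta>_def algebra_simps)
        hence "\<Delta> \<le> max (abs_K \<alpha> * abs_K d) (abs_K \<beta> * abs_K c)"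
          unfolding \<Delta>_def using abs_K_diff[of "\<alpha> * d" "\<beta> * c"] by (simp add: abs_K_mult)
        also have "\<dots> \<le> max (abs_K \<alpha>) (abs_K \<beta>) * C"
          unfolding C_def by (intro max.boundedI mult_mono) auto
        finally have "\<Delta> / C \<le> max (abs_K \<alpha>) (abs_K \<beta>)" using C by (simp add: field_simps)
        hence "\<Delta> / C / q ^ (2 * m) \<le> max (abs_K \<alpha>) (abs_K \<beta>) / q ^ (2 * m)"
          using qm[of "2 * m"] by (intro divide_right_mono) auto
        thus ?thesis using affinoid_linear_ge[OF z, of \<alpha> \<beta>] unfolding q_def by linarith
      qed
      ultimately show "B2 \<le> nm (?n / ?d - ofK x)"
        unfolding B2_def using d d0 \<Delta> C qm[of "2 * m"] by (simp only: nm_divide) (intro frac_le, auto)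
    qed
    ultimately show ?thesis using m(1) m' unfolding half_plane_affinoid_def q_def by auto
  qed
  thus ?thesis by blast
qed

lemma poly_homogenize:
  fixes p :: "'c poly"
  assumes "degree p \<le> N"
  shows "\<exists>p'. \<forall>z. c * z + d \<noteq> 0 \<longrightarrow> poly p' z = (c * z + d) ^ N * poly p ((a * z + b) / (c * z + d))"
proof (intro exI allI impI)
  fix z assume nz: "c * z + d \<noteq> 0"
  let ?w = "(a * z + b) / (c * z + d)"
  have "poly p ?w = (\<Sum>i\<le>N. coeff p i * ?w ^ i)"
    unfolding poly_altdef using assms by (intro sum.mono_neutral_left) (auto simp: coeff_eq_0)
  hence "(c * z + d) ^ N * poly p ?w = (\<Sum>i\<le>N. (c * z + d) ^ N * (coeff p i * ?w ^ i))"
    by (simp add: sum_distrib_left)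
  also have "\<dots> = (\<Sum>i\<le>N. coeff p i * ((a * z + b) ^ i * (c * z + d) ^ (N - i)))"
  proof (intro sum.cong refl)
    fix i assume "i \<in> {..N}"
    hence "(c * z + d) ^ N = (c * z + d) ^ i * (c * z + d) ^ (N - i)" by (simp flip: power_add)
    thus "(c * z + d) ^ N * (coeff p i * ?w ^ i) = coeff p i * ((a * z + b) ^ i * (c * z + d) ^ (N - i))"
      using nz by (simp add: power_divide)
  qed
  finally show "poly (\<Sum>i\<le>N. smult (coeff p i) ([:b, a:] ^ i * [:d, c:] ^ (N - i))) z = (c * z + d) ^ N * poly p ?w"
    by (simp add: poly_sum poly_power mult.commute add.commute)
qed

lemma rigid_holomorphic_slash:
  assumes f: "rigid_holomorphic \<iota> f" and "det M \<noteq> 0"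
  shows "rigid_holomorphic \<iota> (slash \<iota> k l f M)"
proof -
  obtain a b c d where M: "M = mat2 a b c d" by (rule mat2_cases)
  have det: "a * d - b * c \<noteq> 0" using assms(2) by (simp add: M det_mat2)
  define j where "j z = ofK c * z + ofK d" for z
  define w where "w z = (ofK a * z + ofK b) / j z" for z
  define e where "e = ofK (a * d - b * c) ^ l"
  have sl: "slash \<iota> k l f M = (\<lambda>z. e * inverse (j z) ^ k * f (w z))"
    by (simp add: M slash_mat2 e_def j_def w_def power_int_minus power_inverse fun_eq_iff)
  have "rational_limit_on (half_plane_affinoid \<iota> m) (\<lambda>z. e * inverse (j z) ^ k * f (w z))" for m
  proof -
    obtain m' where m': "\<And>z. z \<in> half_plane_affinoid \<iota> m \<Longrightarrow> w z \<in> half_plane_affinoid \<iota> m'"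
      using moebius_affinoid[OF det] unfolding w_def j_def by blast
    let ?X = "half_plane_affinoid \<iota> m"
    define C where "C = max (abs_K c) (abs_K d) / real CARD('q) ^ (2 * m)"
    have "c \<noteq> 0 \<or> d \<noteq> 0" using det by auto
    hence "max (abs_K c) (abs_K d) > 0" by (simp add: less_max_iff_disj)
    hence C: "C > 0" unfolding C_def by simp
    have jC: "nm (j z) \<ge> C" if "z \<in> ?X" for z
      unfolding C_def j_def using that by (rule affinoid_linear_ge)
    have j0: "j z \<noteq> 0" if "z \<in> ?X" for z using jC[OF that] C by auto
    show ?thesis
    proof (rule rational_limit_on_compose[where f = f and w = w and C = "nm e * inverse C ^ k"])
      show "rational_limit_on (half_plane_affinoid \<iota> m') f" using f by (simp add: rigid_holomorphic_iff)
      show "w z \<in> half_plane_affinoid \<iota> m'" if "z \<in> ?X" for z by (rule m'[OF that])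
      show "nm (e * inverse (j z) ^ k) \<le> nm e * inverse C ^ k" if "z \<in> ?X" for z
        unfolding nm_mult nm_power nm_inverse using jC[OF that] C
        by (intro mult_left_mono power_mono le_imp_inverse_le) auto
      fix r s :: "'c poly" assume s: "\<And>z. z \<in> half_plane_affinoid \<iota> m' \<Longrightarrow> poly s z \<noteq> 0"
      define N where "N = max (degree r) (degree s)"
      obtain r' where r': "\<And>z. j z \<noteq> 0 \<Longrightarrow> poly r' z = j z ^ N * poly r (w z)"
        using poly_homogenize[of r N] unfolding j_def w_def N_def by (meson max.cobounded1)
      obtain s' where s': "\<And>z. j z \<noteq> 0 \<Longrightarrow> poly s' z = j z ^ N * poly s (w z)"
        using poly_homogenize[of s N] unfolding j_def w_def N_def by (meson max.cobounded2)
      have "poly (s' * [:ofK d, ofK c:] ^ k) z = j z ^ N * poly s (w z) * j z ^ k" if "j z \<noteq> 0" for z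
        using s'[OF that] by (simp add: poly_power j_def add.commute mult.commute)
      thus "\<exists>r' s'. \<forall>z\<in>?X. poly s' z \<noteq> 0 \<and>
          poly r' z / poly s' z = e * inverse (j z) ^ k * (poly r (w z) / poly s (w z))"
        using j0 s[OF m'] r'
        by (intro exI[of _ "smult e r'"] exI[of _ "s' * [:ofK d, ofK c:] ^ k"]) (simp add: field_simps)
    qed
  qed
  thus ?thesis
    using slash_supported[OF rigid_holomorphic_supported[OF f], of k l M] by (simp add: rigid_holomorphic_iff sl)
qed

end

section \<open>Goss sums\<close>

text \<open>
  Power sums of reciprocals of the roots of \<open>R - c\<close>, after Goss.  As the derivative of \<open>R\<close> is the constant \<open>\<delta>\<close>,
  the logarithmic derivative of \<open>c - R(t)\<close> gives \<open>\<Sum>x\<in>A. 1/(x - t) = \<delta>/(c - R(t))\<close>.  Compare the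
  coefficients of the expansions in powers of \<open>t\<close>.
\<close>

lemma power_sum_inverse_roots:
  fixes R :: "'a::field poly"
  assumes pd: "pderiv R = [:\<delta>:]" and R0: "coeff R 0 = 0"
    and fin: "finite A" and card: "degree R \<le> card A"
    and roots: "\<And>x. x \<in> A \<Longrightarrow> poly R x = c" and c: "c \<noteq> 0"
  shows "(\<Sum>x\<in>A. (1 / x) ^ Suc i) = \<delta> * (\<Sum>m\<le>i. (1 / c) ^ Suc m * coeff (R ^ m) i)"
proof -
  have nz: "x \<noteq> 0" if "x \<in> A" for x using roots[OF that] R0 c by (auto simp: poly_0_coeff_0)
  define Q where "Q = [:c:] - R"
  define k where "k = coeff Q (card A)"
  have degQ: "degree Q \<le> card A" unfolding Q_def using card by (intro degree_diff_le) auto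
  have degP: "degree (\<Prod>x\<in>A. [:- x, 1:]) = card A"
    by (subst degree_prod_eq_sum_degree) auto
  have "Q = smult k (\<Prod>x\<in>A. [:- x, 1:])"
  proof (rule poly_eqI_degree_lead_coeff)
    show "coeff Q (card A) = coeff (smult k (\<Prod>x\<in>A. [:- x, 1:])) (card A)"
      using lead_coeff_prod[of "\<lambda>x. [:- x, 1:]" A] degP by (simp add: k_def)
    show "degree (smult k (\<Prod>x\<in>A. [:- x, 1:])) \<le> card A"
      using degree_smult_le[of k "\<Prod>x\<in>A. [:- x, 1:]"] degP by simp
    fix x assume x: "x \<in> A"
    have "(\<Prod>y\<in>A. x - y) = 0" using x fin by (intro prod_zero) auto
    thus "poly Q x = poly (smult k (\<Prod>x\<in>A. [:- x, 1:])) x"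
      by (simp add: Q_def roots[OF x] poly_prod)
  qed (use degQ in simp_all)
  note Q = this
  define S where "S x = (\<Prod>y\<in>A - {x}. [:- y, 1:])" for x
  have "[:\<delta>:] = - pderiv Q" by (simp add: Q_def pderiv_diff pd pderiv_pCons)
  also have "\<dots> = - smult k (\<Sum>x\<in>A. S x)"
    unfolding Q S_def by (simp add: pderiv_smult pderiv_prod pderiv_pCons)
  finally have \<delta>: "[:\<delta>:] = - smult k (\<Sum>x\<in>A. S x)" .
  define G where "G = (\<Sum>x\<in>A. Abs_fps (\<lambda>i. (1 / x) ^ Suc i))"
  have "fps_of_poly Q * Abs_fps (\<lambda>i. (1 / x) ^ Suc i) = - (fps_const k * fps_of_poly (S x))"
    if x: "x \<in> A" for x
  proof -
    have "Q = smult k (S x) * [:- x, 1:]"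
      unfolding Q prod.remove[OF fin x] S_def by (simp add: mult.commute)
    hence "fps_of_poly Q = fps_const k * fps_of_poly (S x) * fps_of_poly [:- x, 1:]"
      by (simp only: fps_of_poly_mult fps_of_poly_smult)
    thus ?thesis using fps_inverse_linear_factor[OF nz[OF x]] by (simp only: mult.assoc) simp
  qed
  hence "fps_of_poly Q * G = - (fps_const k * (\<Sum>x\<in>A. fps_of_poly (S x)))"
    by (simp add: G_def sum_distrib_left sum_negf)
  also have "\<dots> = fps_of_poly [:\<delta>:]"
    unfolding \<delta> by (simp add: fps_of_poly_uminus fps_of_poly_smult fps_of_poly_sum)
  finally have QG: "fps_of_poly Q * G = fps_const \<delta>" by simp
  define Z where "Z = fps_compose (Abs_fps (\<lambda>m. (1 / c) ^ Suc m)) (fps_of_poly R)"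
  have "fps_of_poly [:- c, 1:] = - (fps_const c - fps_X)"
    by (simp add: fps_of_poly_pCons flip: fps_const_neg)
  hence "- ((fps_const c - fps_X) * Abs_fps (\<lambda>m. (1 / c) ^ Suc m)) = - 1"
    using fps_inverse_linear_factor[OF c] by (simp only: mult_minus_left)
  hence "(fps_const c - fps_X) * Abs_fps (\<lambda>m. (1 / c) ^ Suc m) = 1"
    by (simp only: neg_equal_iff_equal)
  hence "fps_compose ((fps_const c - fps_X) * Abs_fps (\<lambda>m. (1 / c) ^ Suc m)) (fps_of_poly R) = fps_compose 1 (fps_of_poly R)"
    by simp
  hence "fps_of_poly Q * Z = 1"
    using R0 by (simp add: fps_compose_mult_distrib fps_compose_sub_distrib Z_def Q_def fps_of_poly_diff fps_of_poly_const)
  hence "G = G * (fps_of_poly Q * Z)" by simp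
  also have "\<dots> = fps_of_poly Q * G * Z" by (simp only: mult_ac)
  finally have "G = fps_const \<delta> * Z" unfolding QG .
  hence "fps_nth G i = \<delta> * fps_nth Z i" by simp
  thus ?thesis
    by (simp add: G_def Z_def fps_compose_nth fps_sum_nth atLeast0AtMost flip: fps_of_poly_power)
qed

section \<open>Expansions at infinity\<close>

context carlitz_lattice
begin

lemma imag_abs_of_A:
  assumes "a \<noteq> 0" "d \<noteq> 0"
  shows "imag ((ofA a * z + ofA b) / ofA d) = nm (ofA a) / nm (ofA d) * imag z"
proof -
  let ?a = "poly_to_K a / poly_to_K d" and ?b = "poly_to_K b / poly_to_K d"
  have "(ofA a * z + ofA b) / ofA d = ofK ?a * z + ofK ?b"
    by (simp add: of_A_def of_K_divide add_divide_distrib)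
  moreover have "abs_K ?a = nm (ofA a) / nm (ofA d)"
    by (simp add: of_A_def of_K_divide nm_divide flip: nm_of_K)
  ultimately show ?thesis using imag_abs_affine[of ?a z ?b] assms by simp
qed

lemma E_nz_if_imag_abs_pos:
  assumes "imag z > 0"
  shows "E z \<noteq> 0"
proof -
  have "nm \<pi> * imag z > 0" using assms \<pi>_nz by simp
  thus ?thesis using nm_E_ge_imag_abs[of z] by auto
qed

lemma imag_abs_div_of_A:
  "n \<noteq> 0 \<Longrightarrow> imag (z / ofA n) = imag z / nm (ofA n)"
  using imag_abs_of_A[of 1 n z 0] by simp

lemma u_param_small:
  assumes n: "n \<noteq> 0" and e: "e > 0"
  obtains R where "R \<ge> 0" "\<And>z. imag z > R \<Longrightarrow> nm (u_param \<iota> \<pi> (z / ofA n)) < e"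
    "\<And>z. imag z > R \<Longrightarrow> E (z / ofA n) \<noteq> 0"
proof -
  let ?N = "nm (ofA n)"
  have N: "?N > 0" using n by simp
  have p: "nm \<pi> > 0" using \<pi>_nz by simp
  show ?thesis
  proof (rule that[of "?N / (nm \<pi> * e)"])
    show "?N / (nm \<pi> * e) \<ge> 0" using N p e by simp
    fix z assume z: "imag z > ?N / (nm \<pi> * e)"
    have pos: "imag z > 0"
      using z divide_pos_pos[OF N mult_pos_pos[OF p e]] by linarith
    thus "E (z / ofA n) \<noteq> 0"
      using N by (intro E_nz_if_imag_abs_pos) (simp add: imag_abs_div_of_A[OF n])
    have "1 / e < nm \<pi> * (imag z / ?N)" using z N p e by (simp add: field_simps)
    also have "\<dots> \<le> nm (E (z / ofA n))"
      using nm_E_ge_imag_abs[of "z / ofA n"] by (simp add: imag_abs_div_of_A[OF n])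
    finally have "1 / e < nm (E (z / ofA n))" .
    moreover have "1 / e > 0" using e by simp
    ultimately have "nm (E (z / ofA n)) > 0" "1 < nm (E (z / ofA n)) * e"
      using e by (linarith, simp add: field_simps)
    thus "nm (u_param \<iota> \<pi> (z / ofA n)) < e"
      by (simp add: u_param_E nm_divide field_simps)
  qed
qed

lemma vanishes_at_infinityI:
  assumes "fps_nth F 0 = 0"
    and "\<And>z. z \<in> \<Omega> \<Longrightarrow> imag z > R \<Longrightarrow> fps_sums F (u_param \<iota> \<pi> (z / ofA n)) (f z)"
  shows "vanishes_at_infinity \<iota> \<pi> n f"
  unfolding vanishes_at_infinity_def
  by (rule exI[of _ "fps_nth F"], rule exI[of _ R]) (use assms in \<open>simp add: fps_sums_def\<close>)

text \<open>
  Convergence at a single point where \<open>u \<noteq> 0\<close> bounds the coefficients.  If there is no point of large imaginary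
  part at all, the zero series will do.
\<close>

lemma vanishes_at_infinityE:
  assumes "vanishes_at_infinity \<iota> \<pi> n f" and n: "n \<noteq> 0"
  obtains F R where "geom_bounded F" "fps_nth F 0 = 0" "R \<ge> 0"
    "\<And>z. z \<in> \<Omega> \<Longrightarrow> imag z > R \<Longrightarrow> fps_sums F (u_param \<iota> \<pi> (z / ofA n)) (f z)"
proof -
  obtain a R where a: "a 0 = 0" "\<And>z. z \<in> \<Omega> \<Longrightarrow> imag z > R \<Longrightarrow>
    (\<lambda>i. a i * u_param \<iota> \<pi> (z / ofA n) ^ i) sums f z"
    using assms(1) unfolding vanishes_at_infinity_def by blast
  have F: "fps_sums (Abs_fps a) (u_param \<iota> \<pi> (z / ofA n)) (f z)"
    if "z \<in> \<Omega>" "imag z > max R 0" for z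
    using a(2) that by (simp add: fps_sums_def)
  show ?thesis
  proof (cases "\<exists>z\<in>\<Omega>. imag z > max R 0")
    case True
    then obtain z where z: "z \<in> \<Omega>" "imag z > max R 0" by blast
    have "imag (z / ofA n) > 0" using z(2) n by (simp add: imag_abs_div_of_A)
    hence "u_param \<iota> \<pi> (z / ofA n) \<noteq> 0" by (simp add: u_param_E E_nz_if_imag_abs_pos)
    hence gb: "geom_bounded (Abs_fps a)" by (rule geom_bounded_if_sums[OF F[OF z]])
    show ?thesis
      by (rule that[of "Abs_fps a" "max R 0"]) (use gb a(1) F in simp_all)
  next
    case False
    have "geom_bounded 0" unfolding geom_bounded_def by (intro exI[of _ 0]) simp
    thus ?thesis by (rule that[of 0 "max R 0"]) (use False in auto)
  qed
qed

lemma vanishes_at_infinity_0: "vanishes_at_infinity \<iota> \<pi> n 0"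
proof (rule vanishes_at_infinityI[of 0 0])
  fix z
  show "fps_sums 0 (u_param \<iota> \<pi> (z / ofA n)) (0 z)"
    using fps_sums_poly[of 0] by simp
qed simp

lemma vanishes_at_infinity_add:
  assumes "vanishes_at_infinity \<iota> \<pi> n f" "vanishes_at_infinity \<iota> \<pi> n g"
  shows "vanishes_at_infinity \<iota> \<pi> n (f + g)"
proof -
  obtain a R where a: "a 0 = 0" "\<And>z. z \<in> \<Omega> \<Longrightarrow> imag z > R \<Longrightarrow>
    (\<lambda>i. a i * u_param \<iota> \<pi> (z / ofA n) ^ i) sums f z"
    using assms(1) unfolding vanishes_at_infinity_def by blast
  obtain b R' where b: "b 0 = 0" "\<And>z. z \<in> \<Omega> \<Longrightarrow> imag z > R' \<Longrightarrow>
    (\<lambda>i. b i * u_param \<iota> \<pi> (z / ofA n) ^ i) sums g z"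
    using assms(2) unfolding vanishes_at_infinity_def by blast
  show ?thesis
  proof (rule vanishes_at_infinityI)
    show "fps_nth (Abs_fps (\<lambda>i. a i + b i)) 0 = 0" using a b by simp
    fix z assume z: "z \<in> \<Omega>" "imag z > max R R'"
    show "fps_sums (Abs_fps (\<lambda>i. a i + b i)) (u_param \<iota> \<pi> (z / ofA n)) ((f + g) z)"
      using sums_add_nm[OF a(2)[OF z(1)] b(2)[OF z(1)]] z(2)
      by (simp add: fps_sums_def distrib_right)
  qed
qed

lemma vanishes_at_infinity_scale:
  assumes "vanishes_at_infinity \<iota> \<pi> n f"
  shows "vanishes_at_infinity \<iota> \<pi> n (scale_fun c f)"
proof -
  obtain a R where a: "a 0 = 0" "\<And>z. z \<in> \<Omega> \<Longrightarrow> imag z > R \<Longrightarrow>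
    (\<lambda>i. a i * u_param \<iota> \<pi> (z / ofA n) ^ i) sums f z"
    using assms(1) unfolding vanishes_at_infinity_def by blast
  show ?thesis
  proof (rule vanishes_at_infinityI)
    show "fps_nth (Abs_fps (\<lambda>i. c * a i)) 0 = 0" using a by simp
    fix z assume z: "z \<in> \<Omega>" "imag z > R"
    show "fps_sums (Abs_fps (\<lambda>i. c * a i)) (u_param \<iota> \<pi> (z / ofA n)) (scale_fun c f z)"
      using sums_cmult_nm[OF a(2)[OF z]] by (simp add: fps_sums_def scale_fun_def mult.assoc)
  qed
qed

text \<open>
  The parameter \<open>u(a w + b)\<close> is a power series in \<open>u(w)\<close>: if \<open>x = 1/u(w)\<close>, then
  \<open>1/u(a w + b)\<close> is a polynomial in \<open>x\<close>, of positive degree, and its reciprocal is a power series in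
  \<open>1/x\<close> without constant term.
\<close>

lemma vanishes_at_infinity_affine:
  assumes f: "vanishes_at_infinity \<iota> \<pi> n f" and nz: "n \<noteq> 0" "a \<noteq> 0" "d \<noteq> 0"
    and g: "\<And>z. z \<in> \<Omega> \<Longrightarrow> g z = c * f ((ofA a * z + ofA b) / ofA d)"
  shows "vanishes_at_infinity \<iota> \<pi> (d * n) g"
proof -
  obtain F R where F: "geom_bounded F" "fps_nth F 0 = 0" "R \<ge> 0"
    "\<And>z. z \<in> \<Omega> \<Longrightarrow> imag z > R \<Longrightarrow> fps_sums F (u_param \<iota> \<pi> (z / ofA n)) (f z)"
    using vanishes_at_infinityE[OF f nz(1)] by blast
  define \<phi> where "\<phi> v = (THE s. fps_sums F v s)" for v
  have \<phi>: "expands \<phi> F" unfolding \<phi>_def by (rule expands_if_geom_bounded[OF F(1)])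
  have \<phi>_eq: "\<phi> v = s" if "fps_sums F v s" for v s
    unfolding \<phi>_def by (rule the_equality) (use that fps_sums_unique in blast)+
  obtain P where P: "\<And>z. poly P (E z) = E (ofA a * z)" "pderiv P = [:ofA a:]"
    using carlitz_module_poly[of a] by blast
  define S where "S = P + [:E (ofA b / ofA (d * n)):]"
  have S: "poly S (E w) = E (ofA a * w + ofA b / ofA (d * n))" for w
    by (simp add: S_def P(1) E_add)
  have "pderiv S \<noteq> 0" using nz by (simp add: S_def pderiv_add P(2) pderiv_pCons)
  have degS: "degree S > 0"
  proof (rule ccontr)
    assume "\<not> degree S > 0"
    then obtain s where "S = [:s:]" by (auto elim: degree_eq_zeroE)
    hence "pderiv S = 0" by (simp add: pderiv_pCons)
    thus False using \<open>pderiv S \<noteq> 0\<close> by contradiction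
  qed
  hence S0: "S \<noteq> 0" by auto
  define s0 where "s0 = lead_coeff S"
  define B where "B = [:s0:] - reflect_poly S"
  define \<psi> where "\<psi> v = poly (monom 1 (degree S)) v * ((\<lambda>x. inverse (s0 - x)) \<circ> poly B) v" for v
  define H where "H = fps_of_poly (monom 1 (degree S)) *
      fps_compose (Abs_fps (\<lambda>i. (1 / s0) ^ Suc i)) (fps_of_poly B)"
  have "s0 \<noteq> 0" and "fps_nth (fps_of_poly B) 0 = 0" using S0 by (simp_all add: s0_def B_def)
  hence \<psi>: "expands \<psi> H"
    unfolding \<psi>_def H_def
    by (intro expands_mult expands_poly expands_compose[OF expands_geometric expands_poly])
  have H0: "fps_nth H 0 = 0" using degS by (simp add: H_def)
  define G where "G = fps_of_poly [:c:] * fps_compose F H"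
  have "expands (\<lambda>v. poly [:c:] v * (\<phi> \<circ> \<psi>) v) G"
    unfolding G_def by (intro expands_mult expands_poly expands_compose \<phi> \<psi> H0)
  then obtain e where e: "e > 0" "\<And>v. nm v < e \<Longrightarrow> fps_sums G v (poly [:c:] v * (\<phi> \<circ> \<psi>) v)"
    unfolding expands_def by blast
  obtain R' where R': "R' \<ge> 0" "\<And>z. imag z > R' \<Longrightarrow> nm (u_param \<iota> \<pi> (z / ofA (d * n))) < e"
    "\<And>z. imag z > R' \<Longrightarrow> E (z / ofA (d * n)) \<noteq> 0"
    by (rule u_param_small[OF _ e(1), of "d * n"]) (use nz in simp_all)
  let ?q = "nm (ofA a) / nm (ofA d)"
  have q: "?q > 0" using nz by simp
  show ?thesis
  proof (rule vanishes_at_infinityI)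
    show "fps_nth G 0 = 0" using F(2) by (simp add: G_def fps_compose_nth_0)
    fix z assume z: "z \<in> \<Omega>" "imag z > max R' (R / ?q)"
    define w where "w = z / ofA (d * n)"
    define y where "y = (ofA a * z + ofA b) / ofA d"
    have Ew: "E w \<noteq> 0" unfolding w_def using z(2) by (intro R'(3)) simp
    have "imag y = ?q * imag z" unfolding y_def by (rule imag_abs_of_A[OF nz(2,3)])
    moreover have "R / ?q < imag z" using z(2) by (simp only: max_less_iff_conj)
    hence "R < ?q * imag z" by (simp only: pos_divide_less_eq[OF q] mult.commute)
    ultimately have yR: "imag y > R" by simp
    have "y \<in> \<Omega>"
      unfolding y_def of_A_def using moebius_upper_half[OF z(1), of "poly_to_K a" "poly_to_K d" "poly_to_K b" 0] nz
      by simp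
    hence fy: "\<phi> (u_param \<iota> \<pi> (y / ofA n)) = f y" by (intro \<phi>_eq F(4) yR)
    have "y / ofA n = ofA a * w + ofA b / ofA (d * n)"
      by (simp add: y_def w_def of_A_mult add_divide_distrib)
    hence "u_param \<iota> \<pi> (y / ofA n) = 1 / poly S (E w)" by (simp add: u_param_E S)
    also have "\<dots> = \<psi> (1 / E w)"
      using Ew poly_reflect_poly_nz[of "1 / E w" S]
      by (simp add: \<psi>_def B_def poly_monom field_simps)
    finally have "\<psi> (1 / E w) = u_param \<iota> \<pi> (y / ofA n)" ..
    hence "poly [:c:] (1 / E w) * (\<phi> \<circ> \<psi>) (1 / E w) = g z"
      using fy g[OF z(1)] by (simp add: y_def)
    moreover have "nm (1 / E w) < e" using R'(2)[of z] z(2) by (simp add: w_def u_param_E)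
    ultimately show "fps_sums G (u_param \<iota> \<pi> (z / ofA (d * n))) (g z)"
      using e(2)[of "1 / E w"] by (simp add: u_param_E w_def)
  qed
qed

lemma translated_torsion_points:
  fixes w :: 'c and d :: "'q poly"
  assumes d: "d \<noteq> 0"
  defines "A \<equiv> (\<lambda>\<mu>. E (w + ofA \<mu> / ofA d)) ` lowdeg (degree d)"
  shows "inj_on (\<lambda>\<mu>. E (w + ofA \<mu> / ofA d)) (lowdeg (degree d))"
    and "finite A" and "card A = CARD('q) ^ degree d"
proof -
  show inj: "inj_on (\<lambda>\<mu>. E (w + ofA \<mu> / ofA d)) (lowdeg (degree d))"
  proof (rule inj_onI)
    fix \<mu> \<nu> assume mem: "\<mu> \<in> lowdeg (degree d)" "\<nu> \<in> lowdeg (degree d)"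
      and eq: "E (w + ofA \<mu> / ofA d) = E (w + ofA \<nu> / ofA d)"
    have "E (ofA (\<mu> - \<nu>) / ofA d) = 0"
      using eq by (simp add: E_add of_A_diff diff_divide_distrib E_diff)
    then obtain a where "ofA (\<mu> - \<nu>) / ofA d = ofA a" by (auto simp: E_eq_0_iff)
    hence "ofA (\<mu> - \<nu> - a * d) = 0"
      using d by (simp add: of_A_diff of_A_mult divide_eq_eq)
    hence eq: "\<mu> - \<nu> = a * d" by simp
    have "\<mu> - \<nu> \<in> lowdeg (degree d)" using mem by (rule lowdeg_diff)
    hence "\<mu> - \<nu> = 0 \<or> degree (a * d) < degree d" unfolding lowdeg_iff eq by simp
    thus "\<mu> = \<nu>" using d eq degree_mult_eq[of a d] by (cases "a = 0") auto
  qed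
  show "finite A" unfolding A_def by (intro finite_imageI finite_lowdeg)
  show "card A = CARD('q) ^ degree d" unfolding A_def card_image[OF inj] by (rule card_lowdeg)
qed

text \<open>
  A function with an expansion in \<open>u(z/(d n))\<close> that is invariant under the translations by \<open>n A\<close> has
  one in \<open>y = u(z/n)\<close>.  Averaging over the translations modulo \<open>d n A\<close> is impossible, since their number
  is a power of \<open>q\<close>, which is zero in the field unless
  \<open>d\<close> is constant; instead \<open>f\<close> is multiplied by \<open>u(z/(d n))\<close> before summing.  The sum of the translates of
  \<open>u(z/(d n))\<close> is \<open>d y\<close>, and the sums of the higher powers are polynomials in \<open>y\<close>.
\<close>

lemma vanishes_at_infinity_descent:
  assumes f: "vanishes_at_infinity \<iota> \<pi> (d * n) f" and nz: "n \<noteq> 0" "d \<noteq> 0"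
    and inv: "\<And>z \<mu>. f (z + ofA (n * \<mu>)) = f z"
  shows "vanishes_at_infinity \<iota> \<pi> n f"
proof -
  have dn: "d * n \<noteq> 0" using nz by simp
  obtain F R where F: "geom_bounded F" "fps_nth F 0 = 0" "R \<ge> 0"
    "\<And>z. z \<in> \<Omega> \<Longrightarrow> imag z > R \<Longrightarrow> fps_sums F (u_param \<iota> \<pi> (z / ofA (d * n))) (f z)"
    using vanishes_at_infinityE[OF f dn] by blast
  obtain M r where Mr: "M \<ge> 1" "r \<ge> 1" "\<And>i. nm (fps_nth F i) \<le> M * r ^ i"
    using geom_boundedE[OF F(1)] by blast
  obtain P where P: "\<And>z. poly P (E z) = E (ofA d * z)" "pderiv P = [:ofA d:]"
    "degree P \<le> CARD('q) ^ degree d"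
    using carlitz_module_poly[of d] by blast
  have "poly P (E 0) = 0" using P(1)[of 0] by simp
  hence P0: "coeff P 0 = 0" by (simp add: poly_0_coeff_0)
  define D where "D = degree P"
  \<comment> \<open>The coefficients of \<open>P\<^sup>m\<close> occupy the degrees from \<open>m\<close> to \<open>D m\<close> and are bounded by \<open>K\<^sup>m\<close>.\<close>
  define K where "K = 1 + (\<Sum>i\<le>D. nm (coeff P i))"
  have K1: "K \<ge> 1" unfolding K_def by (simp add: sum_nonneg)
  have KP: "nm (coeff P i) \<le> K" for i
  proof (cases "i \<le> D")
    case True
    hence "nm (coeff P i) \<le> (\<Sum>i\<le>D. nm (coeff P i))"
      by (intro member_le_sum) auto
    thus ?thesis by (simp add: K_def)
  qed (use K1 in \<open>simp add: D_def coeff_eq_0\<close>)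
  have KPm: "nm (coeff (P ^ m) i) \<le> K ^ m" for m i
    using nm_power_nth[of "fps_of_poly P" 1 K m i] KP by (simp flip: fps_of_poly_power)
  have tri: "coeff (P ^ m) i = 0" if "i < m" for m i
    using startsby_zero_power_prefix[of "fps_of_poly P" m] that P0 by (simp flip: fps_of_poly_power)
  have top: "coeff (P ^ m) i = 0" if "i > D * m" for m i
    using that degree_power_le[of P m] by (intro coeff_eq_0) (simp add: D_def)
  define B where "B = K * r ^ D"
  have B1: "B \<ge> 1" unfolding B_def using K1 Mr(2) mult_mono[of 1 K 1 "r ^ D"] by (simp add: one_le_power)
  have bound: "nm (fps_nth F i * coeff (P ^ m) i) \<le> M * B ^ m" for i m
  proof (cases "i > D * m")
    case False
    have "nm (fps_nth F i * coeff (P ^ m) i) \<le> (M * r ^ i) * K ^ m"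
      unfolding nm_mult using Mr KPm by (intro mult_mono) auto
    also have "\<dots> \<le> (M * r ^ (D * m)) * K ^ m"
      using False Mr K1 by (intro mult_right_mono mult_left_mono power_increasing) auto
    also have "\<dots> = M * B ^ m" unfolding B_def power_mult_distrib power_mult by (simp only: mult_ac)
    finally show ?thesis .
  qed (use top Mr(1) B1 in simp)
  \<comment> \<open>The coefficients of the new expansion, read off from the sums of the powers of \<open>u\<close>.\<close>
  define b where "b m = (\<Sum>i\<le>D * m. fps_nth F i * coeff (P ^ m) i)" for m
  have nm_b: "nm (b m) \<le> M * B ^ m" for m
    unfolding b_def using bound Mr(1) B1 by (intro nm_sum) auto
  obtain R' where R': "R' \<ge> 0" "\<And>z. imag z > R' \<Longrightarrow> nm (u_param \<iota> \<pi> (z / ofA n)) < 1 / (2 * B)"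
    "\<And>z. imag z > R' \<Longrightarrow> E (z / ofA n) \<noteq> 0"
    by (rule u_param_small[OF nz(1), of "1 / (2 * B)"]) (use B1 in simp_all)
  show ?thesis
  proof (rule vanishes_at_infinityI)
    show "fps_nth (Abs_fps b) 0 = 0" using F(2) by (simp add: b_def)
    fix z assume z: "z \<in> \<Omega>" "imag z > max R R'"
    define w where "w = z / ofA (d * n)"
    define x where "x \<mu> = E (w + ofA \<mu> / ofA d)" for \<mu>
    define A where "A = x ` lowdeg (degree d)"
    note A = translated_torsion_points[OF nz(2), of w, folded x_def A_def]
    define c where "c = E (z / ofA n)"
    have c0: "c \<noteq> 0" unfolding c_def using z(2) by (intro R'(3)) simp
    have "poly P \<xi> = c" if \<xi>: "\<xi> \<in> A" for \<xi>
    proof -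
      obtain \<mu> where \<mu>: "\<xi> = E (w + ofA \<mu> / ofA d)" using \<xi> by (auto simp: A_def x_def)
      have "ofA d * (w + ofA \<mu> / ofA d) = z / ofA n + ofA \<mu>"
        using nz by (simp add: w_def of_A_mult distrib_left)
      hence "poly P \<xi> = E (z / ofA n + ofA \<mu>)" unfolding \<mu> P(1) by (rule arg_cong)
      thus ?thesis by (simp add: E_add c_def)
    qed
    hence goss: "(\<Sum>\<xi>\<in>A. (1 / \<xi>) ^ Suc i) = ofA d * (\<Sum>m\<le>i. (1 / c) ^ Suc m * coeff (P ^ m) i)" for i
      using P(3) A(3) by (intro power_sum_inverse_roots[OF P(2) P0 A(2) _ _ c0]) simp_all
    have Fsum: "fps_sums F (1 / \<xi>) (f z)" if \<xi>: "\<xi> \<in> A" for \<xi>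
    proof -
      obtain \<mu> where \<mu>: "\<xi> = E (w + ofA \<mu> / ofA d)" using \<xi> by (auto simp: A_def x_def)
      let ?z = "z + ofA (n * \<mu>)"
      have "imag ?z = imag z" using imag_abs_of_A[of 1 1 z "n * \<mu>"] by simp
      moreover have "?z \<in> \<Omega>"
        using moebius_upper_half[OF z(1), of 1 1 "poly_to_K (n * \<mu>)" 0] by (simp add: of_A_def)
      ultimately have "fps_sums F (u_param \<iota> \<pi> (?z / ofA (d * n))) (f z)"
        using F(4)[of ?z] z(2) inv[of z \<mu>] by simp
      moreover have "?z / ofA (d * n) = w + ofA \<mu> / ofA d"
        using nz by (simp add: w_def of_A_mult add_divide_distrib)
      ultimately show ?thesis by (simp add: u_param_E \<mu>)
    qed
    have "(\<lambda>i. \<Sum>\<xi>\<in>A. 1 / \<xi> * (fps_nth F i * (1 / \<xi>) ^ i)) sums (\<Sum>\<xi>\<in>A. 1 / \<xi> * f z)"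
      by (intro sums_sum_nm sums_cmult_nm) (use Fsum in \<open>simp add: fps_sums_def\<close>)
    moreover have "(\<Sum>\<xi>\<in>A. 1 / \<xi> * (fps_nth F i * (1 / \<xi>) ^ i)) = fps_nth F i * (\<Sum>\<xi>\<in>A. (1 / \<xi>) ^ Suc i)" for i
      by (simp add: sum_distrib_left mult_ac)
    moreover have "(\<Sum>\<xi>\<in>A. 1 / \<xi> * f z) = ofA d / c * f z"
    proof -
      have "(\<Sum>\<xi>\<in>A. 1 / \<xi> * f z) = (\<Sum>\<xi>\<in>A. (1 / \<xi>) ^ Suc 0) * f z"
        by (simp add: sum_distrib_right)
      thus ?thesis by (simp only: goss) simp
    qed
    ultimately have "(\<lambda>i. fps_nth F i * (ofA d * (\<Sum>m\<le>i. (1 / c) ^ Suc m * coeff (P ^ m) i))) sums (ofA d / c * f z)"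
      by (simp only: goss)
    from sums_cmult_nm[OF this, of "c / ofA d"]
    have "(\<lambda>i. c / ofA d * (fps_nth F i * (ofA d * (\<Sum>m\<le>i. (1 / c) ^ Suc m * coeff (P ^ m) i)))) sums f z"
      using c0 nz by simp
    moreover define C where "C m i = (1 / c) ^ m * (fps_nth F i * coeff (P ^ m) i)" for m i
    have "c / ofA d * (fps_nth F i * (ofA d * (\<Sum>m\<le>i. (1 / c) ^ Suc m * coeff (P ^ m) i))) = (\<Sum>m\<le>i. C m i)" for i
    proof -
      have "c / ofA d * (fps_nth F i * (ofA d * s)) = fps_nth F i * (c * s)" for s
        using nz by simp
      hence "c / ofA d * (fps_nth F i * (ofA d * (\<Sum>m\<le>i. (1 / c) ^ Suc m * coeff (P ^ m) i)))
          = fps_nth F i * (c * (\<Sum>m\<le>i. (1 / c) ^ Suc m * coeff (P ^ m) i))" .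
      also have "c * (\<Sum>m\<le>i. (1 / c) ^ Suc m * coeff (P ^ m) i) = (\<Sum>m\<le>i. (1 / c) ^ m * coeff (P ^ m) i)"
        unfolding sum_distrib_left using c0 by (intro sum.cong) simp_all
      also have "fps_nth F i * \<dots> = (\<Sum>m\<le>i. C m i)"
        unfolding sum_distrib_left C_def by (intro sum.cong refl) (simp only: mult_ac)
      finally show ?thesis .
    qed
    ultimately have total: "(\<lambda>i. \<Sum>m\<le>i. C m i) sums f z" by (simp only:)
    have y: "nm (1 / c) * B \<le> 1 / 2"
    proof -
      have "nm (1 / c) < 1 / (2 * B)" using R'(2)[of z] z(2) by (simp add: c_def u_param_E)
      thus ?thesis using B1 by (simp add: field_simps)
    qed
    have half: "nm (1 / c) ^ m * (M * B ^ m) \<le> M * (1 / 2) ^ m" for m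
    proof -
      have "(nm (1 / c) * B) ^ m \<le> (1 / 2) ^ m" using y B1 by (intro power_mono) auto
      hence "M * (nm (1 / c) * B) ^ m \<le> M * (1 / 2) ^ m" using Mr(1) by (intro mult_left_mono) auto
      thus ?thesis by (simp add: power_mult_distrib mult_ac)
    qed
    have CM: "nm (C m i) \<le> M * (1 / 2) ^ m" for m i
    proof -
      have "nm (C m i) \<le> nm (1 / c) ^ m * (M * B ^ m)"
        unfolding C_def nm_mult[of "(1 / c) ^ m"] nm_power by (intro mult_left_mono bound) simp
      thus ?thesis using half[of m] by (rule order_trans)
    qed
    have "nm (b m * (1 / c) ^ m) \<le> M * (1 / 2) ^ m" for m
    proof -
      have "nm (b m * (1 / c) ^ m) \<le> nm (1 / c) ^ m * (M * B ^ m)"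
        unfolding nm_mult nm_power mult.commute[of "nm (b m)"] by (intro mult_left_mono nm_b) simp
      thus ?thesis using half[of m] by (rule order_trans)
    qed
    hence "(\<lambda>m. nm (b m * (1 / c) ^ m)) \<longlonglongrightarrow> 0" by (rule tendsto_geom) simp_all
    from sums_if_tendsto_zero[OF this] obtain t where t: "(\<lambda>m. b m * (1 / c) ^ m) sums t" ..
    have "(\<lambda>i. \<Sum>m\<le>i. C m i) sums t"
    proof (rule triangular_sum_swap[OF _ _ t])
      fix e :: real assume "e > 0"
      have "(\<lambda>m. M * (1 / 2) ^ m) \<longlonglongrightarrow> M * 0"
        by (intro tendsto_mult tendsto_const LIMSEQ_power_zero) auto
      from order_tendstoD(2)[OF this, of e] \<open>e > 0\<close>
      obtain m0 where "\<And>m. m \<ge> m0 \<Longrightarrow> M * (1 / 2) ^ m < e"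
        by (auto simp: eventually_sequentially)
      thus "\<exists>m0. \<forall>m\<ge>m0. \<forall>i. nm (C m i) < e" using CM by (meson le_less_trans)
    next
      fix m
      have "(\<lambda>i. C m i) sums (\<Sum>i\<in>{..D * m}. C m i)"
        by (rule sums_finite) (use top in \<open>simp_all add: C_def\<close>)
      moreover have "(\<Sum>i\<in>{..D * m}. C m i) = b m * (1 / c) ^ m"
        unfolding C_def b_def sum_distrib_right by (intro sum.cong refl) (simp only: mult.commute)
      ultimately show "(\<lambda>i. C m i) sums (b m * (1 / c) ^ m)" by (simp only:)
    qed (simp add: C_def tri)
    hence "t = f z" using total by (rule sums_unique2)
    thus "fps_sums (Abs_fps b) (u_param \<iota> \<pi> (z / ofA n)) (f z)"
      using t by (simp add: fps_sums_def u_param_E c_def)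
  qed
qed

end

section \<open>Prime divisors of a squarefree level\<close>

lemma prime_divisor_cofactor:
  fixes n :: "'q::field poly"
  assumes P: "prime_divisor P n" and "squarefree n"
  obtains m where "n = P * m" "\<not> P dvd m" "n div P = m"
proof -
  have irr: "irreducible P" "P dvd n" using P by (simp_all add: prime_divisor_def)
  obtain m where m: "n = P * m" using irr(2) by (rule dvdE)
  have "\<not> P dvd m"
  proof
    assume "P dvd m"
    hence "P ^ 2 dvd n" unfolding m power2_eq_square by (rule mult_dvd_mono[OF dvd_refl])
    hence "P dvd 1" using assms(2) unfolding squarefree_def by blast
    thus False using irreducible_not_unit[OF irr(1)] by contradiction
  qed
  moreover have "P \<noteq> 0" using irr(1) by auto
  hence "n div P = m" by (simp add: m)
  ultimately show ?thesis by (rule that[OF m])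
qed

lemma W_matrix_AL_prime_divisor:
  fixes n :: "'q::field poly"
  assumes P: "prime_divisor P n" and "squarefree n"
  shows "W_matrix n P \<in> AL n P"
proof -
  obtain m where m: "n = P * m" "\<not> P dvd m" "n div P = m"
    by (rule prime_divisor_cofactor[OF assms])
  have "irreducible P" using P by (simp add: prime_divisor_def)
  thus ?thesis using m(2,1) by (rule W_matrix_AL)
qed

lemma distinct_prime_divisors:
  fixes n :: "'q::field poly"
  assumes P: "prime_divisor P n" and P': "prime_divisor P' n" and "P \<noteq> P'"
  obtains t where "n = P * P' * t"
proof -
  have irr: "irreducible P" "irreducible P'" "lead_coeff P = 1" "lead_coeff P' = 1" "P dvd n" "P' dvd n"
    using P P' by (simp_all add: prime_divisor_def)
  obtain m where m: "n = P * m" using irr(5) by (rule dvdE)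
  have "\<not> P' dvd P"
  proof
    assume "P' dvd P"
    then obtain c where c: "P = P' * c" by (rule dvdE)
    have "P' dvd 1 \<or> c dvd 1" using irr(1) c by (rule irreducibleD)
    hence "c dvd 1" using irreducible_not_unit[OF irr(2)] by blast
    then obtain a where a: "c = [:a:]" by (rule is_unit_polyE)
    have "lead_coeff P = lead_coeff P' * a" unfolding c a by (simp add: lead_coeff_mult)
    hence "a = 1" using irr(3,4) by simp
    hence "P = P'" unfolding c a by (simp flip: one_pCons)
    thus False using assms(3) by contradiction
  qed
  hence "P' dvd m"
    using irr(6) prime_elem_dvd_mult_iff[OF field_poly_irreducible_imp_prime[OF irr(2)], of P m]
    unfolding m by blast
  then obtain t where "m = P' * t" by (rule dvdE)
  hence "n = P * P' * t" using m by (simp only: mult.assoc)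
  thus ?thesis by (rule that)
qed

context carlitz_lattice
begin

section \<open>Cusp forms and Atkin--Lehner operators\<close>

lemma cusp_forms_supported: "f \<in> cusp_forms \<iota> \<pi> k l n \<Longrightarrow> supported f"
  using rigid_holomorphic_supported by (simp add: cusp_forms_def)

lemma cusp_forms_invariant: "f \<in> cusp_forms \<iota> \<pi> k l n \<Longrightarrow> \<gamma> \<in> Gamma0 n \<Longrightarrow> slashA k l f \<gamma> = f"
  by (simp add: cusp_forms_def)

lemma slash_A_0: "slashA k l 0 M = 0"
  by (rule ext, rule mat2_cases[of M]) (simp add: slash_A_mat2)

lemma cusp_forms_0: "0 \<in> cusp_forms \<iota> \<pi> k l n"
  by (simp add: cusp_forms_def rigid_holomorphic_0 slash_A_0 vanishes_at_infinity_0)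

lemma cusp_forms_add:
  "f \<in> cusp_forms \<iota> \<pi> k l n \<Longrightarrow> g \<in> cusp_forms \<iota> \<pi> k l n \<Longrightarrow> f + g \<in> cusp_forms \<iota> \<pi> k l n"
  by (simp add: cusp_forms_def rigid_holomorphic_add slash_A_add vanishes_at_infinity_add)

lemma cusp_forms_scale:
  "f \<in> cusp_forms \<iota> \<pi> k l n \<Longrightarrow> scale_fun c f \<in> cusp_forms \<iota> \<pi> k l n"
  by (simp add: cusp_forms_def rigid_holomorphic_scale slash_A_scale vanishes_at_infinity_scale)

lemma Gamma0_det_nz: "\<gamma> \<in> Gamma0 n \<Longrightarrow> det \<gamma> \<noteq> 0"
  unfolding Gamma0_iff by auto

lemma slash_A_left_factor:
  assumes "supported f" "\<And>\<gamma>. \<gamma> \<in> Gamma0 n \<Longrightarrow> slashA k l f \<gamma> = f" "\<gamma> \<in> Gamma0 n" "det M \<noteq> 0"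
  shows "slashA k l f (\<gamma> ** M) = slashA k l f M"
  using slash_A_slash_A[where k = k and l = l, OF assms(1) Gamma0_det_nz[OF assms(3)] assms(4)]
    assms(2)[OF assms(3)] by simp

lemma slash_A_AL_invariant:
  assumes f: "supported f" "\<And>\<gamma>. \<gamma> \<in> Gamma0 n \<Longrightarrow> slashA k l f \<gamma> = f"
    and W: "W \<in> AL n P" and P: "P dvd n" "P \<noteq> 0" and \<gamma>: "\<gamma> \<in> Gamma0 n"
  shows "slashA k l (slashA k l f W) \<gamma> = slashA k l f W"
proof -
  obtain \<gamma>' where \<gamma>': "\<gamma>' \<in> Gamma0 n" "W ** \<gamma> = \<gamma>' ** W"
    by (rule AL_left_coset[OF AL_Gamma0_right[OF W P(1) \<gamma>] W P])
  have "slashA k l (slashA k l f W) \<gamma> = slashA k l f (W ** \<gamma>)"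
    by (rule slash_A_slash_A[OF f(1) AL_det_nz[OF W P(2)] Gamma0_det_nz[OF \<gamma>]])
  also have "\<dots> = slashA k l f W"
    unfolding \<gamma>'(2) by (rule slash_A_left_factor[OF f \<gamma>'(1) AL_det_nz[OF W P(2)]])
  finally show ?thesis .
qed

text \<open>
  For the behaviour at the cusp of \<open>\<gamma>\<close>, write \<open>W \<gamma> = \<delta> (a b; 0 d)\<close>.  The form \<open>f|\<delta>\<close> has an expansion by assumption;
  the triangular matrix leads to an expansion in \<open>u(z/(d n))\<close>.  The translations by \<open>n A\<close> are congruent to the identity
  modulo \<open>n\<close>, so their conjugates by \<open>\<gamma>\<close> lie in \<open>Gamma0 n\<close> and fix \<open>f|W\<close>, and the descent applies.
\<close>

lemma cusp_forms_AL:
  assumes f: "f \<in> cusp_forms \<iota> \<pi> k l n" and W: "W \<in> AL n P" and P: "P dvd n" and n: "n \<noteq> 0"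
  shows "slashA k l f W \<in> cusp_forms \<iota> \<pi> k l n"
proof -
  have P0: "P \<noteq> 0" using P n by auto
  have detW: "det W \<noteq> 0" by (rule AL_det_nz[OF W P0])
  note fs = cusp_forms_supported[OF f] and finv = cusp_forms_invariant[OF f]
  let ?fW = "slashA k l f W"
  have fWs: "supported ?fW" by (rule slash_A_supported[OF fs])
  have inv: "slashA k l ?fW \<gamma> = ?fW" if "\<gamma> \<in> Gamma0 n" for \<gamma>
    by (rule slash_A_AL_invariant[OF fs finv W P P0 that])
  have "rigid_holomorphic \<iota> ?fW"
    unfolding slash_A_def using f detW
    by (intro rigid_holomorphic_slash) (simp_all add: cusp_forms_def det_map_matrix_poly_to_K)
  moreover have "vanishes_at_infinity \<iota> \<pi> n (slashA k l ?fW \<gamma>)" if \<gamma>: "invertible \<gamma>" for \<gamma>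
  proof -
    have det\<gamma>: "det \<gamma> dvd 1" using \<gamma> by (simp add: invertible_mat2_iff)
    hence det\<gamma>0: "det \<gamma> \<noteq> 0" by auto
    have "det (W ** \<gamma>) \<noteq> 0" using detW det\<gamma>0 by (simp add: det_mul)
    then obtain \<delta> a b d where dec: "det \<delta> = 1" "W ** \<gamma> = \<delta> ** mat2 a b 0 d" "a \<noteq> 0" "d \<noteq> 0"
      by (rule upper_triangular_decomposition)
    let ?g = "slashA k l ?fW \<gamma>" and ?h = "slashA k l f \<delta>"
    have "invertible \<delta>" by (simp add: invertible_mat2_iff dec(1))
    hence h: "vanishes_at_infinity \<iota> \<pi> n ?h" using f by (simp add: cusp_forms_def)
    have "?g = slashA k l f (\<delta> ** mat2 a b 0 d)"
      using slash_A_slash_A[OF fs detW det\<gamma>0] dec(2) by simp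
    also have "\<dots> = slashA k l ?h (mat2 a b 0 d)"
      by (rule slash_A_slash_A[OF fs, symmetric]) (use dec in \<open>simp_all add: det_mat2\<close>)
    finally have g: "?g z = (ofA (a * d) ^ l * ofA d powi (- int k)) *
        ?h ((ofA a * z + ofA b) / ofA d)" for z
      by (simp add: slash_A_mat2)
    have "vanishes_at_infinity \<iota> \<pi> (d * n) ?g"
      by (rule vanishes_at_infinity_affine[OF h n dec(3,4)]) (rule g)
    thus ?thesis
    proof (rule vanishes_at_infinity_descent[OF _ n dec(4)])
      fix z \<mu>
      let ?N = "mat2 1 (n * \<mu>) 0 1"
      have detN: "det ?N = 1" by (simp add: det_mat2)
      obtain x y u v where G: "\<gamma> = mat2 x y u v" by (rule mat2_cases)
      have "n dvd (\<gamma> ** ?N) $ 2 $ 1 * \<gamma> $ 2 $ 2 - (\<gamma> ** ?N) $ 2 $ 2 * \<gamma> $ 2 $ 1"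
        by (simp add: G mat2_mult algebra_simps)
      moreover have "det (\<gamma> ** ?N) dvd 1" using det\<gamma> by (simp add: det_mul detN)
      ultimately obtain \<eta> where \<eta>: "\<eta> \<in> Gamma0 n" "\<gamma> ** ?N = \<eta> ** \<gamma>"
        using same_Gamma0_coset_iff[OF _ det\<gamma>, of "\<gamma> ** ?N" n] by blast
      have "slashA k l ?g ?N = slashA k l ?fW (\<eta> ** \<gamma>)"
        using slash_A_slash_A[OF fWs det\<gamma>0, of ?N] detN \<eta>(2) by simp
      also have "\<dots> = ?g" by (rule slash_A_left_factor[OF fWs inv \<eta>(1) det\<gamma>0])
      finally have "slashA k l ?g ?N z = ?g z" by (rule arg_cong)
      thus "?g (z + ofA (n * \<mu>)) = ?g z" by (simp add: slash_A_mat2)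
    qed
  qed
  ultimately show ?thesis using inv by (simp add: cusp_forms_def)
qed

lemma slash_A_AL_twice:
  assumes f: "f \<in> cusp_forms \<iota> \<pi> k l n" and W: "W \<in> AL n P" and P: "P dvd n" "P \<noteq> 0"
  shows "slashA k l (slashA k l f W) W = scale_fun (ofA P powi (2 * int l - int k)) f"
proof -
  note fs = cusp_forms_supported[OF f] and finv = cusp_forms_invariant[OF f]
  obtain \<gamma> where \<gamma>: "\<gamma> \<in> Gamma0 n" "W ** W = mat2 P 0 0 P ** \<gamma>" by (rule AL_square[OF W P])
  have detW: "det W \<noteq> 0" by (rule AL_det_nz[OF W P(2)])
  have "slashA k l (slashA k l f W) W = slashA k l f (mat2 P 0 0 P ** \<gamma>)"
    using slash_A_slash_A[OF fs detW detW] \<gamma>(2) by simp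
  also have "\<dots> = slashA k l (slashA k l f (mat2 P 0 0 P)) \<gamma>"
    using P(2) Gamma0_det_nz[OF \<gamma>(1)] by (intro slash_A_slash_A[OF fs, symmetric]) (simp_all add: det_mat2)
  also have "\<dots> = scale_fun (ofA P powi (2 * int l - int k)) f"
    by (simp add: slash_A_scalar[OF P(2)] slash_A_scale finv[OF \<gamma>(1)])
  finally show ?thesis .
qed

text \<open>
  Both products are Atkin--Lehner matrices for the divisor \<open>P P'\<close>, and these form a single coset of \<open>Gamma0 n\<close>.
\<close>

lemma slash_A_AL_commute:
  assumes f: "f \<in> cusp_forms \<iota> \<pi> k l n" and W: "W \<in> AL n P" and W': "W' \<in> AL n P'"
    and PP': "P * P' dvd n" and n: "n \<noteq> 0"
  shows "slashA k l (slashA k l f W) W' = slashA k l (slashA k l f W') W"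
proof -
  note fs = cusp_forms_supported[OF f] and finv = cusp_forms_invariant[OF f]
  have P: "P \<noteq> 0" "P' \<noteq> 0" using PP' n by auto
  have "W ** W' \<in> AL n (P * P')" by (rule AL_mult[OF W W' PP'])
  moreover have "W' ** W \<in> AL n (P * P')" using AL_mult[OF W' W] PP' by (simp add: mult.commute)
  moreover have "P * P' \<noteq> 0" using P by simp
  ultimately obtain \<gamma> where \<gamma>: "\<gamma> \<in> Gamma0 n" "W ** W' = \<gamma> ** (W' ** W)"
    using AL_left_coset[OF _ _ PP'] by blast
  have det: "det W \<noteq> 0" "det W' \<noteq> 0" by (rule AL_det_nz[OF W P(1)], rule AL_det_nz[OF W' P(2)])
  have "slashA k l (slashA k l f W) W' = slashA k l f (\<gamma> ** (W' ** W))"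
    using slash_A_slash_A[OF fs det] \<gamma>(2) by simp
  also have "\<dots> = slashA k l f (W' ** W)"
    by (rule slash_A_left_factor[OF fs finv \<gamma>(1)]) (use det in \<open>simp_all add: det_mul\<close>)
  also have "\<dots> = slashA k l (slashA k l f W') W"
    by (rule slash_A_slash_A[OF fs det(2,1), symmetric])
  finally show ?thesis .
qed

section \<open>Traces\<close>

lemma trace_op_reps:
  assumes h: "supported h" "\<And>\<gamma>. \<gamma> \<in> Gamma0 n \<Longrightarrow> slashA k l h \<gamma> = h"
    and r: "\<And>i. i \<in> I \<Longrightarrow> r i \<in> Gamma0 (n div P)"
    and uniq: "\<And>\<gamma>. \<gamma> \<in> Gamma0 (n div P) \<Longrightarrow> \<exists>!i. i \<in> I \<and> (\<exists>\<delta>\<in>Gamma0 n. \<gamma> = \<delta> ** r i)"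
  shows "trace_op \<iota> k l n P h = (\<lambda>z. \<Sum>i\<in>I. slashA k l h (r i) z)"
proof
  fix z
  define coset where "coset \<gamma> = (\<lambda>\<delta>. \<delta> ** \<gamma>) ` Gamma0 n" for \<gamma> :: "'q poly^2^2"
  have self: "\<gamma> \<in> coset \<gamma>" for \<gamma>
    unfolding coset_def by (rule image_eqI[OF _ Gamma0_one]) simp
  have coset_eq: "coset (\<delta> ** \<gamma>) = coset \<gamma>" if \<delta>: "\<delta> \<in> Gamma0 n" for \<delta> \<gamma>
  proof (intro equalityI subsetI)
    fix x assume "x \<in> coset (\<delta> ** \<gamma>)"
    then obtain \<epsilon> where \<epsilon>: "\<epsilon> \<in> Gamma0 n" "x = \<epsilon> ** (\<delta> ** \<gamma>)" unfolding coset_def by blast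
    have "x = (\<epsilon> ** \<delta>) ** \<gamma>" by (simp only: \<epsilon>(2) matrix_mul_assoc)
    thus "x \<in> coset \<gamma>" unfolding coset_def using Gamma0_mult[OF \<epsilon>(1) \<delta>] by (rule image_eqI)
  next
    fix x assume "x \<in> coset \<gamma>"
    then obtain \<epsilon> where \<epsilon>: "\<epsilon> \<in> Gamma0 n" "x = \<epsilon> ** \<gamma>" unfolding coset_def by blast
    obtain \<delta>' where \<delta>': "\<delta>' \<in> Gamma0 n" "\<delta> ** \<delta>' = mat 1" "\<delta>' ** \<delta> = mat 1"
      by (rule Gamma0_inverse[OF \<delta>])
    have "(\<epsilon> ** \<delta>') ** (\<delta> ** \<gamma>) = \<epsilon> ** ((\<delta>' ** \<delta>) ** \<gamma>)" by (simp only: matrix_mul_assoc)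
    also have "\<dots> = x" by (simp only: \<delta>'(3) \<epsilon>(2) matrix_mul_lid)
    finally have "x = (\<epsilon> ** \<delta>') ** (\<delta> ** \<gamma>)" ..
    thus "x \<in> coset (\<delta> ** \<gamma>)" unfolding coset_def using Gamma0_mult[OF \<epsilon>(1) \<delta>'(1)] by (rule image_eqI)
  qed
  have "inj_on (\<lambda>i. coset (r i)) I"
  proof (rule inj_onI)
    fix i j assume ij: "i \<in> I" "j \<in> I" "coset (r i) = coset (r j)"
    have "r i \<in> coset (r j)" using self[of "r i"] ij(3) by simp
    hence j: "\<exists>\<delta>\<in>Gamma0 n. r i = \<delta> ** r j" unfolding coset_def by blast
    have i: "\<exists>\<delta>\<in>Gamma0 n. r i = \<delta> ** r i" by (rule bexI[OF _ Gamma0_one]) simp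
    show "i = j" using uniq[OF r[OF ij(1)]] ij(1,2) i j by (elim ex1E) blast
  qed
  moreover have "Gamma0_cosets n (n div P) = (\<lambda>i. coset (r i)) ` I"
  proof (intro equalityI subsetI)
    fix S assume "S \<in> Gamma0_cosets n (n div P)"
    then obtain \<gamma> where \<gamma>: "\<gamma> \<in> Gamma0 (n div P)" "S = coset \<gamma>"
      unfolding Gamma0_cosets_def coset_def by blast
    obtain i \<delta> where i: "i \<in> I" "\<delta> \<in> Gamma0 n" "\<gamma> = \<delta> ** r i" using uniq[OF \<gamma>(1)] by blast
    have "S = coset (r i)" unfolding \<gamma>(2) i(3) by (rule coset_eq[OF i(2)])
    thus "S \<in> (\<lambda>i. coset (r i)) ` I" using i(1) by (rule image_eqI)
  next
    fix S assume "S \<in> (\<lambda>i. coset (r i)) ` I"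
    then obtain i where i: "i \<in> I" "S = coset (r i)" by blast
    show "S \<in> Gamma0_cosets n (n div P)"
      unfolding Gamma0_cosets_def i(2) coset_def by (rule imageI[OF r[OF i(1)]])
  qed
  moreover have "slashA k l h (SOME \<gamma>. \<gamma> \<in> coset (r i)) = slashA k l h (r i)" if i: "i \<in> I" for i
  proof -
    have "(SOME \<gamma>. \<gamma> \<in> coset (r i)) \<in> coset (r i)" using self by (rule someI)
    then obtain \<delta> where \<delta>: "\<delta> \<in> Gamma0 n" "(SOME \<gamma>. \<gamma> \<in> coset (r i)) = \<delta> ** r i"
      unfolding coset_def by blast
    show ?thesis unfolding \<delta>(2) by (rule slash_A_left_factor[OF h \<delta>(1) Gamma0_det_nz[OF r[OF i]]])
  qed
  ultimately show "trace_op \<iota> k l n P h z = (\<Sum>i\<in>I. slashA k l h (r i) z)"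
    unfolding trace_op_def by (simp add: sum.reindex)
qed

lemma trace_op_scale: 
  "trace_op \<iota> k l n P (scale_fun c f) = scale_fun c (trace_op \<iota> k l n P f)"
  by (simp add: trace_op_def slash_A_scale) (simp add: scale_fun_def sum_distrib_left)

lemma trace_op_add: 
  "trace_op \<iota> k l n P (f + g) = trace_op \<iota> k l n P f + trace_op \<iota> k l n P g"
  by (simp add: trace_op_def slash_A_add fun_eq_iff sum.distrib)

lemma trace_op_0: "trace_op \<iota> k l n P 0 = 0"
  by (simp add: trace_op_def slash_A_0 fun_eq_iff)

lemma finite_degree_less: "finite {Q :: 'q poly. degree Q < d}"
  by (rule finite_subset[OF _ finite_lowdeg[of d]]) (auto simp: lowdeg_iff)

text \<open>
  The nontrivial representatives \<open>\<gamma>\<close> of the cosets can be chosen with \<open>W \<gamma>\<close> equal to the matrices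
  that define the \<open>U\<close> operator.
\<close>

lemma twisted_trace_eq:
  assumes f: "f \<in> cusp_forms \<iota> \<pi> k l n" and P: "prime_divisor P n" and "squarefree n" and n: "n \<noteq> 0"
  shows "twisted_trace_op \<iota> k l n P f =
    slashA k l f (W_matrix n P) + scale_fun (ofA P powi (int l - int k)) (U_op \<iota> k l P f)"
proof -
  obtain m where m: "n = P * m" "\<not> P dvd m" "n div P = m" by (rule prime_divisor_cofactor[OF P assms(3)])
  have irr: "irreducible P" and Pn: "P dvd n" using P by (simp_all add: prime_divisor_def)
  have P0: "P \<noteq> 0" using Pn n by auto
  obtain b d where W: "W_matrix n P = mat2 P b n (P * d)" "P * d - m * b = 1"
    by (rule W_matrix_props[OF irr m(2,1)])
  have WAL: "W_matrix n P \<in> AL n P" by (rule W_matrix_AL[OF irr m(2,1)])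
  note fs = cusp_forms_supported[OF f] and finv = cusp_forms_invariant[OF f]
  let ?g = "slashA k l f (W_matrix n P)" and ?D = "{Q. degree Q < degree P}"
  let ?r = "coset_rep P m b d"
  have gs: "supported ?g" by (rule slash_A_supported[OF fs])
  have ginv: "slashA k l ?g \<gamma> = ?g" if "\<gamma> \<in> Gamma0 n" for \<gamma>
    by (rule slash_A_AL_invariant[OF fs finv WAL Pn P0 that])
  have tr: "trace_op \<iota> k l n P ?g = (\<lambda>z. \<Sum>i\<in>insert None (Some ` ?D). slashA k l ?g (?r i) z)"
    by (rule trace_op_reps[OF gs ginv])
       (simp_all only: m(3) coset_rep_Gamma0[OF W(2)] coset_rep_unique[OF irr m(2,1) W(2)])
  have Q: "slashA k l ?g (?r (Some Q)) = slashA k l f (mat2 1 Q 0 P)" for Q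
  proof -
    have "slashA k l ?g (?r (Some Q)) = slashA k l f (W_matrix n P ** ?r (Some Q))"
      by (rule slash_A_slash_A[OF fs AL_det_nz[OF WAL P0] Gamma0_det_nz[OF coset_rep_Gamma0[OF W(2)]]])
    also have "W_matrix n P ** ?r (Some Q) = mat2 1 Q 0 P" unfolding W(1) by (rule W_coset_rep[OF W(2) m(1)])
    finally show ?thesis .
  qed
  have N: "slashA k l ?g (?r None) = ?g" by (simp add: coset_rep_def slash_A_one)
  show ?thesis
  proof
    fix z
    have "twisted_trace_op \<iota> k l n P f z = ?g z + (\<Sum>Q\<in>?D. slashA k l f (mat2 1 Q 0 P) z)"
      unfolding twisted_trace_op_def tr
      by (subst sum.insert) (simp_all add: finite_degree_less sum.reindex Q N)
    moreover have "ofA P powi (int l - int k) * U_op \<iota> k l P f z = (\<Sum>Q\<in>?D. slashA k l f (mat2 1 Q 0 P) z)"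
    proof -
      have "ofA P powi (int l - int k) * ofA P powi (int k - int l) = 1"
        using P0 by (simp flip: power_int_add)
      thus ?thesis by (simp add: U_op_def flip: mult.assoc)
    qed
    ultimately show "twisted_trace_op \<iota> k l n P f z =
        (?g + scale_fun (ofA P powi (int l - int k)) (U_op \<iota> k l P f)) z"
      by (simp add: scale_fun_def)
  qed
qed

text \<open>
  Conjugation by \<open>W\<close> permutes the cosets, as \<open>W\<close> normalizes the groups of both levels.
\<close>

lemma trace_op_AL:
  assumes h: "supported h" "\<And>\<gamma>. \<gamma> \<in> Gamma0 n \<Longrightarrow> slashA k l h \<gamma> = h"
    and P': "prime_divisor P' n" and sf: "squarefree n" and n: "n \<noteq> 0"
    and W: "W \<in> AL n P" and P: "P dvd n div P'"
  shows "trace_op \<iota> k l n P' (slashA k l h W) = slashA k l (trace_op \<iota> k l n P' h) W"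
proof -
  obtain m where m: "n = P' * m" "\<not> P' dvd m" "n div P' = m" by (rule prime_divisor_cofactor[OF P' sf])
  have irr: "irreducible P'" using P' by (simp add: prime_divisor_def)
  obtain b d where bd: "W_matrix n P' = mat2 P' b n (P' * d)" "P' * d - m * b = 1"
    by (rule W_matrix_props[OF irr m(2,1)])
  have Pm: "P dvd m" using P by (simp only: m(3))
  have Pn: "P dvd n" unfolding m(1) using Pm by simp
  have P0: "P \<noteq> 0" using Pn n by auto
  have mn: "m dvd n" unfolding m(1) by simp
  have Wm: "W \<in> AL m P" by (rule AL_level_dvd[OF W mn])
  have detW: "det W \<noteq> 0" by (rule AL_det_nz[OF W P0])
  let ?D = "insert None (Some ` {Q. degree Q < degree P'})" and ?r = "coset_rep P' m b d"
  let ?g = "slashA k l h W"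
  have r\<Gamma>: "?r i \<in> Gamma0 m" for i by (rule coset_rep_Gamma0[OF bd(2)])
  have "\<exists>\<gamma>. \<gamma> \<in> Gamma0 m \<and> W ** ?r i = \<gamma> ** W" for i
    by (rule AL_left_coset[OF AL_Gamma0_right[OF Wm Pm r\<Gamma>] Wm Pm P0, of i]) blast
  then obtain r' where r': "\<And>i. r' i \<in> Gamma0 m" "\<And>i. W ** ?r i = r' i ** W" by metis
  have gs: "supported ?g" by (rule slash_A_supported[OF h(1)])
  have ginv: "slashA k l ?g \<gamma> = ?g" if "\<gamma> \<in> Gamma0 n" for \<gamma>
    by (rule slash_A_AL_invariant[OF h W Pn P0 that])
  have "trace_op \<iota> k l n P' ?g = (\<lambda>z. \<Sum>i\<in>?D. slashA k l ?g (?r i) z)"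
    by (rule trace_op_reps[OF gs ginv])
       (simp_all only: m(3) r\<Gamma> coset_rep_unique[OF irr m(2,1) bd(2)])
  also have "\<dots> = (\<lambda>z. \<Sum>i\<in>?D. slashA k l (slashA k l h (r' i)) W z)"
  proof (intro ext sum.cong refl)
    fix z i
    have "slashA k l ?g (?r i) = slashA k l h (W ** ?r i)"
      by (rule slash_A_slash_A[OF h(1) detW Gamma0_det_nz[OF r\<Gamma>]])
    also have "\<dots> = slashA k l (slashA k l h (r' i)) W"
      unfolding r'(2) by (rule slash_A_slash_A[OF h(1) Gamma0_det_nz[OF r'(1)] detW, symmetric])
    finally show "slashA k l ?g (?r i) z = slashA k l (slashA k l h (r' i)) W z" by simp
  qed
  also have "\<dots> = slashA k l (\<lambda>z. \<Sum>i\<in>?D. slashA k l h (r' i) z) W"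
    by (rule ext, rule mat2_cases[of W]) (simp only: slash_A_mat2 sum_distrib_left)
  also have "(\<lambda>z. \<Sum>i\<in>?D. slashA k l h (r' i) z) = trace_op \<iota> k l n P' h"
  proof (rule trace_op_reps[OF h, symmetric])
    show "r' i \<in> Gamma0 (n div P')" for i unfolding m(3) by (rule r'(1))
    fix \<gamma> assume "\<gamma> \<in> Gamma0 (n div P')"
    hence \<gamma>: "\<gamma> \<in> Gamma0 m" by (simp only: m(3))
    obtain \<gamma>' where \<gamma>': "\<gamma>' \<in> Gamma0 m" "\<gamma> ** W = W ** \<gamma>'"
      by (rule AL_right_coset[OF AL_Gamma0_left[OF Wm Pm \<gamma>] Wm Pm P0])
    have "(\<exists>\<delta>\<in>Gamma0 n. \<gamma> = \<delta> ** r' i) \<longleftrightarrow> (\<exists>\<delta>\<in>Gamma0 n. \<gamma>' = \<delta> ** ?r i)" for i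
    proof
      assume "\<exists>\<delta>\<in>Gamma0 n. \<gamma> = \<delta> ** r' i"
      then obtain \<delta> where \<delta>: "\<delta> \<in> Gamma0 n" "\<gamma> = \<delta> ** r' i" by blast
      obtain \<delta>' where \<delta>': "\<delta>' \<in> Gamma0 n" "\<delta> ** W = W ** \<delta>'"
        by (rule AL_right_coset[OF AL_Gamma0_left[OF W Pn \<delta>(1)] W Pn P0])
      have "W ** \<gamma>' = \<delta> ** (r' i ** W)" unfolding \<gamma>'(2)[symmetric] \<delta>(2) by (simp only: matrix_mul_assoc)
      also have "\<dots> = (\<delta> ** W) ** ?r i" unfolding r'(2)[symmetric] by (simp only: matrix_mul_assoc)
      also have "\<dots> = W ** (\<delta>' ** ?r i)" unfolding \<delta>'(2) by (simp only: matrix_mul_assoc)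
      finally have "\<gamma>' = \<delta>' ** ?r i" using detW by (rule mat2_mult_cancel_left)
      thus "\<exists>\<delta>\<in>Gamma0 n. \<gamma>' = \<delta> ** ?r i" using \<delta>'(1) by (rule bexI)
    next
      assume "\<exists>\<delta>\<in>Gamma0 n. \<gamma>' = \<delta> ** ?r i"
      then obtain \<delta> where \<delta>: "\<delta> \<in> Gamma0 n" "\<gamma>' = \<delta> ** ?r i" by blast
      obtain \<delta>' where \<delta>': "\<delta>' \<in> Gamma0 n" "W ** \<delta> = \<delta>' ** W"
        by (rule AL_left_coset[OF AL_Gamma0_right[OF W Pn \<delta>(1)] W Pn P0])
      have "\<gamma> ** W = (W ** \<delta>) ** ?r i" unfolding \<gamma>'(2) \<delta>(2) by (simp only: matrix_mul_assoc)
      also have "\<dots> = \<delta>' ** (W ** ?r i)" unfolding \<delta>'(2) by (simp only: matrix_mul_assoc)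
      also have "\<dots> = (\<delta>' ** r' i) ** W" unfolding r'(2) by (simp only: matrix_mul_assoc)
      finally have "\<gamma> = \<delta>' ** r' i" using detW by (rule mat2_mult_cancel_right)
      thus "\<exists>\<delta>\<in>Gamma0 n. \<gamma> = \<delta> ** r' i" using \<delta>'(1) by (rule bexI)
    qed
    thus "\<exists>!i. i \<in> ?D \<and> (\<exists>\<delta>\<in>Gamma0 n. \<gamma> = \<delta> ** r' i)"
      using coset_rep_unique[OF irr m(2,1) bd(2) \<gamma>'(1)] by (simp only:)
  qed
  finally show ?thesis .
qed

section \<open>Newforms\<close>

lemma new_cusp_forms_subspace: "module.subspace scale_fun (new_cusp_forms \<iota> \<pi> k l n)"
proof -
  interpret vector_space "scale_fun :: 'c \<Rightarrow> ('c \<Rightarrow> 'c) \<Rightarrow> 'c \<Rightarrow> 'c" by (rule vector_space_scale_fun)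
  have "scale_fun c 0 = (0 :: 'c \<Rightarrow> 'c)" for c :: 'c by simp
  thus ?thesis
    unfolding subspace_def
    by (auto simp: new_cusp_forms_def cusp_forms_0 cusp_forms_add cusp_forms_scale twisted_trace_op_def
      trace_op_0 trace_op_add trace_op_scale slash_A_0 slash_A_add slash_A_scale)
qed

lemma U_op_new:
  assumes f: "f \<in> new_cusp_forms \<iota> \<pi> k l n" and P: "prime_divisor P n" and sf: "squarefree n" and n: "n \<noteq> 0"
  shows "U_op \<iota> k l P f = scale_fun (- (ofA P powi (int k - int l))) (slashA k l f (W_matrix n P))"
proof
  fix z
  have P0: "P \<noteq> 0" using P n by (auto simp: prime_divisor_def)
  have f': "f \<in> cusp_forms \<iota> \<pi> k l n" and "twisted_trace_op \<iota> k l n P f = 0"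
    using f P by (simp_all add: new_cusp_forms_def)
  hence "slashA k l f (W_matrix n P) + scale_fun (ofA P powi (int l - int k)) (U_op \<iota> k l P f) = 0"
    using twisted_trace_eq[OF f' P sf n] by simp
  hence "slashA k l f (W_matrix n P) z + ofA P powi (int l - int k) * U_op \<iota> k l P f z = 0"
    by (simp add: fun_eq_iff scale_fun_def)
  hence "ofA P powi (int l - int k) * U_op \<iota> k l P f z = - slashA k l f (W_matrix n P) z"
    by (simp add: add_eq_0_iff)
  hence "ofA P powi (int k - int l) * (ofA P powi (int l - int k) * U_op \<iota> k l P f z) =
      ofA P powi (int k - int l) * - slashA k l f (W_matrix n P) z" by (rule arg_cong)
  moreover have "ofA P powi (int k - int l) * ofA P powi (int l - int k) = 1"
    using P0 by (simp flip: power_int_add)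
  ultimately show "U_op \<iota> k l P f z =
      scale_fun (- (ofA P powi (int k - int l))) (slashA k l f (W_matrix n P)) z"
    by (simp add: scale_fun_def flip: mult.assoc)
qed

text \<open>
  For \<open>P\<close> itself \<open>W\<close> exchanges the two trace conditions, up to the scalar \<open>W\<^sup>2\<close>.  For the other primes the traces
  commute with the action of \<open>W\<close>.
\<close>

lemma new_cusp_forms_W:
  assumes f: "f \<in> new_cusp_forms \<iota> \<pi> k l n" and P: "prime_divisor P n" and sf: "squarefree n" and n: "n \<noteq> 0"
  shows "slashA k l f (W_matrix n P) \<in> new_cusp_forms \<iota> \<pi> k l n"
proof -
  have WAL: "W_matrix n P \<in> AL n P" if "prime_divisor P n" for P
    by (rule W_matrix_AL_prime_divisor[OF that sf])
  let ?W = "W_matrix n P"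
  have Pn: "P dvd n" and P0: "P \<noteq> 0" using P n by (auto simp: prime_divisor_def)
  have fc: "f \<in> cusp_forms \<iota> \<pi> k l n"
    and tr: "\<And>P. prime_divisor P n \<Longrightarrow> trace_op \<iota> k l n P f = 0"
    and tw: "\<And>P. prime_divisor P n \<Longrightarrow> trace_op \<iota> k l n P (slashA k l f (W_matrix n P)) = 0"
    using f by (simp_all add: new_cusp_forms_def twisted_trace_op_def)
  note fs = cusp_forms_supported[OF fc] and finv = cusp_forms_invariant[OF fc]
  have "slashA k l f ?W \<in> cusp_forms \<iota> \<pi> k l n" by (rule cusp_forms_AL[OF fc WAL[OF P] Pn n])
  moreover have "trace_op \<iota> k l n P' (slashA k l f ?W) = 0 \<and>
      trace_op \<iota> k l n P' (slashA k l (slashA k l f ?W) (W_matrix n P')) = 0"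
    if P': "prime_divisor P' n" for P'
  proof (cases "P' = P")
    case True
    have "trace_op \<iota> k l n P (slashA k l (slashA k l f ?W) ?W) = 0"
      unfolding slash_A_AL_twice[OF fc WAL[OF P] Pn P0] trace_op_scale tr[OF P]
      by (simp add: scale_fun_def fun_eq_iff)
    thus ?thesis using tw[OF P] True by simp
  next
    case False
    let ?W' = "W_matrix n P'"
    have P'n: "P' dvd n" and P'0: "P' \<noteq> 0" using P' n by (auto simp: prime_divisor_def)
    obtain t where t: "n = P * P' * t" by (rule distinct_prime_divisors[OF P P' False[symmetric]])
    have "n = P' * (P * t)" unfolding t by (simp only: mult_ac)
    hence "n div P' = P * t" using P'0 by simp
    hence dvd: "P dvd n div P'" by simp
    have PP': "P * P' dvd n" unfolding t by (rule dvd_triv_left)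
    have "trace_op \<iota> k l n P' (slashA k l f ?W) = slashA k l (trace_op \<iota> k l n P' f) ?W"
      by (rule trace_op_AL[OF fs finv P' sf n WAL[OF P] dvd])
    hence "trace_op \<iota> k l n P' (slashA k l f ?W) = 0" by (simp only: tr[OF P'] slash_A_0)
    moreover have "trace_op \<iota> k l n P' (slashA k l (slashA k l f ?W) ?W') = 0"
    proof -
      note gc = cusp_forms_AL[OF fc WAL[OF P'] P'n n]
      have "trace_op \<iota> k l n P' (slashA k l (slashA k l f ?W') ?W) =
          slashA k l (trace_op \<iota> k l n P' (slashA k l f ?W')) ?W"
        by (rule trace_op_AL[OF cusp_forms_supported[OF gc] cusp_forms_invariant[OF gc] P' sf n WAL[OF P] dvd])
      thus ?thesis
        by (simp only: slash_A_AL_commute[OF fc WAL[OF P] WAL[OF P'] PP' n] tw[OF P'] slash_A_0)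
    qed
    ultimately show ?thesis ..
  qed
  ultimately show ?thesis by (simp add: new_cusp_forms_def twisted_trace_op_def)
qed

lemma U_op_diagonalizable:
  assumes odd: "odd CARD('q)" and n: "n \<noteq> 0" and sf: "squarefree n"
  shows "simultaneously_diagonalizable scale_fun
           {U_op \<iota> k l P | P. prime_divisor P n} (new_cusp_forms \<iota> \<pi> k l n)"
proof -
  let ?V = "new_cusp_forms \<iota> \<pi> k l n" and ?\<U> = "{U_op \<iota> k l P | P. prime_divisor P n}"
  interpret vs: vector_space "scale_fun :: 'c \<Rightarrow> ('c \<Rightarrow> 'c) \<Rightarrow> 'c \<Rightarrow> 'c" by (rule vector_space_scale_fun)
  have sub: "vs.subspace ?V" by (rule new_cusp_forms_subspace)
  have WAL: "W_matrix n P \<in> AL n P" if "prime_divisor P n" for P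
    by (rule W_matrix_AL_prime_divisor[OF that sf])
  have scale_scale: "scale_fun a (scale_fun b f) = scale_fun (a * b) f" for a b and f :: "'c \<Rightarrow> 'c"
    by (rule vs.scale_scale)
  have stable: "U_op \<iota> k l P f \<in> ?V" if f: "f \<in> ?V" and P: "prime_divisor P n" for P f
    unfolding U_op_new[OF f P sf n] by (rule vs.subspace_scale[OF sub new_cusp_forms_W[OF f P sf n]])
  have UU: "U_op \<iota> k l P (U_op \<iota> k l P' f) =
      scale_fun (ofA P powi (int k - int l) * ofA P' powi (int k - int l))
        (slashA k l (slashA k l f (W_matrix n P')) (W_matrix n P))"
    if f: "f \<in> ?V" and P: "prime_divisor P n" and P': "prime_divisor P' n" for P P' f
  proof -
    have "U_op \<iota> k l P (U_op \<iota> k l P' f) =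
        scale_fun (- (ofA P powi (int k - int l))) (slashA k l (U_op \<iota> k l P' f) (W_matrix n P))"
      by (rule U_op_new[OF stable[OF f P'] P sf n])
    thus ?thesis
      by (simp only: U_op_new[OF f P' sf n] slash_A_scale scale_scale minus_mult_minus)
  qed
  show ?thesis
  proof (rule simultaneously_diagonalizable_commuting_involutions[OF vector_space_scale_fun two_neq_0[OF odd] _ sub])
    \<comment> \<open>Over a finite field there are only finitely many polynomials of bounded degree.\<close>
    have "finite {P. prime_divisor P n}"
    proof (rule finite_subset[OF _ finite_lowdeg])
      show "{P. prime_divisor P n} \<subseteq> lowdeg (Suc (degree n))"
        using n by (auto simp: prime_divisor_def lowdeg_iff less_Suc_eq_le intro: dvd_imp_degree_le)
    qed
    thus "finite ?\<U>" by simp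
  next
    fix U U' and v w :: "'c \<Rightarrow> 'c" and c
    assume U: "U \<in> ?\<U>"
    then obtain P where P: "U = U_op \<iota> k l P" "prime_divisor P n" by blast
    show "U (v + w) = U v + U w"
      by (simp add: P(1) U_op_def slash_A_add sum.distrib distrib_left fun_eq_iff)
    show "U (scale_fun c v) = scale_fun c (U v)"
      by (simp add: P(1) U_op_def slash_A_scale) (simp add: scale_fun_def sum_distrib_left mult_ac)
    show "\<exists>s. s \<noteq> 0 \<and> (\<forall>v\<in>?V. U (U v) = scale_fun (s * s) v)"
    proof -
      have Pn: "P dvd n" and P0: "P \<noteq> 0" using P(2) n by (auto simp: prime_divisor_def)
      \<comment> \<open>\<open>P\<^sup>k\<close> has a square root in \<open>C\<close>, already in the image of the algebraic closure.\<close>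
      obtain y where y: "y ^ 2 = (to_ac (poly_to_K P) :: 'q fls alg_closure) ^ k"
        using nth_root_exists[of 2 "to_ac (poly_to_K P) ^ k"] by auto
      have \<iota>_power: "\<iota> (x ^ i) = \<iota> x ^ i" for x i by (induction i) (simp_all add: \<iota>_one \<iota>_mult)
      have ss: "\<iota> y * \<iota> y = ofA P ^ k"
        using arg_cong[OF y, of \<iota>] by (simp add: \<iota>_power of_A_def of_K_def power2_eq_square \<iota>_mult)
      have "\<iota> y \<noteq> 0" using ss P0 by auto
      moreover have "U (U v) = scale_fun (\<iota> y * \<iota> y) v" if v: "v \<in> ?V" for v
      proof -
        have vc: "v \<in> cusp_forms \<iota> \<pi> k l n" using v by (simp add: new_cusp_forms_def)
        have "ofA P powi (int k - int l) * ofA P powi (int k - int l) * ofA P powi (2 * int l - int k)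
            = ofA P powi int k"
          using P0 by (simp flip: power_int_add)
        hence "ofA P powi (int k - int l) * ofA P powi (int k - int l) * ofA P powi (2 * int l - int k)
            = \<iota> y * \<iota> y" by (simp add: ss)
        thus ?thesis
          unfolding P(1) UU[OF v P(2) P(2)] slash_A_AL_twice[OF vc WAL[OF P(2)] Pn P0] scale_scale by simp
      qed
      ultimately show ?thesis by blast
    qed
    assume v: "v \<in> ?V"
    show "U v \<in> ?V" unfolding P(1) by (rule stable[OF v P(2)])
    assume "U' \<in> ?\<U>"
    then obtain P' where P': "U' = U_op \<iota> k l P'" "prime_divisor P' n" by blast
    show "U (U' v) = U' (U v)"
    proof (cases "P = P'")
      case False
      have vc: "v \<in> cusp_forms \<iota> \<pi> k l n" using v by (simp add: new_cusp_forms_def)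
      obtain t where t: "n = P * P' * t" by (rule distinct_prime_divisors[OF P(2) P'(2) False])
      have "P * P' dvd n" unfolding t by (rule dvd_triv_left)
      from slash_A_AL_commute[OF vc WAL[OF P(2)] WAL[OF P'(2)] this n]
      show ?thesis unfolding P(1) P'(1) UU[OF v P(2) P'(2)] UU[OF v P'(2) P(2)] by (simp only: mult.commute)
    qed (simp add: P(1) P'(1))
  qed
qed

end

section \<open>Simultaneous diagonalization\<close>

theorem corollary5p6:
  fixes \<iota> :: "'q::{finite,field} fls alg_closure \<Rightarrow> 'c::{field,complete_space}"
    and \<pi> :: 'c
    and n :: "'q poly"
    and k l :: nat
  assumes "odd CARD('q)"
    and "completed_alg_closure \<iota>"
    and "carlitz_period \<iota> \<pi>"
    and "lead_coeff n = 1"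
    and "squarefree n"
    and "k \<ge> 1"
    and "l \<le> CARD('q) - 2"
    and "[k = 2 * l] (mod (CARD('q) - 1))"
  shows "simultaneously_diagonalizable scale_fun
           {U_op \<iota> k l P | P. prime_divisor P n} (new_cusp_forms \<iota> \<pi> k l n)"
proof -
  interpret carlitz_lattice \<iota> \<pi>
    using assms(2,3) by (intro carlitz_lattice.intro carlitz_lattice_axioms.intro)
  have "n \<noteq> 0" using assms(4) by auto
  thus ?thesis using assms(1,5) by (intro U_op_diagonalizable)
qed

end
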